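(* Let $X_1,X_2,\dots$ be i.i.d. real random variables with $\mathbf E X_1=0$ and $\mathbf E X_1^2\in(0,\infty)$, and let $S_0=0$, $S_n=X_1+\dots+X_n$. Assume that $\mathbf E|X_1|^{r+3}<\infty$ for some integer $r\ge 0$, and that either the distribution of $X_1$ is lattice with maximal span $1$, or $\limsup_{|t|\to\infty}|\mathbf E e^{itX_1}|<1$. Let $\tau_0=\inf\{n\ge1: S_n\le 0\}$ and $\overline\tau_0=\inf\{n\ge 1:S_n<0\}$, and let $\delta_r=1$ if $r$ is odd and $\delta_r=0$ if $r$ is even. Then there exist real numbers $\nu_1,\dots,\nu_{\lfloor r/2\rfloor+1}$ such that $$\mathbf P(\tau_0>n)=\sum_{j=1}^{\lfloor r/2\rfloor+1}\nu_j a_n^{(j)}+O\left(\frac{\log^{\delta_r}n}{n^{(r+2)/2}}\right),\qquad n\to\infty .$$ Furthermore, there exist real numbers $\overline\nu_1,\dots,\overline\nu_{\lfloor r/2\rfloor+1}$ such that $$\mathbf P(\overline\tau_0>n)=\sum_{j=1}^{\lfloor r/2\rfloor+1}\overline\nu_j a_n^{(j)}+O\left(\frac{\log^{\delta_r}n}{n^{(r+2)/2}}\right),\qquad n\to\infty .$$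
   Context: For integers $j\ge1$, $n\ge0$: $a_n^{(j)}:=[s^n](1-s)^{j-3/2}=(-1)^n\binom{j-3/2}{n}$, where $[s^n]f(s)$ is the coefficient of $s^n$ in the power series $f$ and $\binom{\gamma}{n}=\gamma(\gamma-1)\cdots(\gamma-n+1)/n!$. "Lattice with maximal span $1$" means that $X_1$ takes values in $\mathbb Z$ and there are no integers $a$ and $h\ge2$ with $\mathbf P(X_1\in a+h\mathbb Z)=1$. *)

theory Defs
  imports "HOL-Probability.Probability"
begin

definition partial_sum :: "(nat \<Rightarrow> 'a \<Rightarrow> real) \<Rightarrow> nat \<Rightarrow> 'a \<Rightarrow> real" where
  "partial_sum X n \<omega> = (\<Sum>i=1..n. X i \<omega>)"

text \<open>The stopping times are extended naturals, because the infimum over the empty set is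
  \<open>\<infinity>\<close>.\<close>

definition tau0 :: "(nat \<Rightarrow> 'a \<Rightarrow> real) \<Rightarrow> 'a \<Rightarrow> enat" where
  "tau0 X \<omega> = (INF n \<in> {n. 1 \<le> n \<and> partial_sum X n \<omega> \<le> 0}. enat n)"

definition tau0_bar :: "(nat \<Rightarrow> 'a \<Rightarrow> real) \<Rightarrow> 'a \<Rightarrow> enat" where
  "tau0_bar X \<omega> = (INF n \<in> {n. 1 \<le> n \<and> partial_sum X n \<omega> < 0}. enat n)"

definition lattice_max_span_1 :: "real measure \<Rightarrow> bool" where
  "lattice_max_span_1 \<mu> \<longleftrightarrow>
     measure \<mu> \<int> = 1 \<and>
     \<not> (\<exists>(a::int) (h::int). h \<ge> 2 \<and> measure \<mu> (range (\<lambda>k::int. real_of_int (a + h * k))) = 1)"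

definition acoeff :: "nat \<Rightarrow> nat \<Rightarrow> real" where
  "acoeff j n = (-1) ^ n * ((real j - 3 / 2) gchoose n)"

lemma acoeff_sums:
  assumes "\<bar>s\<bar> < 1"
  shows "(\<lambda>n. acoeff j n * s ^ n) sums (1 - s) powr (real j - 3 / 2)"
proof -
  have "(\<lambda>n. ((real j - 3 / 2) gchoose n) * (- s) ^ n) sums (1 + (- s)) powr (real j - 3 / 2)"
    by (rule gen_binomial_real) (use assms in simp)
  moreover have "((real j - 3 / 2) gchoose n) * (- s) ^ n = acoeff j n * s ^ n" for n
    by (simp add: acoeff_def power_minus[of s])
  ultimately show ?thesis by simp
qed

end

(*
  A cyclic rearrangement argument shows that the generating functions
  p(s) = sum_n P(tau_0 > n) s^n  and  U(s) = sum_{n >= 1} P(S_n > 0) s^n / n  satisfy  p' = U' p.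

  Fourier inversion, with a Gaussian smoothing of the sign function on a scale n^(-(r+1)) in the
  smooth case and with the kernel cot(t/2) in the lattice case, turns P(S_n > 0) into an integral
  of phi(t)^n over a neighbourhood of 0.  There phi(t) = exp(-b t^2) (1 + w(t)) with w(t) = O(t^3);
  expanding (1 + w)^n and keeping the real part leaves only half-integer powers:
  P(S_n > 0) = 1/2 + sum_{odd j <= r} c_j n^(-j/2) + O(n^(-(r+1)/2)).

  The same lemma applied to phi(t) = cos(t/2)^2, whose integral is Wallis' product acoeff 1 n,
  allows one to trade powers of n for the sequences acoeff l.  With y = (1 - s)^(1/2) it follows that
  y p = const * exp(y P(s)) * exp(E(s)), where P is a polynomial and E has coefficients
  O(n^(-(r+3)/2)).  Splitting the exponential series of y P into even and odd powers gives
  exp(y P) = C + y S with entire C and S, hence p = y^(-1) f + g where f and g have coefficients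
  O(n^(-(r+3)/2)).  A discrete Taylor expansion of the coefficients of y^(-1) finishes the proof;
  for odd r it produces a harmonic sum, which is the source of the logarithm.
*)
theory Submission
  imports Defs "HOL-Computational_Algebra.Polynomial"
begin

unbundle no vec_syntax
unbundle fps_syntax

section \<open>The Sparre Andersen recursion\<close>

text \<open>The constant 1/2 in P(S_n > 0) puts sum_n s^n / (2n) = -log(1-s)/2 into the exponent;
  this is the factor y^(-1). For the rest parity is decisive: an integer power of 1/n in P(S_n > 0)
  would put a term (1-s)^m log(1-s) into the exponent, which no combination of the a^(j) can absorb.
  Hence local expansions are kept in powers of i t with real coefficients, so that real parts lose
  all odd powers.

  The exponential is the second obstacle. The coefficients of y decay only like n^(-3/2), and
  estimates of exp(y P) by absolute values cannot go beyond that rate. But (y P)^2 = (1-s) P^2 is a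
  polynomial, so the even and the odd part of the series inherit every polynomial rate, and y enters
  only once, linearly, where y^(-1) cancels it.

  The moment count r + 3 reflects the cubic order of w: dividing by t^3 leaves r known orders. Both
  stopping times are served by one argument about a set of reals closed under addition together with
  its complement.\<close>

definition psum :: "(nat \<Rightarrow> real) \<Rightarrow> nat \<Rightarrow> real" where
  "psum x j = (\<Sum>i<j. x i)"

lemma psum_add: "psum x (a + j) = psum x a + psum (\<lambda>i. x (a + i)) j"
  by (induction j) (simp_all add: psum_def)

lemma psum_cong: "(\<And>i. i < n \<Longrightarrow> x i = y i) \<Longrightarrow> psum x n = psum y n"
  by (simp add: psum_def)

lemma psum_0 [simp]: "psum x 0 = 0"
  by (simp add: psum_def)

text \<open>The intended instances are (0, oo) and [0, oo). Closure of the complement under addition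
  makes both \<open>pos (b - a)\<close> and its negation transitive in (a, b), so the predicate
  orders the levels of the walk and encodes how ties count.\<close>

locale half_line =
  fixes pos :: "real \<Rightarrow> bool"
  assumes pos_add: "pos a \<Longrightarrow> pos b \<Longrightarrow> pos (a + b)"
    and npos_add: "\<not> pos a \<Longrightarrow> \<not> pos b \<Longrightarrow> \<not> pos (a + b)"
    and pos_meas [measurable]: "Measurable.pred borel pos"
begin

definition stays :: "nat \<Rightarrow> (nat \<Rightarrow> real) \<Rightarrow> bool" where
  "stays n x \<longleftrightarrow> (\<forall>j\<in>{1..n}. pos (psum x j))"

text \<open>Read backwards: the walk with its \<open>k\<close> steps reversed has the partial sums
  \<open>psum x k - psum x j\<close>, so \<open>k\<close> is the first time at which the reversed
  walk enters the half-line.\<close>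

definition ladder :: "nat \<Rightarrow> (nat \<Rightarrow> real) \<Rightarrow> bool" where
  "ladder k x \<longleftrightarrow> pos (psum x k) \<and> (\<forall>j\<in>{1..<k}. \<not> pos (psum x k - psum x j))"

text \<open>The path is cut at the last index \<open>n - k\<close> before \<open>n\<close> from
  which the increment up to time \<open>n\<close> is \<open>pos\<close>;
  \<open>last_block_iff\<close> makes this explicit.\<close>

definition last_block :: "nat \<Rightarrow> nat \<Rightarrow> (nat \<Rightarrow> real) \<Rightarrow> bool" where
  "last_block n k x \<longleftrightarrow> stays (n - k) x \<and> ladder k (\<lambda>i. x (n - k + i))"

lemma pos_trans: "pos (b - a) \<Longrightarrow> pos (c - b) \<Longrightarrow> pos (c - a)"
  using pos_add[of "b - a" "c - b"] by simp

lemma npos_trans: "\<not> pos (b - a) \<Longrightarrow> \<not> pos (c - b) \<Longrightarrow> \<not> pos (c - a)"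
  using npos_add[of "b - a" "c - b"] by simp

lemma stays_cong: "(\<And>i. i < n \<Longrightarrow> x i = y i) \<Longrightarrow> stays n x = stays n y"
  unfolding stays_def by (intro ball_cong refl) (auto cong: psum_cong)

lemma ladder_cong:
  assumes "\<And>i. i < n \<Longrightarrow> x i = y i"
  shows "ladder n x = ladder n y"
proof -
  have "psum x j = psum y j" if "j \<le> n" for j using assms that by (intro psum_cong) auto
  thus ?thesis unfolding ladder_def by auto
qed

lemma last_block_cong:
  assumes "k \<le> n" "\<And>i. i < n \<Longrightarrow> x i = y i"
  shows "last_block n k x = last_block n k y"
proof -
  have "stays (n - k) x = stays (n - k) y" using assms by (intro stays_cong) auto
  moreover have "ladder k (\<lambda>i. x (n - k + i)) = ladder k (\<lambda>i. y (n - k + i))"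
    using assms by (intro ladder_cong) auto
  ultimately show ?thesis by (simp add: last_block_def)
qed

text \<open>Inside the last block \<open>psum x n - psum x j\<close> is never \<open>pos\<close>
  although \<open>psum x n\<close> is, so \<open>npos_add\<close> forces \<open>psum x j\<close> to
  be \<open>pos\<close>. The conditions on the block thus already keep the whole path in the
  half-line.\<close>

lemma last_block_iff:
  assumes "1 \<le> k" "k \<le> n"
  shows "last_block n k x \<longleftrightarrow> stays n x \<and> pos (psum x n - psum x (n - k)) \<and>
           (\<forall>j\<in>{n-k<..<n}. \<not> pos (psum x n - psum x j))"
proof -
  let ?z = "\<lambda>i. x (n - k + i)"
  have z: "psum ?z j = psum x (n - k + j) - psum x (n - k)" for j
    by (simp add: psum_add)
  have zk: "psum ?z k - psum ?z j = psum x n - psum x (n - k + j)" for j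
    using assms by (simp only: z) simp
  have zk0: "psum ?z k = psum x n - psum x (n - k)"
    using z[of k] assms by simp
  have L: "ladder k ?z \<longleftrightarrow> pos (psum x n - psum x (n - k)) \<and>
           (\<forall>j\<in>{n-k<..<n}. \<not> pos (psum x n - psum x j))" (is "_ \<longleftrightarrow> ?P \<and> ?Q")
  proof -
    have "(\<forall>j\<in>{1..<k}. \<not> pos (psum x n - psum x (n - k + j))) \<longleftrightarrow> ?Q"
    proof safe
      fix j assume a: "\<forall>j\<in>{1..<k}. \<not> pos (psum x n - psum x (n - k + j))" "j \<in> {n-k<..<n}" "pos (psum x n - psum x j)"
      from a(2) have "j - (n - k) \<in> {1..<k}" "n - k + (j - (n - k)) = j" using assms by auto
      with a show False by metis
    next
      fix j assume a: "?Q" "j \<in> {1..<k}" "pos (psum x n - psum x (n - k + j))"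
      have "n - k + j \<in> {n-k<..<n}" using a(2) assms by auto
      with a show False by blast
    qed
    moreover have "ladder k ?z \<longleftrightarrow> ?P \<and> (\<forall>j\<in>{1..<k}. \<not> pos (psum x n - psum x (n - k + j)))"
      unfolding ladder_def zk unfolding zk0 ..
    ultimately show ?thesis by blast
  qed
  have "stays n x" if "stays (n - k) x" "?P" "?Q"
    unfolding stays_def
  proof
    fix j assume j: "j \<in> {1..n}"
    have pn: "pos (psum x n)"
    proof (cases "n - k = 0")
      case True thus ?thesis using that(2) by simp
    next
      case False
      hence "pos (psum x (n - k))" using that(1) by (auto simp: stays_def)
      from pos_add[OF this that(2)] show ?thesis by simp
    qed
    show "pos (psum x j)"
    proof (cases "j \<le> n - k")
      case True thus ?thesis using that(1) j by (auto simp: stays_def)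
    next
      case False
      show ?thesis
      proof (cases "j = n")
        case False
        with \<open>\<not> j \<le> n - k\<close> j have "\<not> pos (psum x n - psum x j)" using that(3) by auto
        from npos_add[OF this, of "psum x j"] pn show ?thesis by auto
      qed (use pn in simp)
    qed
  qed
  moreover have "stays (n - k) x" if "stays n x" using that by (auto simp: stays_def)
  ultimately show ?thesis unfolding last_block_def L by blast
qed

lemma last_block_unique:
  assumes "1 \<le> k" "k \<le> n" "1 \<le> k'" "k' \<le> n" "last_block n k x" "last_block n k' x"
  shows "k = k'"
proof -
  note a = assms(5)[unfolded last_block_iff[OF assms(1,2)]]
  note b = assms(6)[unfolded last_block_iff[OF assms(3,4)]]
  have "\<not> n - k < n - k'"
  proof
    assume "n - k < n - k'"
    hence "n - k' \<in> {n-k<..<n}" using assms by auto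
    with a b show False by blast
  qed
  moreover have "\<not> n - k' < n - k"
  proof
    assume "n - k' < n - k"
    hence "n - k \<in> {n-k'<..<n}" using assms by auto
    with a b show False by blast
  qed
  ultimately show ?thesis using assms by linarith
qed

lemma stays_iff_last_block:
  assumes "1 \<le> n"
  shows "stays n x \<longleftrightarrow> (\<exists>k\<in>{1..n}. last_block n k x)"
proof
  assume st: "stays n x"
  let ?A = "{i. i < n \<and> pos (psum x n - psum x i)}"
  \<comment> \<open>Index 0 qualifies because \<open>psum x n\<close> itself is \<open>pos\<close>,
    so a last index exists.\<close>
  have "0 \<in> ?A" using st assms by (auto simp: stays_def)
  hence ne: "?A \<noteq> {}" by blast
  have fin: "finite ?A" by simp
  define i where "i = Max ?A"
  have i: "i \<in> ?A" unfolding i_def using fin ne by (rule Max_in)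
  have mx: "j \<le> i" if "j \<in> ?A" for j unfolding i_def using fin that by (rule Max_ge)
  have "last_block n (n - i) x"
    using i st mx assms by (subst last_block_iff) force+
  thus "\<exists>k\<in>{1..n}. last_block n k x" using i by (intro bexI[of _ "n - i"]) auto
next
  assume "\<exists>k\<in>{1..n}. last_block n k x"
  thus "stays n x" using last_block_iff by auto
qed

section \<open>Cyclic rearrangements of a finite walk\<close>

context
  fixes n :: nat and x :: "nat \<Rightarrow> real"
  assumes n: "1 \<le> n"
begin

definition cyclic_psum :: "nat \<Rightarrow> real" where "cyclic_psum j = psum (\<lambda>i. x (i mod n)) j"

lemma cyclic_psum_shift: "cyclic_psum (j + n) = cyclic_psum j + cyclic_psum n"
proof -
  have "cyclic_psum (n + j) = cyclic_psum n + cyclic_psum j"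
    unfolding cyclic_psum_def psum_add by simp
  thus ?thesis by (simp add: add.commute)
qed

text \<open>A position below all that follow it, with ties decided by \<open>pos\<close>. Looking at
  one period suffices: every later index differs from one in it by whole periods, and each period
  adds a \<open>pos\<close> amount.\<close>

definition cyclic_ladder :: "nat \<Rightarrow> bool" where
  "cyclic_ladder c \<longleftrightarrow> (\<forall>j\<in>{c<..c+n}. pos (cyclic_psum j - cyclic_psum c))"

lemma cyclic_ladder_shift: "cyclic_ladder (c + n) \<longleftrightarrow> cyclic_ladder c"
proof -
  have "{c+n<..c+n+n} = (\<lambda>j. j + n) ` {c<..c+n}"
  proof safe
    fix j assume "j \<in> {c+n<..c+n+n}"
    thus "j \<in> (\<lambda>j. j + n) ` {c<..c+n}" by (intro image_eqI[of _ _ "j - n"]) auto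
  qed auto
  thus ?thesis unfolding cyclic_ladder_def by (simp add: cyclic_psum_shift)
qed

lemma cyclic_ladder_later:
  assumes "cyclic_ladder c" "c < j" shows "pos (cyclic_psum j - cyclic_psum c)"
  using assms(2)
proof (induction j rule: less_induct)
  case (less j)
  show ?case
  proof (cases "j \<le> c + n")
    case True thus ?thesis using assms less by (auto simp: cyclic_ladder_def)
  next
    case False
    hence "pos (cyclic_psum (j - n) - cyclic_psum c)" using less n by auto
    moreover have "cyclic_psum j = cyclic_psum (j - n) + cyclic_psum n" using cyclic_psum_shift[of "j - n"] False by simp
    moreover have "pos (cyclic_psum n)" using assms(1) n unfolding cyclic_ladder_def
      by (metis add_diff_cancel_left' greaterThanAtMost_iff le_refl less_add_same_cancel1 less_le_trans cyclic_psum_shift zero_less_one)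
    ultimately show ?thesis using pos_add[of "cyclic_psum (j - n) - cyclic_psum c" "cyclic_psum n"] by (simp add: algebra_simps)
  qed
qed

text \<open>A minimum of the partial sums over one period works; \<open>pos\<close> decides whether
  the last or the first minimum is taken. Indices past the period are shifted back by
  \<open>n\<close>, which lowers their level by the \<open>pos\<close> amount
  \<open>cyclic_psum n\<close>.\<close>

lemma cyclic_ladder_exists:
  assumes "pos (cyclic_psum n)"
  shows "\<exists>c. cyclic_ladder c"
proof -
  \<comment> \<open>The invariant tracks the minimum among the indices up to \<open>m\<close>: later
    levels are \<open>pos\<close> above it, and it is not \<open>pos\<close> above any earlier
    one.\<close>
  have "\<exists>c\<le>m. (\<forall>j\<in>{c<..m}. pos (cyclic_psum j - cyclic_psum c)) \<and> (\<forall>j<c. \<not> pos (cyclic_psum c - cyclic_psum j))" for m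
  proof (induction m)
    case 0 show ?case by auto
  next
    case (Suc m)
    then obtain c where c: "c \<le> m" "\<forall>j\<in>{c<..m}. pos (cyclic_psum j - cyclic_psum c)" "\<forall>j<c. \<not> pos (cyclic_psum c - cyclic_psum j)"
      by blast
    show ?case
    proof (cases "pos (cyclic_psum (Suc m) - cyclic_psum c)")
      case True
      thus ?thesis using c by (intro exI[of _ c]) (auto simp: le_Suc_eq)
    next
      case False
      have "\<not> pos (cyclic_psum (Suc m) - cyclic_psum j)" if "j < Suc m" for j
      proof (cases j c rule: linorder_cases)
        case less thus ?thesis using c(3) False npos_trans by blast
      next
        case equal thus ?thesis using False by simp
      next
        case greater thus ?thesis using c(2) False that pos_trans
          by (metis greaterThanAtMost_iff less_Suc_eq_le)
      qed
      thus ?thesis by (intro exI[of _ "Suc m"]) auto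
    qed
  qed
  then obtain c where c: "c \<le> n - 1" "\<forall>j\<in>{c<..n-1}. pos (cyclic_psum j - cyclic_psum c)" "\<forall>j<c. \<not> pos (cyclic_psum c - cyclic_psum j)"
    by blast
  have "cyclic_ladder c" unfolding cyclic_ladder_def
  proof
    fix j assume j: "j \<in> {c<..c+n}"
    show "pos (cyclic_psum j - cyclic_psum c)"
    proof (cases "j \<le> n - 1")
      case True thus ?thesis using c j by auto
    next
      case False
      define i where "i = j - n"
      have i: "j = i + n" "i \<le> c" using False j n by (auto simp: i_def)
      show ?thesis
      proof (cases "i = c")
        case True thus ?thesis using i assms by (simp add: cyclic_psum_shift)
      next
        case False
        hence "\<not> pos (cyclic_psum c - cyclic_psum i)" using c i by auto
        with assms npos_add[of "cyclic_psum c - cyclic_psum i" "cyclic_psum i + cyclic_psum n - cyclic_psum c"]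
        show ?thesis unfolding i(1) cyclic_psum_shift by auto
      qed
    qed
  qed
  thus ?thesis ..
qed

definition cyclic_shift :: "nat \<Rightarrow> nat \<Rightarrow> real" where "cyclic_shift t i = x ((t + i) mod n)"

lemma psum_cyclic_shift: "psum (cyclic_shift t) j = cyclic_psum (t + j) - cyclic_psum t"
proof -
  have "cyclic_shift t = (\<lambda>i. x ((t + i) mod n))" by (simp add: cyclic_shift_def fun_eq_iff)
  thus ?thesis unfolding cyclic_psum_def psum_add by simp
qed

text \<open>In the periodic walk, a last block of length \<open>k\<close> seen from \<open>t\<close>
  means that \<open>t\<close> is a ladder position and that the ladder position preceding
  \<open>t + n\<close> is \<open>t + n - k\<close>. So \<open>k\<close> is the gap between
  cyclically consecutive ladder positions.\<close>

lemma last_block_cyclic_shift_iff: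
  assumes "1 \<le> k" "k \<le> n"
  shows "last_block n k (cyclic_shift t) \<longleftrightarrow> cyclic_ladder t \<and> cyclic_ladder (t + n - k) \<and> (\<forall>j. t + n - k < j \<and> j < t + n \<longrightarrow> \<not> cyclic_ladder j)"
proof -
  have st: "stays n (cyclic_shift t) \<longleftrightarrow> cyclic_ladder t"
  proof -
    have "(\<forall>j\<in>{1..n}. pos (cyclic_psum (t + j) - cyclic_psum t)) \<longleftrightarrow> (\<forall>j\<in>{t<..t+n}. pos (cyclic_psum j - cyclic_psum t))"
    proof safe
      fix j assume a: "\<forall>j\<in>{1..n}. pos (cyclic_psum (t + j) - cyclic_psum t)" "j \<in> {t<..t+n}"
      hence "j - t \<in> {1..n}" "t + (j - t) = j" by auto
      with a show "pos (cyclic_psum j - cyclic_psum t)" by metis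
    qed auto
    thus ?thesis unfolding stays_def cyclic_ladder_def psum_cyclic_shift .
  qed
  have A: "psum (cyclic_shift t) n - psum (cyclic_shift t) j = cyclic_psum (t + n) - cyclic_psum (t + j)" for j
    by (simp add: psum_cyclic_shift)
  have B: "(\<forall>j\<in>{n-k<..<n}. \<not> pos (cyclic_psum (t + n) - cyclic_psum (t + j))) \<longleftrightarrow>
        (\<forall>j. t + n - k < j \<and> j < t + n \<longrightarrow> \<not> pos (cyclic_psum (t + n) - cyclic_psum j))" (is "?l = ?r")
  proof
    assume l: ?l
    show ?r
    proof safe
      fix j assume j: "t + n - k < j" "j < t + n" and p: "pos (cyclic_psum (t + n) - cyclic_psum j)"
      hence "j - t \<in> {n-k<..<n}" "t + (j - t) = j" using assms by auto
      with l p show False by metis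
    qed
  qed (use assms in auto)
  have lb: "last_block n k (cyclic_shift t) \<longleftrightarrow> cyclic_ladder t \<and> pos (cyclic_psum (t + n) - cyclic_psum (t + n - k)) \<and>
          (\<forall>j. t + n - k < j \<and> j < t + n \<longrightarrow> \<not> pos (cyclic_psum (t + n) - cyclic_psum j))"
    unfolding last_block_iff[OF assms] st A B using assms by simp
  show ?thesis
  proof (cases "cyclic_ladder t")
    case True
    hence g: "cyclic_ladder (t + n)" by (simp add: cyclic_ladder_shift)
    have imp: "pos (cyclic_psum (t + n) - cyclic_psum j)" if "cyclic_ladder j" "j < t + n" for j
      using cyclic_ladder_later that by blast
    \<comment> \<open>The last index before \<open>t + n\<close> with a \<open>pos\<close> increment
      to \<open>t + n\<close> is a ladder position: indices in between lie \<open>pos\<close> above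
      it by \<open>npos_trans\<close>, those beyond \<open>t + n\<close> by
      \<open>pos_trans\<close>.\<close>
    have conv: "cyclic_ladder c" if c: "c < t + n" "pos (cyclic_psum (t + n) - cyclic_psum c)"
      "\<And>j. c < j \<Longrightarrow> j < t + n \<Longrightarrow> \<not> pos (cyclic_psum (t + n) - cyclic_psum j)" for c
      unfolding cyclic_ladder_def
    proof
      fix j assume j: "j \<in> {c<..c+n}"
      show "pos (cyclic_psum j - cyclic_psum c)"
      proof (cases j "t + n" rule: linorder_cases)
        case less thus ?thesis using c j npos_trans[of "cyclic_psum j" "cyclic_psum c" "cyclic_psum (t+n)"] by auto
      next
        case equal thus ?thesis using c by simp
      next
        case greater
        thus ?thesis using cyclic_ladder_later[OF g greater] pos_trans c by blast
      qed
    qed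
    have ex: "\<exists>j. m < j \<and> j < t + n \<and> cyclic_ladder j"
      if "m < j" "j < t + n" "pos (cyclic_psum (t + n) - cyclic_psum j)" for j m
    proof -
      let ?A = "{i. i < t + n \<and> pos (cyclic_psum (t + n) - cyclic_psum i)}"
      have "j \<in> ?A" using that by auto
      hence ne: "?A \<noteq> {}" by blast
      have fin: "finite ?A" by simp
      define i where "i = Max ?A"
      have i: "i \<in> ?A" unfolding i_def using fin ne by (rule Max_in)
      have mx: "j \<le> i" if "j \<in> ?A" for j unfolding i_def using fin that by (rule Max_ge)
      have "cyclic_ladder i" using i mx by (intro conv) force+
      thus ?thesis using i mx[OF \<open>j \<in> ?A\<close>] that by (intro exI[of _ i]) auto
    qed
    have tk: "t + n - k < t + n" using assms by auto
    show ?thesis unfolding lb using True imp conv[OF tk] ex[of "t + n - k"] tk by blast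
  qed (simp add: lb)
qed

text \<open>The restriction \<open>t < k\<close> says that the gap ending at \<open>t\<close>
  reaches back past index 0, which singles out the first ladder position of the period. Every cyclic
  arrangement with \<open>pos\<close> total therefore yields exactly one pair (k, t); the uniqueness
  is \<open>cyclic_shift_unique\<close>.\<close>

lemma pos_iff_cyclic_shift:
  "pos (psum x n) \<longleftrightarrow> (\<exists>k\<in>{1..n}. \<exists>t<k. last_block n k (cyclic_shift t))"
proof -
  have pn: "psum x n = cyclic_psum n" unfolding cyclic_psum_def by (intro psum_cong) auto
  show ?thesis
  proof
    assume "pos (psum x n)"
    hence ex: "\<exists>c. cyclic_ladder c" using cyclic_ladder_exists pn by simp
    define t where "t = (LEAST c. cyclic_ladder c)"
    have t: "cyclic_ladder t" unfolding t_def using ex by (rule LeastI_ex)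
    have tl: "t \<le> c" if "cyclic_ladder c" for c unfolding t_def using that by (rule Least_le)
    have tn: "t < n"
    proof (rule ccontr)
      assume "\<not> t < n"
      hence "cyclic_ladder (t - n)" using t cyclic_ladder_shift[of "t - n"] by simp
      with tl \<open>\<not> t < n\<close> n show False by force
    qed
    let ?A = "{c. c < t + n \<and> cyclic_ladder c}"
    have "t \<in> ?A" using t n by auto
    hence ne: "?A \<noteq> {}" by blast
    have fin: "finite ?A" by simp
    define i where "i = Max ?A"
    have i: "i \<in> ?A" unfolding i_def using fin ne by (rule Max_in)
    have mx: "j \<le> i" if "j \<in> ?A" for j unfolding i_def using fin that by (rule Max_ge)
    have i_n: "i < n"
    proof (rule ccontr)
      assume "\<not> i < n"
      hence "cyclic_ladder (i - n)" using i cyclic_ladder_shift[of "i - n"] by simp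
      with tl have "t \<le> i - n" by auto
      with i \<open>\<not> i < n\<close> show False by auto
    qed
    have ti: "t \<le> i" using i tl by auto
    define k where "k = t + n - i"
    have k: "k \<in> {1..n}" "t < k" "t + n - k = i" using i i_n ti by (auto simp: k_def)
    have "last_block n k (cyclic_shift t)"
      using k t i mx by (subst last_block_cyclic_shift_iff) force+
    thus "\<exists>k\<in>{1..n}. \<exists>t<k. last_block n k (cyclic_shift t)" using k by auto
  next
    assume "\<exists>k\<in>{1..n}. \<exists>t<k. last_block n k (cyclic_shift t)"
    then obtain k t where "k \<in> {1..n}" "t < k" "last_block n k (cyclic_shift t)" by blast
    hence "cyclic_ladder t" using last_block_cyclic_shift_iff by auto
    from cyclic_ladder_later[OF this, of "t + n"] n show "pos (psum x n)"
      by (simp add: pn cyclic_psum_shift)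
  qed
qed

lemma cyclic_shift_unique:
  assumes "k \<in> {1..n}" "t < k" "last_block n k (cyclic_shift t)"
    and "k' \<in> {1..n}" "t' < k'" "last_block n k' (cyclic_shift t')"
  shows "k = k' \<and> t = t'"
proof -
  have le: "t \<le> t'" if "k \<in> {1..n}" "t < k" "last_block n k (cyclic_shift t)"
    and "k' \<in> {1..n}" "t' < k'" "last_block n k' (cyclic_shift t')" for k t k' t'
  proof (rule ccontr)
    assume "\<not> t \<le> t'"
    have "cyclic_ladder t'" and *: "\<forall>j. t + n - k < j \<and> j < t + n \<longrightarrow> \<not> cyclic_ladder j"
      using that last_block_cyclic_shift_iff by auto
    hence "cyclic_ladder (t' + n)" by (simp add: cyclic_ladder_shift)
    with * \<open>\<not> t \<le> t'\<close> that show False by (auto dest!: spec[of _ "t' + n"])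
  qed
  have "t = t'" using le[OF assms] le[OF assms(4-6) assms(1-3)] by simp
  moreover have "k = k'" using assms last_block_unique[of k n k' "cyclic_shift t"] \<open>t = t'\<close> by auto
  ultimately show ?thesis by simp
qed

end

end

section \<open>From path identities to probabilities for i.i.d. steps\<close>

locale iid_walk = prob_space + half_line +
  fixes Y :: "nat \<Rightarrow> 'a \<Rightarrow> real"
  assumes indep: "indep_vars (\<lambda>_. borel) Y UNIV"
    and ident: "distr M borel (Y i) = distr M borel (Y 0)"
begin

lemma Y_meas [measurable]: "Y i \<in> borel_measurable M"
  using indep unfolding indep_vars_def by auto

text \<open>Exchangeability and stationarity at once: both sides are the mass of the same set under
  the product of \<open>n\<close> copies of the common law.\<close>

lemma prob_reindex:
  assumes inj: "inj_on \<pi> {..<n}"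
    and Q [measurable]: "Measurable.pred (PiM {..<n} (\<lambda>_. borel)) Q"
    and cong: "\<And>x y. (\<And>i. i < n \<Longrightarrow> x i = y i) \<Longrightarrow> Q x = Q y"
  shows "prob {\<omega> \<in> space M. Q (\<lambda>i. Y (\<pi> i) \<omega>)} = prob {\<omega> \<in> space M. Q (\<lambda>i. Y i \<omega>)}"
proof (cases "n = 0")
  \<comment> \<open>With no coordinates \<open>Q\<close> is constant; the other case describes
    independence by a product over a nonempty index set.\<close>
  case True
  hence "Q x = Q y" for x y by (intro cong) auto
  hence "{\<omega> \<in> space M. Q (\<lambda>i. Y (\<pi> i) \<omega>)} = {\<omega> \<in> space M. Q (\<lambda>i. Y i \<omega>)}" by blast
  thus ?thesis by (rule arg_cong)
next
  case False
  have key: "prob {\<omega> \<in> space M. Q (\<lambda>i. Y (\<pi> i) \<omega>)} =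
          measure (PiM {..<n} (\<lambda>_. distr M borel (Y 0))) {z \<in> space (PiM {..<n} (\<lambda>_. borel)). Q z}"
    if inj: "inj_on \<pi> {..<n}" for \<pi>
  proof -
    have "indep_vars (\<lambda>j. PiM {\<pi> j} (\<lambda>_. borel)) (\<lambda>j \<omega>. restrict (\<lambda>i. Y i \<omega>) {\<pi> j}) {..<n}"
      using inj by (intro indep_vars_restrict[OF indep]) (auto simp: disjoint_family_on_def inj_on_def)
    from indep_vars_compose2[OF this, of "\<lambda>j z. z (\<pi> j)" "\<lambda>_. borel"]
    have "indep_vars (\<lambda>_. borel) (\<lambda>i. Y (\<pi> i)) {..<n}" by simp
    hence "distr M (PiM {..<n} (\<lambda>_. borel)) (\<lambda>\<omega>. \<lambda>i\<in>{..<n}. Y (\<pi> i) \<omega>) =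
            PiM {..<n} (\<lambda>i. distr M borel (Y (\<pi> i)))"
      by (subst (asm) indep_vars_iff_distr_eq_PiM') (use False in auto)
    also have "\<dots> = PiM {..<n} (\<lambda>_. distr M borel (Y 0))"
      using ident by (intro PiM_cong) auto
    finally have d: "PiM {..<n} (\<lambda>_. distr M borel (Y 0)) =
         distr M (PiM {..<n} (\<lambda>_. borel)) (\<lambda>\<omega>. \<lambda>i\<in>{..<n}. Y (\<pi> i) \<omega>)" ..
    have "{\<omega> \<in> space M. Q (\<lambda>i. Y (\<pi> i) \<omega>)} = (\<lambda>\<omega>. \<lambda>i\<in>{..<n}. Y (\<pi> i) \<omega>) -` {z \<in> space (PiM {..<n} (\<lambda>_. borel)). Q z} \<inter> space M"
    proof -
      have "Q (\<lambda>i. Y (\<pi> i) \<omega>) = Q (\<lambda>i\<in>{..<n}. Y (\<pi> i) \<omega>)" for \<omega> by (intro cong) auto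
      thus ?thesis by (auto simp: space_PiM)
    qed
    thus ?thesis unfolding d by (subst measure_distr) (auto intro!: measurable_restrict)
  qed
  show ?thesis using key[OF inj] key[of "\<lambda>i. i"] by simp
qed

lemma psum_meas: "j \<le> n \<Longrightarrow> (\<lambda>z. psum z j) \<in> borel_measurable (PiM {..<n} (\<lambda>_. borel))"
  unfolding psum_def by (intro borel_measurable_sum measurable_component_singleton) auto

lemma stays_meas: "m \<le> n \<Longrightarrow> Measurable.pred (PiM {..<n} (\<lambda>_. borel)) (stays m)"
  unfolding stays_def
  by (intro pred_intros_finite measurable_compose[OF _ pos_meas] psum_meas) auto

lemma ladder_meas: "Measurable.pred (PiM {..<n} (\<lambda>_. borel)) (ladder n)"
  unfolding ladder_def
  by (intro pred_intros_finite pred_intros_logic measurable_compose[OF _ pos_meas] psum_meas borel_measurable_diff) auto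

lemma shift_meas:
  fixes m k n :: nat
  shows "(\<lambda>z. \<lambda>i\<in>{..<k}. z (m + i)) \<in> PiM {m..<m+k} (\<lambda>_. borel) \<rightarrow>\<^sub>M PiM {..<k} (\<lambda>_. borel)"
  "m + k \<le> n \<Longrightarrow> (\<lambda>z. \<lambda>i\<in>{..<k}. z (m + i)) \<in> PiM {..<n} (\<lambda>_. borel) \<rightarrow>\<^sub>M PiM {..<k} (\<lambda>_. borel)"
  by (auto intro!: measurable_restrict measurable_component_singleton)

lemma ladder_restrict: "ladder k (\<lambda>i. z (m + i)) = ladder k (\<lambda>i\<in>{..<k}. z (m + i))"
  by (intro ladder_cong) auto

lemma last_block_meas:
  assumes "k \<le> n" shows "Measurable.pred (PiM {..<n} (\<lambda>_. borel)) (last_block n k)"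
proof -
  have "Measurable.pred (PiM {..<n} (\<lambda>_. borel)) (\<lambda>z. ladder k (\<lambda>i. z (n - k + i)))"
    unfolding ladder_restrict
    using assms by (intro measurable_compose[OF shift_meas(2) ladder_meas]) auto
  thus ?thesis unfolding last_block_def using stays_meas[of "n - k" n]
    by (intro pred_intros_logic) auto
qed

definition stay_prob :: "nat \<Rightarrow> real" where
  "stay_prob n = prob {\<omega> \<in> space M. stays n (\<lambda>i. Y i \<omega>)}"

definition ladder_prob :: "nat \<Rightarrow> real" where
  "ladder_prob n = prob {\<omega> \<in> space M. ladder n (\<lambda>i. Y i \<omega>)}"

definition pos_prob :: "nat \<Rightarrow> real" where
  "pos_prob n = prob {\<omega> \<in> space M. pos (psum (\<lambda>i. Y i \<omega>) n)}"

lemma Y_pred [measurable]: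
  assumes Q: "Measurable.pred (PiM {..<n} (\<lambda>_. borel)) Q"
    and cong: "\<And>x y. (\<And>i. i < n \<Longrightarrow> x i = y i) \<Longrightarrow> Q x = Q y"
  shows "{\<omega> \<in> space M. Q (\<lambda>i. Y (\<pi> i) \<omega>)} \<in> events"
proof -
  have "Q (\<lambda>i. Y (\<pi> i) \<omega>) = Q (\<lambda>i\<in>{..<n}. Y (\<pi> i) \<omega>)" for \<omega> by (intro cong) auto
  moreover have "Measurable.pred M (\<lambda>\<omega>. Q (\<lambda>i\<in>{..<n}. Y (\<pi> i) \<omega>))"
    by (intro measurable_compose[OF _ Q] measurable_restrict) auto
  ultimately show ?thesis by (simp add: pred_def)
qed

text \<open>The first \<open>n - k\<close> steps decide \<open>stays\<close> and the remaining
  \<open>k\<close> decide \<open>ladder\<close>. Independence factorises the probability, and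
  \<open>prob_reindex\<close> moves the second block to the origin.\<close>

lemma prob_last_block:
  assumes "k \<le> n"
  shows "prob {\<omega> \<in> space M. last_block n k (\<lambda>i. Y i \<omega>)} = stay_prob (n - k) * ladder_prob k"
proof -
  define m where "m = n - k"
  let ?A = "{..<m}" and ?B = "{m..<m+k}"
  let ?Xa = "{z \<in> space (PiM ?A (\<lambda>_. borel)). stays m z}"
  let ?Xb = "{z \<in> space (PiM ?B (\<lambda>_. borel)). ladder k (\<lambda>i. z (m + i))}"
  have ind: "indep_var (PiM ?A (\<lambda>_. borel)) (\<lambda>\<omega>. restrict (\<lambda>i. Y i \<omega>) ?A) (PiM ?B (\<lambda>_. borel)) (\<lambda>\<omega>. restrict (\<lambda>i. Y i \<omega>) ?B)"
    by (intro indep_var_restrict[OF indep]) auto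
  have Xa: "?Xa \<in> sets (PiM ?A (\<lambda>_. borel))" using stays_meas[of m m] by (simp add: pred_def)
  have "Measurable.pred (PiM ?B (\<lambda>_. borel)) (\<lambda>z. ladder k (\<lambda>i. z (m + i)))"
    unfolding ladder_restrict by (intro measurable_compose[OF shift_meas(1) ladder_meas])
  hence Xb: "?Xb \<in> sets (PiM ?B (\<lambda>_. borel))" by (simp add: pred_def)
  have sa: "stays m (restrict (\<lambda>i. Y i \<omega>) ?A) = stays m (\<lambda>i. Y i \<omega>)" for \<omega>
    by (intro stays_cong) auto
  have sb: "ladder k (\<lambda>i. restrict (\<lambda>i. Y i \<omega>) ?B (m + i)) = ladder k (\<lambda>i. Y (m + i) \<omega>)" for \<omega>
    by (intro ladder_cong) auto
  have 1: "(\<lambda>x. (restrict (\<lambda>i. Y i x) ?A, restrict (\<lambda>i. Y i x) ?B)) -` (?Xa \<times> ?Xb) \<inter> space M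
     = {\<omega> \<in> space M. last_block n k (\<lambda>i. Y i \<omega>)}"
    unfolding last_block_def m_def[symmetric] using sa sb by (auto simp: space_PiM)
  have 2: "(\<lambda>x. restrict (\<lambda>i. Y i x) ?A) -` ?Xa \<inter> space M = {\<omega> \<in> space M. stays m (\<lambda>i. Y i \<omega>)}"
    using sa by (auto simp: space_PiM)
  have 3: "(\<lambda>x. restrict (\<lambda>i. Y i x) ?B) -` ?Xb \<inter> space M = {\<omega> \<in> space M. ladder k (\<lambda>i. Y (m + i) \<omega>)}"
    using sb by (auto simp: space_PiM)
  have 4: "prob {\<omega> \<in> space M. ladder k (\<lambda>i. Y (m + i) \<omega>)} = ladder_prob k"
    unfolding ladder_prob_def
    by (rule prob_reindex[where \<pi> = "\<lambda>i. m + i" and n = k, OF _ ladder_meas ladder_cong]) auto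
  show ?thesis
    using indep_varD[OF ind Xa Xb] unfolding 1 2 3 4 by (simp add: stay_prob_def m_def)
qed

lemma stay_prob_0: "stay_prob 0 = 1"
  by (simp add: stay_prob_def stays_def prob_space)

lemma stay_prob_rec:
  assumes "1 \<le> n"
  shows "stay_prob n = (\<Sum>k=1..n. ladder_prob k * stay_prob (n - k))"
proof -
  have "{\<omega> \<in> space M. stays n (\<lambda>i. Y i \<omega>)} = (\<Union>k\<in>{1..n}. {\<omega> \<in> space M. last_block n k (\<lambda>i. Y i \<omega>)})"
    using stays_iff_last_block[OF assms] by auto
  hence "stay_prob n = prob \<dots>" by (simp add: stay_prob_def)
  also have "\<dots> = (\<Sum>k=1..n. prob {\<omega> \<in> space M. last_block n k (\<lambda>i. Y i \<omega>)})"
  proof (rule finite_measure_finite_Union)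
    show "(\<lambda>k. {\<omega> \<in> space M. last_block n k (\<lambda>i. Y i \<omega>)}) ` {1..n} \<subseteq> events"
      by (rule image_subsetI, rule Y_pred[where \<pi> = "\<lambda>i. i", OF last_block_meas last_block_cong]) auto
    show "disjoint_family_on (\<lambda>k. {\<omega> \<in> space M. last_block n k (\<lambda>i. Y i \<omega>)}) {1..n}"
      unfolding disjoint_family_on_def
    proof (intro ballI impI)
      fix k k' assume "k \<in> {1..n}" "k' \<in> {1..n}" "k \<noteq> k'"
      hence "\<not> (last_block n k x \<and> last_block n k' x)" for x
        using last_block_unique[of k n k' x] by auto
      thus "{\<omega> \<in> space M. last_block n k (\<lambda>i. Y i \<omega>)} \<inter> {\<omega> \<in> space M. last_block n k' (\<lambda>i. Y i \<omega>)} = {}"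
        by blast
    qed
  qed auto
  also have "\<dots> = (\<Sum>k=1..n. ladder_prob k * stay_prob (n - k))"
    by (intro sum.cong refl) (simp add: prob_last_block mult.commute)
  finally show ?thesis .
qed

text \<open>Rotating i.i.d. steps does not change their law, so for each \<open>k\<close> the
  \<open>k\<close> rotations with \<open>t < k\<close> are equally likely; this produces the factor
  \<open>real k\<close>.\<close>

lemma pos_prob_eq:
  assumes "1 \<le> n"
  shows "pos_prob n = (\<Sum>k=1..n. real k * ladder_prob k * stay_prob (n - k))"
proof -
  let ?E = "\<lambda>(k, t). {\<omega> \<in> space M. last_block n k (cyclic_shift n (\<lambda>i. Y i \<omega>) t)}"
  let ?I = "SIGMA k:{1..n}. {..<k}"
  have rotY: "cyclic_shift n (\<lambda>i. Y i \<omega>) t = (\<lambda>i. Y ((t + i) mod n) \<omega>)" for \<omega> t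
    using assms by (simp add: fun_eq_iff cyclic_shift_def)
  have inj: "inj_on (\<lambda>i. (t + i) mod n) {..<n}" for t
  proof (rule inj_onI)
    fix i j assume a: "i \<in> {..<n}" "j \<in> {..<n}" "(t + i) mod n = (t + j) mod n"
    thus "i = j"
    proof (induction i j rule: linorder_wlog)
      case (le i j)
      hence "n dvd (t + j) - (t + i)" by (subst mod_eq_dvd_iff_nat[symmetric]) auto
      with le show ?case by (auto dest: dvd_imp_le)
    qed auto
  qed
  have prob: "prob {\<omega> \<in> space M. last_block n k (cyclic_shift n (\<lambda>i. Y i \<omega>) t)} = stay_prob (n - k) * ladder_prob k"
    if "k \<in> {1..n}" for k t
  proof -
    have "prob {\<omega> \<in> space M. last_block n k (cyclic_shift n (\<lambda>i. Y i \<omega>) t)} = prob {\<omega> \<in> space M. last_block n k (\<lambda>i. Y i \<omega>)}"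
      unfolding rotY
      by (rule prob_reindex[where n = n and \<pi> = "\<lambda>i. (t + i) mod n", OF inj last_block_meas last_block_cong])
         (use that in auto)
    thus ?thesis using that prob_last_block[of k n] by simp
  qed
  have "{\<omega> \<in> space M. pos (psum (\<lambda>i. Y i \<omega>) n)} = (\<Union>p\<in>?I. ?E p)"
    using pos_iff_cyclic_shift[OF assms] by auto
  hence "pos_prob n = prob (\<Union>p\<in>?I. ?E p)" by (simp add: pos_prob_def)
  also have "\<dots> = (\<Sum>p\<in>?I. prob (?E p))"
  proof (rule finite_measure_finite_Union)
    show "?E ` ?I \<subseteq> events"
    proof (rule image_subsetI)
      fix p assume p: "p \<in> ?I"
      obtain k t where kt: "p = (k, t)" by (cases p)
      have k: "k \<le> n" using p unfolding kt by simp
      show "?E p \<in> events" unfolding rotY kt prod.case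
        using k by (intro Y_pred[OF last_block_meas[OF k], where \<pi> = "\<lambda>i. (t + i) mod n"] last_block_cong)
    qed
    show "disjoint_family_on ?E ?I"
      unfolding disjoint_family_on_def
    proof (intro ballI impI)
      fix p p' assume a: "p \<in> ?I" "p' \<in> ?I" "p \<noteq> p'"
      obtain k t where kt: "p = (k, t)" by (cases p)
      obtain k' t' where kt': "p' = (k', t')" by (cases p')
      have "\<not> (last_block n k (cyclic_shift n x t) \<and> last_block n k' (cyclic_shift n x t'))" for x
        using cyclic_shift_unique[OF assms, of k t x k' t'] a unfolding kt kt' by auto
      thus "?E p \<inter> ?E p' = {}" unfolding kt kt' prod.case by blast
    qed
  qed auto
  also have "\<dots> = (\<Sum>k=1..n. \<Sum>t<k. prob {\<omega> \<in> space M. last_block n k (cyclic_shift n (\<lambda>i. Y i \<omega>) t)})"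
    by (subst sum.Sigma) (auto intro!: sum.cong)
  also have "\<dots> = (\<Sum>k=1..n. real k * ladder_prob k * stay_prob (n - k))"
    by (intro sum.cong refl) (simp add: prob)
  finally show ?thesis .
qed

text \<open>With \<open>T\<close> the generating function of \<open>ladder_prob\<close>, the two
  recursions read P = 1/(1 - T) and U = T'/(1 - T). Hence U is the logarithmic derivative of P, and
  it involves only the one-time probabilities \<open>pos_prob\<close>.\<close>

lemma stay_prob_deriv:
  "fps_deriv (Abs_fps stay_prob) = Abs_fps (\<lambda>n. pos_prob (Suc n)) * Abs_fps stay_prob"
proof -
  define P where "P = Abs_fps stay_prob"
  define T where "T = Abs_fps (\<lambda>n. if n = 0 then 0 else ladder_prob n)"
  define U where "U = Abs_fps (\<lambda>n. pos_prob (Suc n))"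
  have P: "P = 1 + T * P"
  proof (rule fps_ext)
    fix n
    show "P $ n = (1 + T * P) $ n"
    proof (cases "n = 0")
      case False
      have "(T * P) $ n = (\<Sum>k=0..n. T $ k * P $ (n - k))" by (rule fps_mult_nth)
      also have "\<dots> = (\<Sum>k=1..n. T $ k * P $ (n - k))"
        by (intro sum.mono_neutral_right) (auto simp: T_def)
      also have "\<dots> = P $ n" using stay_prob_rec[of n] False by (simp add: T_def P_def)
      finally show ?thesis using False by simp
    qed (simp add: P_def T_def stay_prob_0)
  qed
  have U: "U = fps_deriv T * P"
  proof (rule fps_ext)
    fix n
    have "(fps_deriv T * P) $ n = (\<Sum>k=0..n. real (Suc k) * ladder_prob (Suc k) * stay_prob (n - k))"
      by (simp add: fps_mult_nth T_def P_def)
    also have "\<dots> = (\<Sum>k=1..Suc n. real k * ladder_prob k * stay_prob (Suc n - k))"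
      by (subst One_nat_def, subst sum.shift_bounds_cl_Suc_ivl) simp
    finally show "U $ n = (fps_deriv T * P) $ n" using pos_prob_eq[of "Suc n"] by (simp add: U_def)
  qed
  have "fps_deriv P = fps_deriv (1 + T * P)" using P by simp
  hence d: "fps_deriv P = fps_deriv T * P + T * fps_deriv P" by (simp add: add.commute)
  have "P * (1 - T) = P - T * P" by (simp add: algebra_simps)
  also have "\<dots> = 1" using P by (metis add_diff_cancel_right')
  finally have "P * (1 - T) = 1" .
  moreover have "fps_deriv P * (1 - T) = fps_deriv T * P" using d by (simp add: algebra_simps)
  ultimately have "(fps_deriv P * (1 - T)) * P = (fps_deriv T * P) * P"
    by simp
  hence "fps_deriv P * (P * (1 - T)) = (fps_deriv T * P) * P"
    by (simp only: mult_ac)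
  hence "fps_deriv P = (fps_deriv T * P) * P"
    unfolding \<open>P * (1 - T) = 1\<close> by simp
  thus ?thesis using U by (simp add: P_def U_def)
qed

end

section \<open>Expansions in powers of the imaginary argument\<close>

text \<open>Expanding in powers of i t with real coefficients records parity: even powers are real
  and odd powers imaginary, so real parts keep only the even ones.\<close>

definition imag_expansion :: "nat \<Rightarrow> (real \<Rightarrow> complex) \<Rightarrow> real fps \<Rightarrow> bool" where
  "imag_expansion N f F \<longleftrightarrow>
     (\<lambda>t. f t - (\<Sum>m<N. of_real (F $ m) * (\<i> * of_real t) ^ m)) \<in> O[at 0](\<lambda>t. of_real t ^ N)"

lemma pow_bigo_at_0:
  assumes "N \<le> M" shows "(\<lambda>t. complex_of_real t ^ M) \<in> O[at 0](\<lambda>t. of_real t ^ N)"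
proof (rule bigoI[where c = 1])
  have "eventually (\<lambda>t::real. \<bar>t\<bar> < 1) (at 0)"
    using eventually_at_ball[of 1 "0::real" UNIV] by (simp add: dist_real_def)
  thus "\<forall>\<^sub>F t in at 0. cmod (of_real t ^ M) \<le> 1 * cmod (of_real t ^ N)"
    by eventually_elim (simp add: norm_power power_decreasing[OF assms])
qed

lemma ipow_bigo_at_0:
  assumes "N \<le> M" shows "(\<lambda>t. c * (\<i> * complex_of_real t) ^ M) \<in> O[at 0](\<lambda>t. of_real t ^ N)"
proof -
  have "(\<lambda>t. (c * \<i> ^ M) * (complex_of_real t ^ M)) \<in> O[at 0](\<lambda>t. of_real t ^ N)"
    using pow_bigo_at_0[OF assms] by (cases "c = 0") simp_all
  thus ?thesis by (simp add: power_mult_distrib mult.assoc)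
qed

lemma imag_expansion_mono:
  assumes "imag_expansion N f F" "M \<le> N" shows "imag_expansion M f F"
proof -
  have "(\<lambda>t. f t - (\<Sum>m<N. of_real (F $ m) * (\<i> * of_real t) ^ m)) \<in> O[at 0](\<lambda>t. of_real t ^ M)"
    using assms pow_bigo_at_0 unfolding imag_expansion_def by (meson landau_o.big_trans)
  moreover have "(\<lambda>t. \<Sum>m\<in>{M..<N}. of_real (F $ m) * (\<i> * of_real t) ^ m) \<in> O[at 0](\<lambda>t. of_real t ^ M)"
    by (intro big_sum_in_bigo ipow_bigo_at_0) auto
  ultimately have "(\<lambda>t. f t - (\<Sum>m<N. of_real (F $ m) * (\<i> * of_real t) ^ m)
          + (\<Sum>m\<in>{M..<N}. of_real (F $ m) * (\<i> * of_real t) ^ m)) \<in> O[at 0](\<lambda>t. of_real t ^ M)"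
    by (rule sum_in_bigo)
  moreover have "(\<Sum>m<N. h m) = (\<Sum>m<M. h m) + (\<Sum>m\<in>{M..<N}. h m)" for h :: "nat \<Rightarrow> complex"
    using assms(2) by (metis ivl_disj_un_one(2) lessThan_atLeast0 sum.atLeastLessThan_concat zero_le)
  ultimately show ?thesis unfolding imag_expansion_def by simp
qed

lemma imag_expansion_poly:
  assumes "\<And>t. f t = (\<Sum>m<M. of_real (F $ m) * (\<i> * of_real t) ^ m)" "\<And>m. M \<le> m \<Longrightarrow> F $ m = 0"
  shows "imag_expansion N f F"
proof -
  have *: "imag_expansion L f F" if "M \<le> L" for L
  proof -
    have "(\<Sum>m<L. of_real (F $ m) * (\<i> * of_real t) ^ m) = f t" for t :: real
      unfolding assms(1) using that assms(2) by (intro sum.mono_neutral_right) auto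
    thus ?thesis unfolding imag_expansion_def by simp
  qed
  show ?thesis using imag_expansion_mono[OF *[of "max M N"]] by simp
qed

lemma imag_expansion_add: "imag_expansion N f F \<Longrightarrow> imag_expansion N g G \<Longrightarrow> imag_expansion N (\<lambda>t. f t + g t) (F + G)"
  unfolding imag_expansion_def by (drule (1) sum_in_bigo(1)) (simp add: algebra_simps sum.distrib)

lemma imag_expansion_const: "imag_expansion N (\<lambda>t. of_real c) (fps_const c)"
  by (rule imag_expansion_poly[where M = 1]) auto

lemma imag_expansion_bounded: "imag_expansion N f F \<Longrightarrow> f \<in> O[at 0](\<lambda>_. 1)"
  using imag_expansion_mono[of N f F 0] by (simp add: imag_expansion_def)

lemma imag_expansion_mult:
  assumes f: "imag_expansion N f F" and g: "imag_expansion N g G"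
  shows "imag_expansion N (\<lambda>t. f t * g t) (F * G)"
proof -
  let ?P = "\<lambda>t::real. \<Sum>m<N. of_real (F $ m) * (\<i> * of_real t) ^ m"
  let ?Q = "\<lambda>t::real. \<Sum>m<N. of_real (G $ m) * (\<i> * of_real t) ^ m"
  let ?h = "\<lambda>i j t. complex_of_real (F $ i) * of_real (G $ j) * (\<i> * of_real t) ^ (i + j)"
  have 1: "(\<lambda>t. (f t - ?P t) * g t) \<in> O[at 0](\<lambda>t. of_real t ^ N * 1)"
    using f imag_expansion_bounded[OF g] unfolding imag_expansion_def by (rule landau_o.big.mult)
  have Pb: "?P \<in> O[at 0](\<lambda>_. 1)"
    by (rule imag_expansion_bounded[of N _ "Abs_fps (\<lambda>m. if m < N then F $ m else 0)"], rule imag_expansion_poly[where M = N]) auto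
  have 2: "(\<lambda>t. ?P t * (g t - ?Q t)) \<in> O[at 0](\<lambda>t. 1 * of_real t ^ N)"
    using Pb g unfolding imag_expansion_def by (rule landau_o.big.mult)
  \<comment> \<open>Products of degree at least \<open>N\<close> go into the error; the others form
    the Cauchy product.\<close>
  let ?S = "{(i, j). i < N \<and> j < N \<and> N \<le> i + j}"
  have fin: "finite ?S" by (rule finite_subset[of _ "{..<N} \<times> {..<N}"]) auto
  have 3: "(\<lambda>t. \<Sum>(i,j)\<in>?S. ?h i j t) \<in> O[at 0](\<lambda>t. of_real t ^ N)"
    by (intro big_sum_in_bigo) (auto intro: ipow_bigo_at_0)
  have PQ: "?P t * ?Q t - (\<Sum>m<N. of_real ((F * G) $ m) * (\<i> * of_real t) ^ m) = (\<Sum>(i,j)\<in>?S. ?h i j t)" for t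
  proof -
    have "?P t * ?Q t = (\<Sum>(i,j)\<in>{..<N}\<times>{..<N}. ?h i j t)"
      by (simp add: sum_product sum.cartesian_product power_add mult_ac)
    also have "{..<N}\<times>{..<N} = {(i, j). i + j < N} \<union> ?S" by auto
    also have "(\<Sum>(i,j)\<in>{(i, j). i + j < N} \<union> ?S. ?h i j t) = (\<Sum>(i,j)\<in>{(i, j). i + j < N}. ?h i j t) + (\<Sum>(i,j)\<in>?S. ?h i j t)"
      by (rule sum.union_disjoint[OF _ fin]) (auto intro: finite_subset[of _ "{..<N} \<times> {..<N}"])
    also have "(\<Sum>(i,j)\<in>{(i, j). i + j < N}. ?h i j t) = (\<Sum>m<N. \<Sum>i\<le>m. ?h i (m - i) t)"
      by (rule sum.triangle_reindex)
    also have "\<dots> = (\<Sum>m<N. of_real ((F * G) $ m) * (\<i> * of_real t) ^ m)"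
      by (intro sum.cong refl) (simp add: fps_mult_nth sum_distrib_right atLeast0AtMost)
    finally show ?thesis by simp
  qed
  have "(\<lambda>t. (f t - ?P t) * g t + ?P t * (g t - ?Q t) + (\<Sum>(i,j)\<in>?S. ?h i j t)) \<in> O[at 0](\<lambda>t. of_real t ^ N)"
    using sum_in_bigo(1)[OF sum_in_bigo(1)[OF 1[simplified] 2[simplified]] 3] .
  also have "(\<lambda>t. (f t - ?P t) * g t + ?P t * (g t - ?Q t) + (\<Sum>(i,j)\<in>?S. ?h i j t)) =
        (\<lambda>t. f t * g t - (\<Sum>m<N. of_real ((F * G) $ m) * (\<i> * of_real t) ^ m))"
    unfolding PQ[symmetric] by (simp add: algebra_simps)
  finally show ?thesis unfolding imag_expansion_def .
qed

lemma imag_expansion_cmult: "imag_expansion N f F \<Longrightarrow> imag_expansion N (\<lambda>t. of_real c * f t) (fps_const c * F)"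
  by (intro imag_expansion_mult imag_expansion_const)

lemma imag_expansion_power: "imag_expansion N f F \<Longrightarrow> imag_expansion N (\<lambda>t. f t ^ k) (F ^ k)"
proof (induction k)
  case 0 show ?case using imag_expansion_const[of N 1] by simp
qed (simp add: imag_expansion_mult)

lemma imag_expansion_shift:
  assumes f: "imag_expansion (N + k) f F" and z: "\<And>m. m < k \<Longrightarrow> F $ m = 0"
  shows "imag_expansion N (\<lambda>t. f t / (\<i> * of_real t) ^ k) (fps_shift k F)"
proof -
  have "(\<lambda>t. (f t - (\<Sum>m<N+k. of_real (F $ m) * (\<i> * of_real t) ^ m)) / (\<i> * of_real t) ^ k)
     \<in> O[at 0](\<lambda>t. of_real t ^ (N + k) / (\<i> * of_real t) ^ k)"
  proof (rule landau_o.big.divide_right)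
    show "(\<lambda>t. f t - (\<Sum>m<N+k. of_real (F $ m) * (\<i> * of_real t) ^ m)) \<in> O[at 0](\<lambda>t. of_real t ^ (N + k))"
      using f unfolding imag_expansion_def .
    show "eventually (\<lambda>t. (\<i> * complex_of_real t) ^ k \<noteq> 0) (at 0)"
      unfolding eventually_at by (intro exI[of _ 1]) auto
  qed
  moreover have "(\<lambda>t. complex_of_real t ^ (N + k) / (\<i> * of_real t) ^ k) \<in> O[at 0](\<lambda>t. of_real t ^ N)"
    by (intro bigoI[where c = 1]) (auto simp: eventually_at norm_divide norm_mult norm_power power_add intro!: exI[of _ 1])
  ultimately have *: "(\<lambda>t. (f t - (\<Sum>m<N+k. of_real (F $ m) * (\<i> * of_real t) ^ m)) / (\<i> * of_real t) ^ k)
     \<in> O[at 0](\<lambda>t. of_real t ^ N)" by (rule landau_o.big_trans)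
  show ?thesis unfolding imag_expansion_def
  proof (rule landau_o.big.in_cong[THEN iffD1, OF _ *])
    show "\<forall>\<^sub>F t in at 0. (f t - (\<Sum>m<N+k. of_real (F $ m) * (\<i> * of_real t) ^ m)) / (\<i> * of_real t) ^ k =
         f t / (\<i> * of_real t) ^ k - (\<Sum>m<N. of_real (fps_shift k F $ m) * (\<i> * of_real t) ^ m)"
      unfolding eventually_at
    proof (intro exI[of _ 1] conjI ballI impI)
      fix t :: real assume "t \<noteq> 0 \<and> dist t 0 < 1"
      hence t: "t \<noteq> 0" by simp
      have "(\<Sum>m<N+k. of_real (F $ m) * (\<i> * of_real t) ^ m) = (\<Sum>m\<in>{k..<N+k}. of_real (F $ m) * (\<i> * of_real t) ^ m)"
        by (intro sum.mono_neutral_right) (auto simp: z)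
      also have "\<dots> = (\<Sum>m<N. of_real (F $ (m + k)) * (\<i> * of_real t) ^ (m + k))"
        using sum.shift_bounds_nat_ivl[of "\<lambda>m. of_real (F $ m) * (\<i> * complex_of_real t) ^ m" 0 k N] by (simp add: lessThan_atLeast0)
      also have "\<dots> = (\<i> * of_real t) ^ k * (\<Sum>m<N. of_real (fps_shift k F $ m) * (\<i> * of_real t) ^ m)"
        by (simp add: sum_distrib_left power_add mult_ac)
      finally show "(f t - (\<Sum>m<N+k. of_real (F $ m) * (\<i> * of_real t) ^ m)) / (\<i> * of_real t) ^ k =
         f t / (\<i> * of_real t) ^ k - (\<Sum>m<N. of_real (fps_shift k F $ m) * (\<i> * of_real t) ^ m)"
        using t by (simp add: divide_simps)
    qed auto
  qed
qed

text \<open>For the truncated inverse series Q one has f Q - 1 = O(t^N), and 1/f - Q = -(f Q - 1)/f.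
  Since \<open>N > 0\<close>, f has the nonzero limit \<open>F $ 0\<close> at the origin, so 1/f
  stays bounded.\<close>

lemma imag_expansion_inverse:
  assumes f: "imag_expansion N f F" and nz: "F $ 0 \<noteq> 0" and N: "N > 0"
  shows "imag_expansion N (\<lambda>t. inverse (f t)) (inverse F)"
proof -
  let ?Q = "\<lambda>t::real. \<Sum>m<N. of_real (inverse F $ m) * (\<i> * of_real t) ^ m"
  have Q: "imag_expansion N ?Q (Abs_fps (\<lambda>m. if m < N then inverse F $ m else 0))"
    by (rule imag_expansion_poly[where M = N]) auto
  hence Q: "imag_expansion N ?Q (inverse F)" unfolding imag_expansion_def by simp
  have "imag_expansion N (\<lambda>t. f t * ?Q t) 1"
    using imag_expansion_mult[OF f Q] nz by (simp add: inverse_mult_eq_1' )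
  hence e: "(\<lambda>t. f t * ?Q t - 1) \<in> O[at 0](\<lambda>t. of_real t ^ N)"
    using N unfolding imag_expansion_def by (simp add: if_distrib if_distribR sum.delta cong: if_cong)
  have lim: "(f \<longlongrightarrow> of_real (F $ 0)) (at 0)"
  proof -
    have "(\<lambda>t. f t - of_real (F $ 0)) \<in> O[at 0](\<lambda>t. of_real t)"
      using imag_expansion_mono[OF f, of 1] N by (simp add: imag_expansion_def)
    moreover have "(\<lambda>t::real. complex_of_real t) \<in> o[at 0](\<lambda>_. 1)"
      by (intro smalloI_tendsto tendsto_eq_intros) auto
    ultimately have "(\<lambda>t. f t - of_real (F $ 0)) \<in> o[at 0](\<lambda>_. 1)"
      by (rule landau_o.big_small_trans)
    hence "((\<lambda>t. f t - of_real (F $ 0)) \<longlongrightarrow> 0) (at 0)" using smalloD_tendsto by fastforce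
    thus ?thesis by (simp add: LIM_zero_iff)
  qed
  have ev: "eventually (\<lambda>t. f t \<noteq> 0) (at 0)"
    using tendsto_imp_eventually_ne[OF lim] nz by simp
  have "((\<lambda>t. inverse (f t)) \<longlongrightarrow> inverse (of_real (F $ 0))) (at 0)"
    using lim nz by (intro tendsto_inverse) auto
  hence "(\<lambda>t. inverse (f t)) \<in> O[at 0](\<lambda>_. 1)"
    by (intro bigoI_tendsto[where c = "inverse (of_real (F $ 0))"]) auto
  from landau_o.big.mult[OF e this]
  have "(\<lambda>t. - ((f t * ?Q t - 1) * inverse (f t))) \<in> O[at 0](\<lambda>t. of_real t ^ N)" by simp
  thus ?thesis unfolding imag_expansion_def
    by (rule landau_o.big.in_cong[THEN iffD1, rotated])
       (use ev in eventually_elim, simp add: field_simps)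
qed

lemma imag_expansion_iexp: "imag_expansion N (\<lambda>t. iexp (a * t)) (fps_exp a)"
proof -
  have "imag_expansion (Suc N) (\<lambda>t. iexp (a * t)) (fps_exp a)"
    unfolding imag_expansion_def
  proof (rule bigoI[where c = "\<bar>a\<bar> ^ Suc N / fact (Suc N)"], intro always_eventually allI)
    fix t :: real
    have "(\<Sum>m<Suc N. complex_of_real (fps_exp a $ m) * (\<i> * of_real t) ^ m) = (\<Sum>k\<le>N. (\<i> * of_real (a * t)) ^ k / fact k)"
      unfolding lessThan_Suc_atMost by (intro sum.cong refl) (simp add: power_mult_distrib)
    thus "cmod (iexp (a * t) - (\<Sum>m<Suc N. complex_of_real (fps_exp a $ m) * (\<i> * of_real t) ^ m))
       \<le> \<bar>a\<bar> ^ Suc N / fact (Suc N) * cmod (of_real t ^ Suc N)"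
      using iexp_approx1[of "a * t" N] by (simp add: norm_power norm_mult abs_mult power_mult_distrib mult_ac)
  qed
  thus ?thesis by (rule imag_expansion_mono) simp
qed

text \<open>The sign in the coefficients comes from t^2 = -(i t)^2.\<close>

lemma imag_expansion_gauss:
  "imag_expansion N (\<lambda>t. of_real (exp (a * t\<^sup>2))) (Abs_fps (\<lambda>m. if even m then (- a) ^ (m div 2) / fact (m div 2) else 0))"
  (is "imag_expansion N ?f ?F")
proof -
  have "imag_expansion (2 * N) ?f ?F"
    unfolding imag_expansion_def
  proof (rule bigoI[where c = "exp \<bar>a\<bar> * \<bar>a\<bar> ^ N / fact N"])
    have "(\<Sum>m<2*N. complex_of_real (?F $ m) * (\<i> * of_real t) ^ m) = of_real (\<Sum>k<N. (a * t\<^sup>2) ^ k / fact k)" for t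
    proof (induction N)
      case (Suc N)
      have "(\<Sum>m<2*Suc N. complex_of_real (?F $ m) * (\<i> * of_real t) ^ m) = of_real (\<Sum>k<N. (a * t\<^sup>2) ^ k / fact k) + of_real ((-a)^N / fact N) * (\<i> * of_real t) ^ (2 * N)"
        using Suc by simp
      also have "(\<i> * complex_of_real t) ^ (2 * N) = of_real ((- (t\<^sup>2)) ^ N)"
        by (simp add: power_mult power_mult_distrib)
      finally show ?case by (simp add: power_mult_distrib[symmetric])
    qed simp
    moreover have "eventually (\<lambda>t::real. \<bar>t\<bar> < 1) (at 0)"
      using eventually_at_ball[of 1 "0::real" UNIV] by (simp add: dist_real_def)
    moreover have "\<bar>exp (a * t\<^sup>2) - (\<Sum>k<N. (a * t\<^sup>2) ^ k / fact k)\<bar> \<le> exp \<bar>a\<bar> * \<bar>a\<bar> ^ N / fact N * \<bar>t\<bar> ^ (2 * N)" if "\<bar>t\<bar> < 1" for t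
    proof -
      obtain s where s: "\<bar>s\<bar> \<le> \<bar>a * t\<^sup>2\<bar>" "exp (a * t\<^sup>2) = (\<Sum>k<N. (a * t\<^sup>2) ^ k / fact k) + exp s / fact N * (a * t\<^sup>2) ^ N"
        using Maclaurin_exp_le by blast
      have "t\<^sup>2 \<le> 1" using that by (simp add: abs_square_le_1)
      hence "\<bar>a * t\<^sup>2\<bar> \<le> \<bar>a\<bar>" by (simp add: abs_mult mult_left_le)
      hence "exp s \<le> exp \<bar>a\<bar>" using s by auto
      hence "exp s * (\<bar>a\<bar> ^ N * \<bar>t\<bar> ^ (2 * N)) \<le> exp \<bar>a\<bar> * (\<bar>a\<bar> ^ N * \<bar>t\<bar> ^ (2 * N))"
        by (intro mult_right_mono) auto
      thus ?thesis unfolding s(2) by (simp add: abs_mult power_mult_distrib power_abs power_mult divide_right_mono mult.assoc)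
    qed
    ultimately show "\<forall>\<^sub>F t in at 0. cmod (?f t - (\<Sum>m<2*N. complex_of_real (?F $ m) * (\<i> * of_real t) ^ m))
       \<le> exp \<bar>a\<bar> * \<bar>a\<bar> ^ N / fact N * cmod (of_real t ^ (2*N))"
      by (simp only: of_real_diff[symmetric] norm_of_real norm_power) (auto elim: eventually_mono)
  qed
  thus ?thesis by (rule imag_expansion_mono) simp
qed

lemma imag_expansion_obtain:
  assumes "imag_expansion N f F"
  shows "\<exists>C. eventually (\<lambda>t. cmod (f t - (\<Sum>m<N. of_real (F $ m) * (\<i> * of_real t) ^ m)) \<le> C * \<bar>t\<bar> ^ N) (at 0)"
  using assms unfolding imag_expansion_def by (elim landau_o.bigE) (auto simp: norm_power)

section \<open>An Edgeworth expansion for Fourier integrals\<close>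

lemma Re_mult_real: "Re (z * of_real x) = Re z * x"
  by simp

lemma Re_real_mult: "Re (of_real x * z) = x * Re z"
  by simp

text \<open>Only odd \<open>j\<close> occur, so all powers of n are half-integers, the type of decay
  that the sequences \<open>acoeff l\<close> have as well.\<close>

definition half_int_expansion :: "nat \<Rightarrow> (nat \<Rightarrow> real) \<Rightarrow> bool" where
  "half_int_expansion r f \<longleftrightarrow> (\<exists>c::nat \<Rightarrow> real.
     (\<lambda>n. f n - (\<Sum>j | j \<le> r \<and> odd j. c j * real n powr (-(real j / 2))))
       \<in> O(\<lambda>n. real n powr (-((real r + 1) / 2))))"

lemma powr_bigo_nat: "a \<le> b \<Longrightarrow> (\<lambda>n. real n powr a) \<in> O(\<lambda>n. real n powr b)"
  by (intro bigoI[where c = 1] eventually_mono[OF eventually_ge_at_top[of "1::nat"]]) (auto intro: powr_mono)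

lemma half_int_expansion_bigo:
  assumes "f \<in> O(\<lambda>n. real n powr (-((real r + 1) / 2)))" shows "half_int_expansion r f"
  unfolding half_int_expansion_def by (intro exI[of _ "\<lambda>_. 0"]) (use assms in simp)

lemma half_int_expansion_add: assumes "half_int_expansion r f" "half_int_expansion r g" shows "half_int_expansion r (\<lambda>n. f n + g n)"
proof -
  obtain c where c: "(\<lambda>n. f n - (\<Sum>j | j \<le> r \<and> odd j. c j * real n powr (-(real j / 2)))) \<in> O(\<lambda>n. real n powr (-((real r + 1) / 2)))"
    using assms(1) unfolding half_int_expansion_def by blast
  obtain d where d: "(\<lambda>n. g n - (\<Sum>j | j \<le> r \<and> odd j. d j * real n powr (-(real j / 2)))) \<in> O(\<lambda>n. real n powr (-((real r + 1) / 2)))"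
    using assms(2) unfolding half_int_expansion_def by blast
  show ?thesis unfolding half_int_expansion_def
    by (intro exI[of _ "\<lambda>j. c j + d j"])
       (use sum_in_bigo(1)[OF c d] in \<open>simp add: algebra_simps sum.distrib\<close>)
qed

lemma half_int_expansion_cmult: assumes "half_int_expansion r f" shows "half_int_expansion r (\<lambda>n. a * f n)"
proof -
  obtain c where c: "(\<lambda>n. f n - (\<Sum>j | j \<le> r \<and> odd j. c j * real n powr (-(real j / 2)))) \<in> O(\<lambda>n. real n powr (-((real r + 1) / 2)))"
    using assms(1) unfolding half_int_expansion_def by blast
  have "(\<lambda>n. a * (f n - (\<Sum>j | j \<le> r \<and> odd j. c j * real n powr (-(real j / 2))))) \<in> O(\<lambda>n. real n powr (-((real r + 1) / 2)))"
    using c by (cases "a = 0") simp_all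
  thus ?thesis unfolding half_int_expansion_def
    by (intro exI[of _ "\<lambda>j. a * c j"]) (simp add: algebra_simps sum_distrib_left)
qed

lemma half_int_expansion_sum: "finite A \<Longrightarrow> (\<And>i. i \<in> A \<Longrightarrow> half_int_expansion r (f i)) \<Longrightarrow> half_int_expansion r (\<lambda>n. \<Sum>i\<in>A. f i n)"
  by (induction A rule: finite_induct) (auto intro: half_int_expansion_add half_int_expansion_bigo)

lemma half_int_expansion_cong:
  assumes "half_int_expansion r f" "eventually (\<lambda>n. f n = g n) sequentially" shows "half_int_expansion r g"
proof -
  obtain c where c: "(\<lambda>n. f n - (\<Sum>j | j \<le> r \<and> odd j. c j * real n powr (-(real j / 2)))) \<in> O(\<lambda>n. real n powr (-((real r + 1) / 2)))"
    using assms(1) unfolding half_int_expansion_def by blast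
  show ?thesis unfolding half_int_expansion_def
    by (rule exI[of _ c], rule landau_o.big.in_cong[THEN iffD1, OF _ c]) (use assms(2) in eventually_elim, simp)
qed

lemma half_int_expansion_diff_bigo:
  assumes "half_int_expansion r f" "(\<lambda>n. g n - f n) \<in> O(\<lambda>n. real n powr (-((real r + 1) / 2)))" shows "half_int_expansion r g"
  using half_int_expansion_add[OF assms(1) half_int_expansion_bigo[OF assms(2)]] by simp

lemma half_int_expansion_powr:
  assumes "odd j" shows "half_int_expansion r (\<lambda>n. real n powr (-(real j / 2)))"
proof (cases "j \<le> r")
  case True
  have "(\<Sum>i | i \<le> r \<and> odd i. (if i = j then 1 else 0) * real n powr (-(real i / 2))) = real n powr (-(real j / 2))" for n
  proof -
    have "(\<Sum>i | i \<le> r \<and> odd i. (if i = j then 1 else 0) * real n powr (-(real i / 2))) = (\<Sum>i\<in>{j}. real n powr (-(real i / 2)))"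
      using True assms by (intro sum.mono_neutral_cong_right) auto
    thus ?thesis by simp
  qed
  thus ?thesis unfolding half_int_expansion_def by (intro exI[of _ "\<lambda>i. if i = j then 1 else 0"]) simp
next
  case False
  thus ?thesis by (intro half_int_expansion_bigo powr_bigo_nat) auto
qed

section \<open>Gaussian moments and integrals against Gaussian weights\<close>

lemma integrable_gauss_moment:
  fixes a :: real assumes "a > 0"
  shows "integrable lborel (\<lambda>t. \<bar>t\<bar> ^ m * exp (- a * t\<^sup>2))"
proof -
  have *: "integrable lborel (\<lambda>x. std_normal_density x * \<bar>x\<bar> ^ m)"
  proof (cases "even m")
    case True
    thus ?thesis using has_bochner_integral_even_function std_normal_moment_even[of "m div 2"]
      by (auto simp: has_bochner_integral_iff power_even_abs)
  next
    case False
    thus ?thesis using std_normal_moment_abs_odd[of "m div 2"]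
      by (auto simp: has_bochner_integral_iff elim!: oddE)
  qed
  define s where "s = sqrt (2 * a)"
  have s: "s > 0" "s\<^sup>2 = 2 * a" using assms by (auto simp: s_def)
  have "integrable lborel (\<lambda>t. std_normal_density (0 + s * t) * \<bar>0 + s * t\<bar> ^ m)"
    using lborel_integrable_real_affine[OF *, of s 0] s by simp
  hence "integrable lborel (\<lambda>t. (sqrt (2 * pi) / s ^ m) * (std_normal_density (0 + s * t) * \<bar>0 + s * t\<bar> ^ m))"
    by (rule integrable_mult_right)
  also have "(\<lambda>t. (sqrt (2 * pi) / s ^ m) * (std_normal_density (0 + s * t) * \<bar>0 + s * t\<bar> ^ m)) = (\<lambda>t. \<bar>t\<bar> ^ m * exp (- a * t\<^sup>2))"
    using s by (auto simp: fun_eq_iff std_normal_density_def abs_mult power_mult_distrib s(2))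
  finally show ?thesis .
qed

definition gauss_moment :: "real \<Rightarrow> nat \<Rightarrow> real" where
  "gauss_moment a m = (LINT t|lborel. \<bar>t\<bar> ^ m * exp (- a * t\<^sup>2))"

text \<open>Rescale t by sqrt n: each factor |t| and the measure dt contribute n^(-1/2).\<close>

lemma gauss_moment_scale:
  assumes "a > 0" "n > 0"
  shows "gauss_moment (real n * a) m = real n powr (-((real m + 1) / 2)) * gauss_moment a m"
proof -
  define s where "s = sqrt (real n)"
  have s: "s > 0" "s\<^sup>2 = real n" using assms by (auto simp: s_def)
  have "gauss_moment a m = s * (LINT t|lborel. \<bar>0 + s * t\<bar> ^ m * exp (- a * (0 + s * t)\<^sup>2))"
    unfolding gauss_moment_def using s by (subst lborel_integral_real_affine[where c = s and t = 0]) auto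
  also have "(\<lambda>t. \<bar>0 + s * t\<bar> ^ m * exp (- a * (0 + s * t)\<^sup>2)) = (\<lambda>t. s ^ m * (\<bar>t\<bar> ^ m * exp (- (real n * a) * t\<^sup>2)))"
    using s by (auto simp: fun_eq_iff abs_mult power_mult_distrib s(2))
  also have "s * (LINT t|lborel. s ^ m * (\<bar>t\<bar> ^ m * exp (- (real n * a) * t\<^sup>2))) = s ^ (m + 1) * gauss_moment (real n * a) m"
    by (simp add: gauss_moment_def)
  also have "s ^ (m + 1) = real n powr ((real m + 1) / 2)"
    using assms by (simp add: s_def powr_half_sqrt[symmetric] powr_realpow[symmetric] powr_powr powr_add[symmetric] add_divide_distrib add.commute)
  finally show ?thesis using assms by (simp add: powr_minus field_simps)
qed

text \<open>Power counting: \<open>k\<close> factors n are lost, and n^(-1/2) is gained for each |t|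
  and once for dt. The point 0 is excluded from the bound because the integrands of interest contain
  a division by t.\<close>

lemma small_int:
  fixes f :: "nat \<Rightarrow> real \<Rightarrow> real"
  assumes a: "a > 0" and meas: "\<And>n. f n \<in> borel_measurable borel"
    and bd: "\<And>n t. n > 0 \<Longrightarrow> t \<noteq> 0 \<Longrightarrow> t \<in> S \<Longrightarrow> \<bar>f n t\<bar> \<le> C * real n ^ k * \<bar>t\<bar> ^ m * exp (- (real n * a) * t\<^sup>2)"
    and S: "S \<in> sets borel"
  shows "n > 0 \<Longrightarrow> set_integrable lborel S (f n)"
    and "(\<lambda>n. LINT t:S|lborel. f n t) \<in> O(\<lambda>n. real n powr (real k - (real m + 1) / 2))"
proof -
  let ?g = "\<lambda>n t. \<bar>C\<bar> * real n ^ k * (\<bar>t\<bar> ^ m * exp (- (real n * a) * t\<^sup>2))"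
  have g: "integrable lborel (?g n)" if "n > 0" for n
    using integrable_gauss_moment[of "real n * a" m] a that by (intro integrable_mult_right) auto
  have ae: "AE t in lborel. norm (indicator S t *\<^sub>R f n t) \<le> ?g n t" if "n > 0" for n
  proof (rule AE_mp[OF AE_lborel_singleton[of 0]], intro AE_I2 impI)
    fix t :: real assume "t \<noteq> 0"
    have "C * real n ^ k * \<bar>t\<bar> ^ m * exp (- (real n * a) * t\<^sup>2) \<le> ?g n t"
      by (simp add: mult.assoc mult_right_mono)
    moreover have "0 \<le> ?g n t" by simp
    ultimately show "norm (indicator S t *\<^sub>R f n t) \<le> ?g n t"
      using bd[OF that \<open>t \<noteq> 0\<close>] by (cases "t \<in> S") auto
  qed
  have meas': "(\<lambda>t. indicator S t *\<^sub>R f n t) \<in> borel_measurable lborel" for n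
    using meas S by measurable
  show int: "set_integrable lborel S (f n)" if "n > 0" for n
    unfolding set_integrable_def using Bochner_Integration.integrable_bound[OF g[OF that] meas' ] ae[OF that] by force
  show "(\<lambda>n. LINT t:S|lborel. f n t) \<in> O(\<lambda>n. real n powr (real k - (real m + 1) / 2))"
  proof (rule bigoI[where c = "\<bar>C\<bar> * gauss_moment a m"], rule eventually_mono[OF eventually_gt_at_top[of 0]])
    fix n :: nat assume n: "n > 0"
    have "norm (LINT t:S|lborel. f n t) \<le> (LINT t|lborel. ?g n t)"
      unfolding set_lebesgue_integral_def using int[OF n] g[OF n] ae[OF n]
      by (intro order_trans[OF integral_norm_bound] integral_mono_AE) (auto simp: set_integrable_def)
    also have "\<dots> = \<bar>C\<bar> * real n ^ k * gauss_moment (real n * a) m"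
      by (simp add: gauss_moment_def)
    also have "\<dots> = \<bar>C\<bar> * gauss_moment a m * (real n ^ k * real n powr (-((real m + 1) / 2)))"
      using gauss_moment_scale[OF a n] by simp
    also have "real n ^ k * real n powr (-((real m + 1) / 2)) = real n powr (real k - (real m + 1) / 2)"
      using n by (simp add: powr_realpow[symmetric] powr_add[symmetric])
    finally show "norm (LINT t:S|lborel. f n t) \<le> \<bar>C\<bar> * gauss_moment a m * norm (real n powr (real k - (real m + 1) / 2))"
      by simp
  qed
qed

lemma small_int':
  assumes "a > 0" "\<And>n. f n \<in> borel_measurable borel"
    and "\<And>n t. n > 0 \<Longrightarrow> t \<noteq> 0 \<Longrightarrow> t \<in> S \<Longrightarrow> \<bar>f n t\<bar> \<le> C * real n ^ k * \<bar>t\<bar> ^ m * exp (- (real n * a) * t\<^sup>2)"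
    and "S \<in> sets borel" "real k - (real m + 1) / 2 \<le> e"
  shows "(\<lambda>n. LINT t:S|lborel. f n t) \<in> O(\<lambda>n. real n powr e)"
  using small_int(2)[OF assms(1-4)] powr_bigo_nat[OF assms(5)] by (rule landau_o.big_trans)

text \<open>Cutting the Gaussian moment down to a neighbourhood of 0 costs less than any power of n,
  since 1 <= (|t| / \<delta>)^N outside it for every N.\<close>

lemma even_moment_int:
  assumes a: "a > 0" and d: "\<delta> > 0" and l: "even l"
  shows "(\<lambda>n. (LINT t:{-\<delta>..\<delta>}|lborel. t ^ l * exp (- (real n * a) * t\<^sup>2)) - gauss_moment a l * real n powr (-((real l + 1) / 2)))
            \<in> O(\<lambda>n. real n powr e)"
proof -
  \<comment> \<open>Chosen so that n^(-(l + N + 1)/2) is at most n^e.\<close>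
  define N where "N = nat \<lceil>2 * \<bar>e\<bar>\<rceil>"
  have N: "real N \<ge> 2 * \<bar>e\<bar>" unfolding N_def by linarith
  let ?f = "\<lambda>n t. t ^ l * exp (- (real n * a) * t\<^sup>2)"
  have tl: "\<bar>t\<bar> ^ l = t ^ l" for t :: real using l by (simp add: power_even_abs)
  have int: "integrable lborel (?f n)" if "n > 0" for n
    using integrable_gauss_moment[of "real n * a" l] a that by (simp add: tl)
  have "(\<lambda>n. LINT t:-{-\<delta>..\<delta>}|lborel. ?f n t) \<in> O(\<lambda>n. real n powr e)"
  proof (rule small_int'[where C = "1 / \<delta> ^ N" and k = 0 and m = "l + N", OF a])
    fix n t assume "t \<in> -{-\<delta>..\<delta>}"
    hence "\<delta> \<le> \<bar>t\<bar>" by auto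
    hence "1 \<le> \<bar>t\<bar> ^ N / \<delta> ^ N" using d by (simp add: power_mono field_simps)
    hence "t ^ l * 1 * exp (- (real n * a) * t\<^sup>2) \<le> t ^ l * (\<bar>t\<bar> ^ N / \<delta> ^ N) * exp (- (real n * a) * t\<^sup>2)"
      using l by (intro mult_right_mono mult_left_mono) (auto simp: zero_le_even_power)
    thus "\<bar>?f n t\<bar> \<le> 1 / \<delta> ^ N * real n ^ 0 * \<bar>t\<bar> ^ (l + N) * exp (- (real n * a) * t\<^sup>2)"
      using l by (simp add: tl abs_mult power_add zero_le_even_power mult_ac)
  next
    show "real 0 - (real (l + N) + 1) / 2 \<le> e" using N by (simp add: field_simps)
  qed auto
  hence "(\<lambda>n. - (LINT t:-{-\<delta>..\<delta>}|lborel. ?f n t)) \<in> O(\<lambda>n. real n powr e)" by simp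
  thus ?thesis
  proof (rule landau_o.big.in_cong[THEN iffD1, rotated], intro eventually_mono[OF eventually_gt_at_top[of 0]])
    fix n :: nat assume n: "n > 0"
    have "gauss_moment a l * real n powr (-((real l + 1) / 2)) = (LINT t|lborel. ?f n t)"
      using gauss_moment_scale[OF a n, of l] by (simp add: gauss_moment_def tl mult.commute)
    also have "\<dots> = (LINT t:{-\<delta>..\<delta>} \<union> -{-\<delta>..\<delta>}|lborel. ?f n t)"
      by (simp add: Compl_partition set_lebesgue_integral_def)
    also have "\<dots> = (LINT t:{-\<delta>..\<delta>}|lborel. ?f n t) + (LINT t:-{-\<delta>..\<delta>}|lborel. ?f n t)"
    proof (rule set_integral_Un)
      have si: "set_integrable lborel A (?f n)" if "A \<in> sets lborel" for A
        unfolding set_integrable_def by (rule integrable_mult_indicator[OF that int[OF n]])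
      show "set_integrable lborel {-\<delta>..\<delta>} (?f n)" "set_integrable lborel (-{-\<delta>..\<delta>}) (?f n)"
        by (intro si; simp)+
    qed simp
    finally show "- (LINT t:-{-\<delta>..\<delta>}|lborel. ?f n t) = (LINT t:{-\<delta>..\<delta>}|lborel. ?f n t) - gauss_moment a l * real n powr (-((real l + 1) / 2))"
      by simp
  qed
qed

lemma set_integrable_sum':
  fixes f :: "'i \<Rightarrow> 'b \<Rightarrow> real"
  assumes "\<And>i. i \<in> I \<Longrightarrow> set_integrable M A (f i)"
  shows "set_integrable M A (\<lambda>x. \<Sum>i\<in>I. f i x)"
    and "(LINT x:A|M. (\<Sum>i\<in>I. f i x)) = (\<Sum>i\<in>I. LINT x:A|M. f i x)"
  using assms unfolding set_integrable_def set_lebesgue_integral_def scaleR_sum_right by auto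

lemma ipow_even: "(\<i> * of_real t) ^ (2 * k) = complex_of_real ((-1) ^ k * t ^ (2 * k))"
proof -
  have "(\<i> * complex_of_real t) ^ (2 * k) = of_real ((- (t\<^sup>2)) ^ k)"
    by (simp add: power_mult power_mult_distrib)
  also have "(- (t\<^sup>2)) ^ k = (-1) ^ k * t ^ (2 * k)"
    by (metis power_minus power_mult)
  finally show ?thesis .
qed

text \<open>Odd powers of i t have real part 0. An even power m + q integrates to a multiple of
  n^(-(m + q + 1)/2) up to a negligible error, and multiplication by n^i leaves the exponent half an
  odd number. The condition 2 i <= q keeps the remainder at order n^(-(r + 1)/2).\<close>

lemma half_int_expansion_gauss_int:
  fixes u :: "real \<Rightarrow> real" and e :: "nat \<Rightarrow> real"
  assumes a: "a > 0" and d: "\<delta> > 0" and u: "u \<in> borel_measurable borel" and q: "q \<ge> 2 * i"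
    and bd: "\<And>t. t \<noteq> 0 \<Longrightarrow> t \<in> {-\<delta>..\<delta>} \<Longrightarrow> \<bar>u t - (\<Sum>m<r. e m * Re ((\<i> * of_real t) ^ (m + q)))\<bar> \<le> C * \<bar>t\<bar> ^ (r + q)"
  shows "half_int_expansion r (\<lambda>n. real n ^ i * (LINT t:{-\<delta>..\<delta>}|lborel. u t * exp (- (real n * a) * t\<^sup>2)))"
    and "n > 0 \<Longrightarrow> set_integrable lborel {-\<delta>..\<delta>} (\<lambda>t. u t * exp (- (real n * a) * t\<^sup>2))"
proof -
  let ?S = "{-\<delta>..\<delta>}"
  let ?E = "\<lambda>n t. exp (- (real n * a) * t\<^sup>2)"
  let ?R = "\<lambda>t. u t - (\<Sum>m<r. e m * Re ((\<i> * of_real t) ^ (m + q)))"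
  have R: "(\<lambda>n. LINT t:?S|lborel. real n ^ i * (?R t * ?E n t)) \<in> O(\<lambda>n. real n powr (-((real r + 1) / 2)))"
  proof (rule small_int'[where C = C and k = i and m = "r + q", OF a])
    show "(\<lambda>t. real n ^ i * (?R t * ?E n t)) \<in> borel_measurable borel" for n using u by measurable
    show "\<bar>real n ^ i * (?R t * ?E n t)\<bar> \<le> C * real n ^ i * \<bar>t\<bar> ^ (r + q) * ?E n t" if "t \<noteq> 0" "t \<in> ?S" for n t
      using mult_right_mono[OF bd[OF that], of "real n ^ i * ?E n t"] by (simp add: abs_mult mult_ac)
    show "real i - (real (r + q) + 1) / 2 \<le> -((real r + 1) / 2)" using q by (simp add: field_simps)
  qed auto
  have intR: "set_integrable lborel ?S (\<lambda>t. ?R t * ?E n t)" if "n > 0" for n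
  proof (rule small_int(1)[where C = C and k = 0 and m = "r + q" and f = "\<lambda>n t. ?R t * ?E n t", OF a _ _ _ that])
    show "(\<lambda>t. ?R t * ?E n t) \<in> borel_measurable borel" for n using u by measurable
    show "\<bar>?R t * ?E n t\<bar> \<le> C * real n ^ 0 * \<bar>t\<bar> ^ (r + q) * ?E n t" if "t \<noteq> 0" "t \<in> ?S" for n t
      using mult_right_mono[OF bd[OF that], of "?E n t"] by (simp add: abs_mult mult_ac)
  qed auto
  let ?T = "\<lambda>m n t. Re ((\<i> * of_real t) ^ (m + q)) * ?E n t"
  have intT: "set_integrable lborel ?S (?T m n)" for m n
    by (intro borel_integrable_atLeastAtMost' continuous_intros)
  have uE: "u t * ?E n t = ?R t * ?E n t + (\<Sum>m<r. e m * ?T m n t)" for n t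
    by (simp add: algebra_simps sum_distrib_left)
  show int: "set_integrable lborel ?S (\<lambda>t. u t * ?E n t)" if "n > 0" for n
    unfolding uE using intR[OF that] intT
    by (intro set_integral_add set_integrable_sum' set_integrable_mult_right) auto
  have eq: "real n ^ i * (LINT t:?S|lborel. u t * ?E n t) =
      (LINT t:?S|lborel. real n ^ i * (?R t * ?E n t)) + (\<Sum>m<r. e m * (real n ^ i * (LINT t:?S|lborel. ?T m n t)))"
    if "n > 0" for n
  proof -
    have "(LINT t:?S|lborel. u t * ?E n t) = (LINT t:?S|lborel. ?R t * ?E n t) + (LINT t:?S|lborel. (\<Sum>m<r. e m * ?T m n t))"
      unfolding uE using intR[OF that] intT
      by (intro set_integral_add set_integrable_sum' set_integrable_mult_right) auto
    also have "(LINT t:?S|lborel. (\<Sum>m<r. e m * ?T m n t)) = (\<Sum>m<r. e m * (LINT t:?S|lborel. ?T m n t))"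
      using intT by (subst set_integrable_sum'(2)) auto
    finally have X: "(LINT t:?S|lborel. u t * ?E n t) = (LINT t:?S|lborel. ?R t * ?E n t) + (\<Sum>m<r. e m * (LINT t:?S|lborel. ?T m n t))" .
    have "real n ^ i * (\<Sum>m<r. e m * (LINT t:?S|lborel. ?T m n t)) = (\<Sum>m<r. e m * (real n ^ i * (LINT t:?S|lborel. ?T m n t)))"
      unfolding sum_distrib_left by (intro sum.cong refl) (rule mult.left_commute)
    thus ?thesis unfolding set_integral_mult_right X distrib_left by (rule arg_cong)
  qed
  have T: "half_int_expansion r (\<lambda>n. e m * (real n ^ i * (LINT t:?S|lborel. ?T m n t)))" for m
  proof (cases "even (m + q)")
    case False
    then obtain k where k: "m + q = 2 * k + 1" by (elim oddE)
    have "(\<i> * of_real t) ^ (m + q) = complex_of_real ((-1) ^ k * t ^ (2 * k)) * (\<i> * of_real t)" for t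
      unfolding k power_add ipow_even by simp
    hence "Re ((\<i> * of_real t) ^ (m + q)) = 0" for t
      by (simp only: times_complex.sel Re_complex_of_real Im_complex_of_real) simp
    thus ?thesis by (intro half_int_expansion_bigo) (simp add: set_lebesgue_integral_def)
  next
    case True
    define p where "p = (m + q) div 2"
    have p: "m + q = 2 * p" using True by (simp add: p_def)
    have Re: "Re ((\<i> * of_real t) ^ (m + q)) = (-1) ^ p * t ^ (m + q)" for t
    proof -
      have "(\<i> * of_real t) ^ (m + q) = complex_of_real ((-1) ^ p * t ^ (m + q))"
        unfolding p by (rule ipow_even)
      thus ?thesis by (simp only: Re_complex_of_real)
    qed
    let ?g = "\<lambda>n. (LINT t:?S|lborel. t ^ (m + q) * ?E n t)"
    let ?x = "-((real (m + q) + 1) / 2)"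
    have 1: "(\<lambda>n. real n ^ i * (?g n - gauss_moment a (m + q) * real n powr ?x)) \<in> O(\<lambda>n. real n ^ i * real n powr (-((real r + 1) / 2) - real i))"
      by (intro landau_o.big.mult even_moment_int[OF a d True]) auto
    also have "(\<lambda>n. real n ^ i * real n powr (-((real r + 1) / 2) - real i)) \<in> O(\<lambda>n. real n powr (-((real r + 1) / 2)))"
      by (intro bigoI[where c = 1] eventually_mono[OF eventually_gt_at_top[of 0]])
         (simp add: powr_realpow[symmetric] powr_add[symmetric])
    finally have 1: "(\<lambda>n. real n ^ i * (?g n - gauss_moment a (m + q) * real n powr ?x)) \<in> O(\<lambda>n. real n powr (-((real r + 1) / 2)))" .
    \<comment> \<open>The subtraction does not truncate because \<open>q \<ge> 2 * i\<close>, and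
      \<open>j\<close> is odd because m + q is even.\<close>
    define j where "j = m + q + 1 - 2 * i"
    have j: "odd j" "real j = real (m + q) + 1 - 2 * real i" using True q by (auto simp: j_def)
    have 2: "half_int_expansion r (\<lambda>n. gauss_moment a (m + q) * (real n ^ i * real n powr ?x))"
    proof (rule half_int_expansion_cong[OF half_int_expansion_cmult[OF half_int_expansion_powr[OF j(1)]]], rule eventually_mono[OF eventually_gt_at_top[of 0]])
      fix n :: nat assume n: "n > 0"
      show "gauss_moment a (m + q) * real n powr (-(real j / 2)) = gauss_moment a (m + q) * (real n ^ i * real n powr ?x)"
      proof -
        have "-(real j / 2) = real i + ?x" unfolding j(2) by (simp add: field_simps)
        thus ?thesis using n by (simp add: powr_realpow[symmetric] powr_add[symmetric])
      qed
    qed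
    have "half_int_expansion r (\<lambda>n. real n ^ i * ?g n)"
      using half_int_expansion_add[OF half_int_expansion_bigo[OF 1] 2] by (simp add: algebra_simps)
    hence "half_int_expansion r (\<lambda>n. (e m * (-1) ^ p) * (real n ^ i * ?g n))" by (rule half_int_expansion_cmult)
    thus ?thesis unfolding Re by (simp add: mult_ac)
  qed
  have "half_int_expansion r (\<lambda>n. (LINT t:?S|lborel. real n ^ i * (?R t * ?E n t)) + (\<Sum>m<r. e m * (real n ^ i * (LINT t:?S|lborel. ?T m n t))))"
    using R T by (intro half_int_expansion_add half_int_expansion_sum half_int_expansion_bigo[OF R]) auto
  thus "half_int_expansion r (\<lambda>n. real n ^ i * (LINT t:?S|lborel. u t * ?E n t))"
    by (rule half_int_expansion_cong) (use eq in \<open>auto intro!: eventually_mono[OF eventually_gt_at_top[of 0]]\<close>)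
qed

text \<open>For k > r, n choose k is at most n^k / (k - r - 1)!. The factor (n |w|)^(r + 1) comes
  out and a piece of the exponential series remains.\<close>

lemma cmod_binomial_tail:
  "cmod ((1 + w) ^ n - (\<Sum>k\<le>r. of_nat (n choose k) * w ^ k)) \<le> (real n * cmod w) ^ (r + 1) * exp (real n * cmod w)"
proof -
  define x where "x = real n * cmod w"
  have x: "x \<ge> 0" by (simp add: x_def)
  let ?h = "\<lambda>k. of_nat (n choose k) * w ^ k"
  have "(1 + w) ^ n = (\<Sum>k\<le>n. ?h k)"
    using binomial_ring[of w 1 n] by (simp add: add.commute)
  \<comment> \<open>Padding with \<open>r\<close> vanishing binomials makes \<open>{..r}\<close> a
    subset of the range also when n < r.\<close>
  also have "\<dots> = (\<Sum>k\<le>n + r. ?h k)"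
    by (intro sum.mono_neutral_left) auto
  also have "{..n + r} = {..r} \<union> {r<..n + r}" by auto
  also have "(\<Sum>k\<in>{..r} \<union> {r<..n + r}. ?h k) = (\<Sum>k\<le>r. ?h k) + (\<Sum>k\<in>{r<..n + r}. ?h k)"
    by (intro sum.union_disjoint) auto
  finally have "(1 + w) ^ n - (\<Sum>k\<le>r. ?h k) = (\<Sum>k\<in>{r<..n + r}. ?h k)" by simp
  hence "cmod ((1 + w) ^ n - (\<Sum>k\<le>r. ?h k)) \<le> (\<Sum>k\<in>{r<..n + r}. cmod (?h k))"
    by (simp add: norm_sum)
  also have "\<dots> \<le> (\<Sum>k\<in>{r<..n + r}. x ^ (r + 1) * (x ^ (k - (r + 1)) / fact (k - (r + 1))))"
  proof (rule sum_mono)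
    fix k assume k: "k \<in> {r<..n + r}"
    have "real ((n choose k) * fact k) \<le> real (n ^ k)" using binomial_fact_pow[of n k] by (simp only: of_nat_le_iff)
    hence "real (n choose k) \<le> real n ^ k / fact k" by (simp add: field_simps)
    also have "\<dots> \<le> real n ^ k / fact (k - (r + 1))"
      by (intro divide_left_mono fact_mono) auto
    finally have "real (n choose k) * cmod w ^ k \<le> real n ^ k / fact (k - (r + 1)) * cmod w ^ k"
      by (intro mult_right_mono) auto
    also have "\<dots> = x ^ k / fact (k - (r + 1))" by (simp add: x_def power_mult_distrib)
    also have "x ^ k = x ^ (r + 1) * x ^ (k - (r + 1))" using k by (subst power_add[symmetric]) simp
    finally show "cmod (?h k) \<le> x ^ (r + 1) * (x ^ (k - (r + 1)) / fact (k - (r + 1)))"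
      by (simp add: norm_mult norm_power)
  qed
  also have "\<dots> = x ^ (r + 1) * (\<Sum>j<n. x ^ j / fact j)"
    unfolding sum_distrib_left[symmetric]
    by (rule arg_cong[where f = "(*) (x ^ (r + 1))"], rule sum.reindex_bij_witness[of _ "\<lambda>j. j + (r + 1)" "\<lambda>k. k - (r + 1)"]) auto
  also have "(\<Sum>j<n. x ^ j / fact j) \<le> exp x"
  proof -
    have "(\<Sum>j<n. x ^ j /\<^sub>R fact j) \<le> exp x"
      unfolding exp_def using x by (intro sum_le_suminf summable_exp_generic) auto
    thus ?thesis by (simp add: divide_inverse mult.commute)
  qed
  finally show ?thesis unfolding x_def using x by (simp add: mult_left_mono x_def)
qed

text \<open>Replaces n choose k by powers n^i with i <= k, the form that
  \<open>half_int_expansion_gauss_int\<close> treats.\<close>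

lemma choose_poly: "\<exists>p :: real poly. degree p \<le> k \<and> (\<forall>n. real (n choose k) = poly p (real n))"
proof (induction k)
  case 0 show ?case by (intro exI[of _ 1]) auto
next
  case (Suc k)
  then obtain p :: "real poly" where p: "degree p \<le> k" "\<And>n. real (n choose k) = poly p (real n)" by blast
  let ?q = "smult (1 / real (Suc k)) ([:- real k, 1:] * p)"
  have "degree ?q \<le> Suc k"
    using degree_mult_le[of "[:- real k, 1:]" p] p(1) by (intro order_trans[OF degree_smult_le]) auto
  moreover have "real (n choose Suc k) = poly ?q (real n)" for n
    using gbinomial_mult_1[of "real n" k] by (simp add: p(2)[symmetric] binomial_gbinomial field_simps)
  ultimately show ?case by blast
qed

text \<open>A real constant divided by i t is purely imaginary, so the singularity 1/t at the origin
  disappears from the real part.\<close>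

lemma Re_add_real_div_i: "Re ((z + of_real c) / (\<i> * of_real t)) = Re (z / (\<i> * of_real t))"
proof -
  have "complex_of_real c / (\<i> * of_real t) = of_real (- c / t) * \<i>"
    by (cases "t = 0") (simp_all add: field_simps)
  hence "Re (complex_of_real c / (\<i> * of_real t)) = 0" by (simp only: Re_real_mult) simp
  thus ?thesis by (simp only: add_divide_distrib plus_complex.sel)
qed

lemma choice_pair: "\<forall>k. \<exists>a b. P k a b \<Longrightarrow> \<exists>f g. \<forall>k. P k (f k) (g k)"
  by metis

lemma Re_shift_power: "h * Re (z ^ (m + q)) = Re (z ^ q * (of_real h * z ^ m))"
  by (simp only: Re_real_mult[symmetric] power_add mult_ac)

text \<open>In the binomial expansion of (1 + w)^n the k-th term carries n^k and, after the division
  by i t, the power t^(3k - 1); under the Gaussian this is worth n^(k - 3k/2) = n^(-k/2). So the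
  terms k <= r suffice. The weight \<open>V\<close> adapts the division by i t to the problem at
  hand: it will be 1, t cot(t/2) or i t.\<close>

theorem edgeworth_integral:
  fixes \<phi> V :: "real \<Rightarrow> complex"
  assumes \<phi>m [measurable]: "\<phi> \<in> borel_measurable borel" and \<phi>: "imag_expansion (r + 3) \<phi> F" "F $ 0 = 1" "F $ 1 = 0" "F $ 2 > 0"
    and Vm [measurable]: "V \<in> borel_measurable borel" and V: "imag_expansion (r + 1) V G"
  shows "\<exists>\<delta>>0. \<delta> \<le> 1 \<and> half_int_expansion r (\<lambda>n. LINT t:{-\<delta>..\<delta>}|lborel. Re (\<phi> t ^ n * V t / (\<i> * of_real t))) \<and>
     (\<forall>n>0. set_integrable lborel {-\<delta>..\<delta>} (\<lambda>t. Re (\<phi> t ^ n * V t / (\<i> * of_real t))))"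
proof -
  \<comment> \<open>\<open>F $ 2\<close> multiplies (i t)^2 = -t^2, so exp(-b t^2) agrees with
    \<open>\<phi>\<close> up to terms of order t^3.\<close>
  define b where "b = F $ 2"
  have b: "b > 0" using \<phi> by (simp add: b_def)
  define E where "E = Abs_fps (\<lambda>m. if even m then (- b) ^ (m div 2) / fact (m div 2) else 0)"
  define w where "w t = \<phi> t * of_real (exp (b * t\<^sup>2)) - 1" for t
  have wm [measurable]: "w \<in> borel_measurable borel" unfolding w_def by measurable
  have "imag_expansion (r + 3) (\<lambda>t. \<phi> t * of_real (exp (b * t\<^sup>2)) + of_real (-1)) (F * E + fps_const (-1))"
    unfolding E_def by (intro imag_expansion_add imag_expansion_mult imag_expansion_gauss \<phi> imag_expansion_const)
  hence w: "imag_expansion (r + 3) w (F * E + fps_const (-1))" by (simp add: w_def[abs_def])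
  have W0: "(F * E + fps_const (-1)) $ m = 0" if "m < 3" for m
  proof -
    have "m = 0 \<or> m = 1 \<or> m = 2" using that by auto
    thus ?thesis using \<phi> by (auto simp: fps_mult_nth E_def b_def numeral_2_eq_2)
  qed
  define w' where "w' t = w t / (\<i> * of_real t) ^ 3" for t
  have w': "imag_expansion r w' (fps_shift 3 (F * E + fps_const (-1)))"
    unfolding w'_def using imag_expansion_shift[OF w W0] .
  define u where "u k t = Re (w t ^ k * V t / (\<i> * of_real t))" for k t
  have um [measurable]: "u k \<in> borel_measurable borel" for k unfolding u_def by measurable
  \<comment> \<open>The lowest relevant power of i t in w^k V / (i t). For k = 0 the constant of
    \<open>V\<close> drops out of the real part; for k >= 1 one has 3k - 1 >= 2k, which admits every
    factor n^i with i <= k.\<close>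
  define q where "q k = (if k = 0 then 0 else 3 * k - 1)" for k :: nat
  have "\<exists>e C. eventually (\<lambda>t. \<bar>u k t - (\<Sum>m<r. e m * Re ((\<i> * of_real t) ^ (m + q k)))\<bar> \<le> C * \<bar>t\<bar> ^ (r + q k)) (at 0)" for k
  proof (cases "k = 0")
    case True
    have "imag_expansion (r + 1) (\<lambda>t. V t + of_real (- (G $ 0))) (G + fps_const (- (G $ 0)))"
      by (intro imag_expansion_add V imag_expansion_const)
    from imag_expansion_obtain[OF imag_expansion_shift[OF this]]
    obtain H C where H: "eventually (\<lambda>t. cmod ((V t + of_real (- (G $ 0))) / (\<i> * of_real t) ^ 1 - (\<Sum>m<r. of_real (H m) * (\<i> * of_real t) ^ m)) \<le> C * \<bar>t\<bar> ^ r) (at 0)"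
      by auto
    have "eventually (\<lambda>t. \<bar>u k t - (\<Sum>m<r. H m * Re ((\<i> * of_real t) ^ (m + q k)))\<bar> \<le> C * \<bar>t\<bar> ^ (r + q k)) (at 0)"
      using H
    proof eventually_elim
      case (elim t)
      have "u k t - (\<Sum>m<r. H m * Re ((\<i> * of_real t) ^ (m + q k))) =
          Re ((V t + of_real (- (G $ 0))) / (\<i> * of_real t) ^ 1 - (\<Sum>m<r. of_real (H m) * (\<i> * of_real t) ^ m))"
        using True by (simp only: u_def q_def Re_add_real_div_i minus_complex.sel Re_sum Re_real_mult power_0 mult_1_left power_one_right if_True add_0_right simp_thms)
      also have "\<bar>\<dots>\<bar> \<le> cmod ((V t + of_real (- (G $ 0))) / (\<i> * of_real t) ^ 1 - (\<Sum>m<r. of_real (H m) * (\<i> * of_real t) ^ m))"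
        by (rule abs_Re_le_cmod)
      also note elim
      finally show ?case using True by (simp only: q_def if_True add_0_right simp_thms)
    qed
    thus ?thesis by blast
  next
    case False
    from imag_expansion_obtain[OF imag_expansion_mult[OF imag_expansion_power[OF w', of k] imag_expansion_mono[OF V, of r]]]
    obtain H C where H: "eventually (\<lambda>t. cmod (w' t ^ k * V t - (\<Sum>m<r. of_real (H m) * (\<i> * of_real t) ^ m)) \<le> C * \<bar>t\<bar> ^ r) (at 0)"
      by auto
    have "eventually (\<lambda>t. \<bar>u k t - (\<Sum>m<r. H m * Re ((\<i> * of_real t) ^ (m + q k)))\<bar> \<le> C * \<bar>t\<bar> ^ (r + q k)) (at 0)"
      using H eventually_neq_at_within[of 0 0]
    proof eventually_elim
      case (elim t)
      have kq: "3 * k = Suc (q k)" using False by (simp add: q_def)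
      have "w t ^ k = (\<i> * of_real t) ^ (3 * k) * w' t ^ k"
        using elim by (simp add: w'_def power_divide power_mult)
      hence "u k t = Re ((\<i> * of_real t) ^ q k * (w' t ^ k * V t))"
        using elim unfolding u_def kq by simp
      moreover have "(\<Sum>m<r. H m * Re ((\<i> * of_real t) ^ (m + q k))) = Re ((\<i> * of_real t) ^ q k * (\<Sum>m<r. of_real (H m) * (\<i> * of_real t) ^ m))"
        unfolding sum_distrib_left Re_sum
        by (intro sum.cong refl) (rule Re_shift_power)
      ultimately have "u k t - (\<Sum>m<r. H m * Re ((\<i> * of_real t) ^ (m + q k))) =
          Re ((\<i> * of_real t) ^ q k * (w' t ^ k * V t - (\<Sum>m<r. of_real (H m) * (\<i> * of_real t) ^ m)))"
        by (simp only: right_diff_distrib minus_complex.sel)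
      also have "\<bar>\<dots>\<bar> \<le> cmod ((\<i> * of_real t) ^ q k * (w' t ^ k * V t - (\<Sum>m<r. of_real (H m) * (\<i> * of_real t) ^ m)))"
        by (rule abs_Re_le_cmod)
      also have "\<dots> = \<bar>t\<bar> ^ q k * cmod (w' t ^ k * V t - (\<Sum>m<r. of_real (H m) * (\<i> * of_real t) ^ m))"
        by (simp add: norm_mult norm_power)
      also have "\<dots> \<le> \<bar>t\<bar> ^ q k * (C * \<bar>t\<bar> ^ r)" using elim by (intro mult_left_mono) auto
      finally show ?case by (simp add: power_add mult_ac)
    qed
    thus ?thesis by blast
  qed
  hence "\<forall>k. \<exists>e C. eventually (\<lambda>t. \<bar>u k t - (\<Sum>m<r. e m * Re ((\<i> * of_real t) ^ (m + q k)))\<bar> \<le> C * \<bar>t\<bar> ^ (r + q k)) (at 0)"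
    by (rule allI)
  from choice_pair[OF this] obtain e C where eC: "\<And>k. eventually (\<lambda>t. \<bar>u k t - (\<Sum>m<r. e k m * Re ((\<i> * of_real t) ^ (m + q k)))\<bar> \<le> C k * \<bar>t\<bar> ^ (r + q k)) (at 0)"
    by (elim exE) (rule that, erule spec)
  have ev1: "eventually (\<lambda>t. \<forall>k\<in>{..r}. \<bar>u k t - (\<Sum>m<r. e k m * Re ((\<i> * of_real t) ^ (m + q k)))\<bar> \<le> C k * \<bar>t\<bar> ^ (r + q k)) (at 0)"
    by (intro eventually_ball_finite ballI eC) auto
  obtain B where B: "B > 0" "eventually (\<lambda>t. cmod (w' t) \<le> B) (at 0)"
    using imag_expansion_bounded[OF w'] by (elim landau_o.bigE) auto
  obtain A where A: "A > 0" "eventually (\<lambda>t. cmod (V t) \<le> A) (at 0)"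
    using imag_expansion_bounded[OF V] by (elim landau_o.bigE) auto
  \<comment> \<open>This radius gives |w| <= B |t|^3 <= (b/2) t^2, so exp(n |w|) uses up at most
    half of the Gaussian exponent.\<close>
  have ev2: "eventually (\<lambda>t::real. \<bar>t\<bar> < b / (2 * B)) (at 0)"
    using eventually_at_ball[of "b / (2 * B)" "0::real" UNIV] b B by (simp add: dist_real_def)
  from eventually_conj[OF ev1 eventually_conj[OF B(2) eventually_conj[OF A(2) ev2]]]
  obtain d where d: "d > 0" "\<And>t. t \<noteq> 0 \<Longrightarrow> \<bar>t\<bar> \<le> d \<Longrightarrow> (\<forall>k\<in>{..r}. \<bar>u k t - (\<Sum>m<r. e k m * Re ((\<i> * of_real t) ^ (m + q k)))\<bar> \<le> C k * \<bar>t\<bar> ^ (r + q k))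
       \<and> cmod (w' t) \<le> B \<and> cmod (V t) \<le> A \<and> \<bar>t\<bar> < b / (2 * B)"
    unfolding eventually_at_le by (auto simp: dist_real_def)
  define \<delta> where "\<delta> = min d 1"
  have \<delta>: "\<delta> > 0" "\<delta> \<le> 1" "\<delta> \<le> d" using d by (auto simp: \<delta>_def)
  let ?S = "{-\<delta>..\<delta>}"
  have S: "\<bar>t\<bar> \<le> d" if "t \<in> ?S" for t using that \<delta> by auto
  let ?E = "\<lambda>n t. exp (- (real n * b) * t\<^sup>2)"
  let ?J = "\<lambda>k n. LINT t:?S|lborel. u k t * ?E n t"
  have J1: "half_int_expansion r (\<lambda>n. real n ^ i * ?J k n)" if "k \<le> r" "i \<le> k" for k i
    by (rule half_int_expansion_gauss_int(1)[where e = "e k" and q = "q k" and C = "C k"])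
       (use b \<delta> that d(2) S in \<open>auto simp: q_def\<close>)
  have J2: "set_integrable lborel ?S (\<lambda>t. u k t * ?E n t)" if "k \<le> r" "n > 0" for k n
    by (rule half_int_expansion_gauss_int(2)[where e = "e k" and q = "q k" and C = "C k" and i = 0 and r = r])
       (use b \<delta> that d(2) S in auto)
  have J: "half_int_expansion r (\<lambda>n. real (n choose k) * ?J k n)" if k: "k \<le> r" for k
  proof -
    obtain p :: "real poly" where p: "degree p \<le> k" "\<And>n. real (n choose k) = poly p (real n)"
      using choose_poly by blast
    have "half_int_expansion r (\<lambda>n. \<Sum>i\<le>degree p. coeff p i * (real n ^ i * ?J k n))"
      using p(1) by (intro half_int_expansion_sum half_int_expansion_cmult J1 k) auto
    thus ?thesis unfolding p(2) poly_altdef by (simp add: sum_distrib_right mult_ac)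
  qed
  define rem where "rem n t = Re (((1 + w t) ^ n - (\<Sum>k\<le>r. of_nat (n choose k) * w t ^ k)) * V t / (\<i> * of_real t)) * ?E n t" for n t
  have remm: "rem n \<in> borel_measurable borel" for n unfolding rem_def by measurable
  \<comment> \<open>The factor n^(r+1) |t|^(3r+2) integrates to n^(r + 1 - (3r + 3)/2), which is
    exactly n^(-(r + 1)/2).\<close>
  have rem_bd: "\<bar>rem n t\<bar> \<le> (B ^ (r + 1) * A) * real n ^ (r + 1) * \<bar>t\<bar> ^ (3 * r + 2) * exp (- (real n * (b / 2)) * t\<^sup>2)"
    if t: "t \<noteq> 0" "t \<in> ?S" for n t
  proof -
    note dt = d(2)[OF t(1) S[OF t(2)]]
    have wt: "cmod (w t) = cmod (w' t) * \<bar>t\<bar> ^ 3"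
      using t by (simp add: w'_def norm_divide norm_mult norm_power)
    have w1: "cmod (w t) \<le> B * \<bar>t\<bar> ^ 3" unfolding wt using dt by (intro mult_right_mono) auto
    also have "\<dots> \<le> (b / 2) * t\<^sup>2"
    proof -
      have "B * \<bar>t\<bar> \<le> b / 2" using dt B by (simp add: field_simps)
      hence "B * \<bar>t\<bar> * t\<^sup>2 \<le> b / 2 * t\<^sup>2" by (intro mult_right_mono) auto
      moreover have "\<bar>t\<bar> ^ 3 = \<bar>t\<bar> * t\<^sup>2" by (simp add: power3_eq_cube power2_eq_square abs_mult)
      ultimately show ?thesis by (simp add: mult.assoc)
    qed
    finally have w2: "real n * cmod (w t) \<le> real n * ((b / 2) * t\<^sup>2)" by (intro mult_left_mono) auto
    have "\<bar>rem n t\<bar> \<le> cmod (((1 + w t) ^ n - (\<Sum>k\<le>r. of_nat (n choose k) * w t ^ k)) * V t / (\<i> * of_real t)) * ?E n t"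
      unfolding rem_def abs_mult by (intro mult_mono abs_Re_le_cmod) auto
    also have "\<dots> = cmod ((1 + w t) ^ n - (\<Sum>k\<le>r. of_nat (n choose k) * w t ^ k)) * (cmod (V t) / \<bar>t\<bar>) * ?E n t"
      by (simp add: norm_mult norm_divide)
    also have "\<dots> \<le> ((real n * cmod (w t)) ^ (r + 1) * exp (real n * cmod (w t))) * (A / \<bar>t\<bar>) * ?E n t"
      using dt by (intro mult_right_mono mult_mono cmod_binomial_tail divide_right_mono) auto
    also have "\<dots> \<le> ((real n * (B * \<bar>t\<bar> ^ 3)) ^ (r + 1) * exp (real n * ((b / 2) * t\<^sup>2))) * (A / \<bar>t\<bar>) * ?E n t"
      using w1 w2 A B(1) by (intro mult_right_mono mult_mono power_mono mult_left_mono) auto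
    also have "\<dots> = (real n * (B * \<bar>t\<bar> ^ 3)) ^ (r + 1) * (A / \<bar>t\<bar>) * (exp (real n * ((b / 2) * t\<^sup>2)) * ?E n t)"
      by (simp only: mult_ac)
    also have "exp (real n * ((b / 2) * t\<^sup>2)) * ?E n t = exp (- (real n * (b / 2)) * t\<^sup>2)"
      by (simp add: exp_add[symmetric] algebra_simps)
    also have "(real n * (B * \<bar>t\<bar> ^ 3)) ^ (r + 1) * (A / \<bar>t\<bar>) = (B ^ (r + 1) * A) * real n ^ (r + 1) * \<bar>t\<bar> ^ (3 * r + 2)"
    proof -
      have "(\<bar>t\<bar> ^ 3) ^ (r + 1) = \<bar>t\<bar> ^ (3 * r + 2) * \<bar>t\<bar>"
      proof -
        have "3 * (r + 1) = Suc (3 * r + 2)" by simp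
        thus ?thesis by (metis power_Suc2 power_mult)
      qed
      thus ?thesis using t(1) by (simp only: power_mult_distrib) simp
    qed
    finally show ?thesis .
  qed
  have rem1: "set_integrable lborel ?S (rem n)" if "n > 0" for n
    by (rule small_int(1)[where f = rem, OF _ remm rem_bd _ that]) (use b in auto)
  have rem2: "(\<lambda>n. LINT t:?S|lborel. rem n t) \<in> O(\<lambda>n. real n powr (-((real r + 1) / 2)))"
    by (rule small_int'[where f = rem, OF _ remm rem_bd]) (use b in \<open>auto simp: field_simps\<close>)
  let ?I = "\<lambda>n t. Re (\<phi> t ^ n * V t / (\<i> * of_real t))"
  have I: "?I n t = (\<Sum>k\<le>r. real (n choose k) * (u k t * ?E n t)) + rem n t" for n t
  proof -
    have "\<phi> t = (1 + w t) * of_real (exp (- b * t\<^sup>2))"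
      by (simp add: w_def mult.assoc flip: of_real_mult exp_add)
    hence "\<phi> t ^ n = (1 + w t) ^ n * of_real (?E n t)"
      by (simp add: power_mult_distrib exp_of_nat_mult[symmetric] mult.assoc flip: of_real_power)
    hence "?I n t = Re ((1 + w t) ^ n * V t / (\<i> * of_real t) * of_real (?E n t))"
      by (simp add: mult_ac)
    also have "\<dots> = Re ((1 + w t) ^ n * V t / (\<i> * of_real t)) * ?E n t"
      by (simp only: Re_mult_real)
    also have "(1 + w t) ^ n * V t / (\<i> * of_real t) = (\<Sum>k\<le>r. of_real (real (n choose k)) * (w t ^ k * V t / (\<i> * of_real t)))
        + ((1 + w t) ^ n - (\<Sum>k\<le>r. of_nat (n choose k) * w t ^ k)) * V t / (\<i> * of_real t)"
      by (simp add: left_diff_distrib diff_divide_distrib sum_distrib_right sum_divide_distrib mult.assoc)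
    also have "Re \<dots> * ?E n t = (\<Sum>k\<le>r. real (n choose k) * (u k t * ?E n t)) + rem n t"
      unfolding plus_complex.sel distrib_right rem_def u_def Re_sum sum_distrib_right Re_real_mult by (simp only: mult.assoc)
    finally show ?thesis .
  qed
  have int: "set_integrable lborel ?S (\<lambda>t. \<Sum>k\<le>r. real (n choose k) * (u k t * ?E n t))" if "n > 0" for n
    using J2 that by (intro set_integrable_sum' set_integrable_mult_right) auto
  have I1: "set_integrable lborel ?S (?I n)" if "n > 0" for n
    unfolding I using int[OF that] rem1[OF that] by (rule set_integral_add)
  have I2: "(LINT t:?S|lborel. ?I n t) = (\<Sum>k\<le>r. real (n choose k) * ?J k n) + (LINT t:?S|lborel. rem n t)" if "n > 0" for n
  proof -
    have "(LINT t:?S|lborel. ?I n t) = (LINT t:?S|lborel. (\<Sum>k\<le>r. real (n choose k) * (u k t * ?E n t))) + (LINT t:?S|lborel. rem n t)"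
      unfolding I using int[OF that] rem1[OF that] by (rule set_integral_add)
    also have "(LINT t:?S|lborel. (\<Sum>k\<le>r. real (n choose k) * (u k t * ?E n t))) = (\<Sum>k\<le>r. LINT t:?S|lborel. real (n choose k) * (u k t * ?E n t))"
      using J2 that by (intro set_integrable_sum' set_integrable_mult_right) auto
    finally show ?thesis by simp
  qed
  have "half_int_expansion r (\<lambda>n. (\<Sum>k\<le>r. real (n choose k) * ?J k n) + (LINT t:?S|lborel. rem n t))"
    by (intro half_int_expansion_add half_int_expansion_sum J half_int_expansion_bigo[OF rem2]) auto
  hence "half_int_expansion r (\<lambda>n. LINT t:?S|lborel. ?I n t)"
    by (rule half_int_expansion_cong) (auto intro!: eventually_mono[OF eventually_gt_at_top[of 0]] simp: I2)
  with \<delta> I1 show ?thesis by blast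
qed

section \<open>Gaussian smoothing of the sign function\<close>

lemma fubini_dominated:
  fixes f :: "'a \<Rightarrow> 'b \<Rightarrow> real"
  assumes M: "finite_measure M" and N: "finite_measure N"
    and f: "case_prod f \<in> borel_measurable (M \<Otimes>\<^sub>M N)" and h: "integrable M h"
    and bd: "\<And>x y. x \<in> space M \<Longrightarrow> y \<in> space N \<Longrightarrow> \<bar>f x y\<bar> \<le> h x"
  shows "(LINT x|M. LINT y|N. f x y) = (LINT y|N. LINT x|M. f x y)"
    and "integrable M (\<lambda>x. LINT y|N. f x y)" and "integrable N (\<lambda>y. LINT x|M. f x y)"
proof -
  interpret M: finite_measure M by fact
  interpret N: finite_measure N by fact
  interpret P: pair_sigma_finite M N ..
  note f [measurable]
  have [measurable]: "h \<in> borel_measurable M" using h by auto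
  have "integrable (M \<Otimes>\<^sub>M N) (\<lambda>p. h (fst p))"
    by (rule P.Fubini_integrable) (use h in auto)
  hence int: "integrable (M \<Otimes>\<^sub>M N) (case_prod f)"
    by (rule Bochner_Integration.integrable_bound[OF _ f])
       (auto intro!: AE_I2 simp: space_pair_measure intro: order_trans[OF bd])
  from P.Fubini_integral[OF int] show "(LINT x|M. LINT y|N. f x y) = (LINT y|N. LINT x|M. f x y)" by simp
  show "integrable M (\<lambda>x. LINT y|N. f x y)" using P.integrable_fst'[OF int] by simp
  show "integrable N (\<lambda>y. LINT x|M. f x y)" using P.integrable_snd[OF int] by simp
qed

lemma gauss_half_line: "(LINT y:{0..}|lborel. exp (- (y\<^sup>2 / 2))) = sqrt (pi / 2)"
proof -
  have "sqrt pi / 2 = (LINT x|lborel. indicator {0..} x *\<^sub>R exp (- x\<^sup>2))"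
    using gaussian_moment_0 by (simp add: has_bochner_integral_iff)
  also have "\<dots> = (1 / sqrt 2) * (LINT x|lborel. indicator {0..} (0 + 1 / sqrt 2 * x) *\<^sub>R exp (- (0 + 1 / sqrt 2 * x)\<^sup>2))"
    by (subst lborel_integral_real_affine[where c = "1 / sqrt 2" and t = 0]) auto
  also have "(\<lambda>x. indicator {0..} (0 + 1 / sqrt 2 * x) *\<^sub>R exp (- (0 + 1 / sqrt 2 * x)\<^sup>2)) = (\<lambda>x::real. indicator {0..} x *\<^sub>R exp (- (x\<^sup>2 / 2)) :: real)"
    by (auto simp: fun_eq_iff indicator_def power_divide zero_le_divide_iff)
  finally have "(LINT y:{0..}|lborel. exp (- (y\<^sup>2 / 2))) = sqrt 2 * (sqrt pi / 2)"
    by (simp add: set_lebesgue_integral_def)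
  also have "\<dots> = sqrt pi / sqrt 2" by (simp add: field_simps)
  finally show ?thesis by (simp add: real_sqrt_divide)
qed

text \<open>Shift the tail to the origin and use (a + x)^2 >= a^2 + x^2 for a, x >= 0: it is at most
  exp(-a^2/2) times the integral over the half-line.\<close>

lemma gauss_tail:
  assumes "a \<ge> 0"
  shows "\<bar>1 - sqrt (2 / pi) * (LINT y:{0..a}|lborel. exp (- (y\<^sup>2 / 2)))\<bar> \<le> exp (- (a\<^sup>2 / 2))"
proof -
  let ?g = "\<lambda>y::real. exp (- (y\<^sup>2 / 2)) :: real"
  have int: "integrable lborel ?g" using integrable_gauss_moment[of "1/2" 0] by simp
  have si: "set_integrable lborel A ?g" if "A \<in> sets lborel" for A
    unfolding set_integrable_def by (rule integrable_mult_indicator[OF that int])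
  define T where "T = (LINT y:{a<..}|lborel. ?g y)"
  have "{0..} = {0..a} \<union> {a<..}" using assms by auto
  hence K: "sqrt (pi / 2) = (LINT y:{0..a}|lborel. ?g y) + T"
    unfolding gauss_half_line[symmetric] T_def by (simp only:) (intro set_integral_Un si; auto)
  have T0: "T \<ge> 0" unfolding T_def set_lebesgue_integral_def by (intro integral_nonneg_AE) auto
  have "T = (LINT x|lborel. indicator {a<..} (a + 1 * x) *\<^sub>R ?g (a + 1 * x))"
    unfolding T_def set_lebesgue_integral_def by (subst lborel_integral_real_affine[where c = 1 and t = a]) auto
  also have "\<dots> \<le> (LINT x|lborel. ?g a * (indicator {0..} x *\<^sub>R ?g x))"
  proof (rule integral_mono)
    have "integrable lborel (\<lambda>x. indicator {a<..} x *\<^sub>R ?g x)" using si[of "{a<..}"] by (simp add: set_integrable_def)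
    from lborel_integrable_real_affine[OF this, of 1 a]
    show "integrable lborel (\<lambda>x. indicator {a<..} (a + 1 * x) *\<^sub>R ?g (a + 1 * x))" by simp
    show "integrable lborel (\<lambda>x. ?g a * (indicator {0..} x *\<^sub>R ?g x))"
      using si[of "{0..}"] unfolding set_integrable_def by (intro integrable_mult_right) auto
    fix x :: real
    show "indicator {a<..} (a + 1 * x) *\<^sub>R ?g (a + 1 * x) \<le> ?g a * (indicator {0..} x *\<^sub>R ?g x)"
    proof (cases "x > 0")
      case True
      have "?g (a + x) \<le> ?g a * ?g x"
        using True assms by (simp add: exp_add[symmetric] power2_sum add_divide_distrib)
      thus ?thesis using True by simp
    qed (auto simp: indicator_def)
  qed
  also have "\<dots> = ?g a * sqrt (pi / 2)" using gauss_half_line by (simp add: set_lebesgue_integral_def)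
  finally have T1: "T \<le> ?g a * sqrt (pi / 2)" .
  have s: "sqrt (2 / pi) * sqrt (pi / 2) = 1" by (simp flip: real_sqrt_mult)
  have "1 - sqrt (2 / pi) * (LINT y:{0..a}|lborel. ?g y) = sqrt (2 / pi) * T"
    using K s by (simp add: algebra_simps)
  moreover have "sqrt (2 / pi) * T \<le> ?g a"
  proof -
    have "sqrt (2 / pi) * T \<le> sqrt (2 / pi) * (?g a * sqrt (pi / 2))"
      using T1 by (intro mult_left_mono) auto
    also have "\<dots> = ?g a * (sqrt (2 / pi) * sqrt (pi / 2))" by (rule mult.left_commute)
    finally show ?thesis unfolding s by simp
  qed
  ultimately show ?thesis using T0 by simp
qed

lemma integral_cos_Icc:
  fixes a z :: real
  assumes "a \<ge> 0" "z \<noteq> 0"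
  shows "(LINT y:{0..a}|lborel. cos (y * z)) = sin (a * z) / z"
proof -
  have "(\<integral>y. cos (y * z) * indicator {0..a} y \<partial>lborel) = sin (a * z) / z - sin (0 * z) / z"
    using assms by (intro integral_FTC_Icc_real) (auto intro!: derivative_eq_intros continuous_intros)
  thus ?thesis by (simp add: set_lebesgue_integral_def mult.commute)
qed

abbreviation "\<N> \<equiv> std_normal_distribution"

lemma prob_N: "prob_space \<N>"
  using prob_space_normal_density by simp

lemma N_AE_nz: "AE z in \<N>. z \<noteq> 0"
  using AE_lborel_singleton[of "0::real"] by (subst AE_density) auto

lemma integral_N_cos: "(LINT z|\<N>. cos (a * z)) = exp (- (a\<^sup>2 / 2))"
proof -
  interpret N: real_distribution \<N> by (rule real_dist_normal_dist)
  have "Re (char \<N> a) = (LINT z|\<N>. Re (iexp (a * z)))"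
    unfolding char_def by (intro integral_Re[symmetric] N.integrable_iexp) auto
  thus ?thesis by (simp add: char_std_normal_distribution flip: cis_conv_exp of_real_mult)
qed

text \<open>For a >= 0, sin(a z)/z is the integral of cos(y z) over 0 <= y <= a. Averaging over a
  normal z turns the cosine into exp(-y^2/2), and the normalised integral of that is a smooth
  version of \<open>sgn a\<close> with error \<open>gauss_tail\<close>. Negative a follow by
  oddness.\<close>

lemma sgn_gauss:
  "\<bar>sgn a - sqrt (2 / pi) * (LINT z|\<N>. sin (a * z) / z)\<bar> \<le> exp (- (a\<^sup>2 / 2))"
proof -
  interpret N: prob_space \<N> by (rule prob_N)
  have main: "(LINT z|\<N>. sin (a * z) / z) = (LINT y:{0..a}|lborel. exp (- (y\<^sup>2 / 2)))" if a: "a \<ge> 0" for a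
  proof -
    let ?L = "restrict_space lborel {0..a}"
    have L: "finite_measure ?L"
      by (rule finite_measureI) (use a in \<open>simp add: emeasure_restrict_space space_restrict_space\<close>)
    have int: "integral\<^sup>L ?L f = (LINT y:{0..a}|lborel. f y)" for f :: "real \<Rightarrow> real"
      by (simp add: integral_restrict_space set_lebesgue_integral_def)
    have "(LINT z|\<N>. sin (a * z) / z) = (LINT z|\<N>. LINT y|?L. cos (y * z))"
      using N_AE_nz unfolding int
      by (intro integral_cong_AE) (auto simp: integral_cos_Icc[OF a, unfolded set_lebesgue_integral_def real_scaleR_def] set_lebesgue_integral_def elim!: eventually_mono)
    also have "\<dots> = (LINT y|?L. LINT z|\<N>. cos (y * z))"
    proof (rule fubini_dominated[OF N.finite_measure_axioms L, where h = "\<lambda>_. 1"])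
      have "(\<lambda>(z, y). cos (y * z :: real)) \<in> borel_measurable (borel \<Otimes>\<^sub>M borel)" by measurable
      moreover have "(\<lambda>p. p) \<in> \<N> \<Otimes>\<^sub>M ?L \<rightarrow>\<^sub>M (borel \<Otimes>\<^sub>M borel)"
        by (intro measurable_pair) (auto simp: comp_def intro!: measurable_compose[OF measurable_fst] measurable_compose[OF measurable_snd] measurable_restrict_space1)
      ultimately show "(\<lambda>(z, y). cos (y * z)) \<in> borel_measurable (\<N> \<Otimes>\<^sub>M ?L)"
        by (rule measurable_compose[rotated])
    qed auto
    also have "\<dots> = (LINT y:{0..a}|lborel. exp (- (y\<^sup>2 / 2)))" by (simp add: integral_N_cos int)
    finally show ?thesis .
  qed
  show ?thesis
  proof (cases a "0::real" rule: linorder_cases)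
    case greater thus ?thesis using gauss_tail[of a] main[of a] by simp
  next
    case less
    have "sgn a - sqrt (2 / pi) * (LINT z|\<N>. sin (a * z) / z) = - (1 - sqrt (2 / pi) * (LINT y:{0..- a}|lborel. exp (- (y\<^sup>2 / 2))))"
    proof -
      have "(LINT y:{0..- a}|lborel. exp (- (y\<^sup>2 / 2))) = - (LINT z|\<N>. sin (a * z) / z)"
        using main[of "- a"] less by simp
      thus ?thesis using less by (simp only:) simp
    qed
    thus ?thesis using gauss_tail[of "- a"] less by (simp only: abs_minus_cancel) simp
  qed simp
qed

lemma abs_sin_div_le: "\<bar>sin (a * z) / z\<bar> \<le> \<bar>a\<bar>" for a z :: real
proof (cases "z = 0")
  case False
  thus ?thesis using abs_sin_x_le_abs_x[of "a * z"] by (simp add: abs_mult field_simps)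
qed simp

section \<open>The sign expectation in terms of the characteristic function\<close>

context real_distribution
begin

lemma Im_char: "Im (char M t) = (LINT x|M. sin (t * x))"
  unfolding char_def using integral_Im[OF integrable_iexp[of "\<lambda>x. t * x"]] by (simp flip: cis_conv_exp of_real_mult)

lemma Re_char: "Re (char M t) = (LINT x|M. cos (t * x))"
  unfolding char_def using integral_Re[OF integrable_iexp[of "\<lambda>x. t * x"]] by (simp flip: cis_conv_exp of_real_mult)

lemma abs_Im_char_le:
  assumes "integrable M (\<lambda>x. x)"
  shows "\<bar>Im (char M t)\<bar> \<le> \<bar>t\<bar> * (LINT x|M. \<bar>x\<bar>)"
proof -
  have "\<bar>Im (char M t)\<bar> \<le> (LINT x|M. \<bar>sin (t * x)\<bar>)"
    unfolding Im_char using integral_norm_bound[of M "\<lambda>x. sin (t * x)"] by simp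
  also have "\<dots> \<le> (LINT x|M. \<bar>t\<bar> * \<bar>x\<bar>)"
  proof (rule integral_mono)
    show "integrable M (\<lambda>x. \<bar>sin (t * x)\<bar>)" by (rule integrable_const_bound[where B = 1]) auto
    show "integrable M (\<lambda>x. \<bar>t\<bar> * \<bar>x\<bar>)" using assms by (intro integrable_mult_right integrable_abs)
    show "\<bar>sin (t * x)\<bar> \<le> \<bar>t\<bar> * \<bar>x\<bar>" for x
      using abs_sin_x_le_abs_x[of "t * x"] by (simp only: abs_mult)
  qed
  finally show ?thesis by simp
qed

text \<open>Writing the Gaussian as a cosine average over a normal frequency turns the smoothing
  error into an average of the characteristic function.\<close>

lemma gauss_kernel: "(LINT x|M. exp (- ((T * x)\<^sup>2 / 2))) = (LINT z|\<N>. Re (char M (T * z)))"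
proof -
  interpret N: prob_space \<N> by (rule prob_N)
  have "(LINT x|M. exp (- ((T * x)\<^sup>2 / 2))) = (LINT x|M. LINT z|\<N>. cos (T * x * z))"
    by (simp add: integral_N_cos)
  also have "\<dots> = (LINT z|\<N>. LINT x|M. cos (T * x * z))"
    by (rule fubini_dominated[OF finite_measure_axioms N.finite_measure_axioms, where h = "\<lambda>_. 1"]) auto
  also have "\<dots> = (LINT z|\<N>. Re (char M (T * z)))" by (simp add: Re_char mult_ac)
  finally show ?thesis .
qed

lemma gauss_sin_kernel:
  assumes "integrable M (\<lambda>x. x)"
  shows "(LINT x|M. LINT z|\<N>. sin (T * x * z) / z) = (LINT z|\<N>. Im (char M (T * z)) / z)"
    and "integrable M (\<lambda>x. LINT z|\<N>. sin (T * x * z) / z)"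
proof -
  interpret N: prob_space \<N> by (rule prob_N)
  have m: "(\<lambda>(x, z). sin (T * x * z) / z) \<in> borel_measurable (M \<Otimes>\<^sub>M \<N>)" by measurable
  have h: "integrable M (\<lambda>x. \<bar>T * x\<bar>)" using assms by (intro integrable_abs integrable_mult_right)
  note fub = fubini_dominated[OF finite_measure_axioms N.finite_measure_axioms m h abs_sin_div_le]
  have "(LINT x|M. LINT z|\<N>. sin (T * x * z) / z) = (LINT z|\<N>. LINT x|M. sin (T * x * z) / z)"
    by (rule fub(1))
  also have "\<dots> = (LINT z|\<N>. Im (char M (T * z)) / z)"
    unfolding Im_char by (intro Bochner_Integration.integral_cong refl) (simp add: mult_ac)
  finally show "(LINT x|M. LINT z|\<N>. sin (T * x * z) / z) = (LINT z|\<N>. Im (char M (T * z)) / z)" .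
  show "integrable M (\<lambda>x. LINT z|\<N>. sin (T * x * z) / z)"
    by (rule fub(2))
qed

text \<open>This is \<open>sgn_gauss\<close> at a = T x, integrated over x. The error is a Gaussian
  bump of width 1/T around 0, which \<open>gauss_kernel\<close> evaluates.\<close>

lemma sgn_smoothing:
  assumes x: "integrable M (\<lambda>x. x)" and "T > 0"
  shows "\<bar>(LINT x|M. sgn x) - sqrt (2 / pi) * (LINT z|\<N>. Im (char M (T * z)) / z)\<bar> \<le> (LINT z|\<N>. Re (char M (T * z)))"
proof -
  note k = gauss_sin_kernel[OF x, of T]
  have sg: "integrable M (\<lambda>x. sgn x)"
    by (rule integrable_const_bound[where B = 1]) (auto simp: abs_sgn_eq)
  define h where "h x = sgn x - sqrt (2 / pi) * (LINT z|\<N>. sin (T * x * z) / z)" for x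
  have i1: "integrable M (\<lambda>x. sqrt (2 / pi) * (LINT z|\<N>. sin (T * x * z) / z))"
    using k(2) by (rule integrable_mult_right)
  have h: "integrable M h" unfolding h_def using sg i1 by (rule Bochner_Integration.integrable_diff)
  have "(LINT x|M. h x) = (LINT x|M. sgn x) - (LINT x|M. sqrt (2 / pi) * (LINT z|\<N>. sin (T * x * z) / z))"
    unfolding h_def using sg i1 by (rule Bochner_Integration.integral_diff)
  hence eq: "(LINT x|M. sgn x) - sqrt (2 / pi) * (LINT z|\<N>. Im (char M (T * z)) / z) = (LINT x|M. h x)"
    unfolding integral_mult_right_zero k(1) by (rule sym)
  have "\<bar>LINT x|M. h x\<bar> \<le> (LINT x|M. \<bar>h x\<bar>)"
    using integral_norm_bound[of M h] by (simp only: real_norm_def)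
  also have "\<dots> \<le> (LINT x|M. exp (- ((T * x)\<^sup>2 / 2)))"
  proof (rule integral_mono)
    show "integrable M (\<lambda>x. \<bar>h x\<bar>)" using h by (rule integrable_abs)
    show "integrable M (\<lambda>x. exp (- ((T * x)\<^sup>2 / 2)))"
      by (rule integrable_const_bound[where B = 1]) auto
    show "\<bar>h x\<bar> \<le> exp (- ((T * x)\<^sup>2 / 2))" for x
      using sgn_gauss[of "T * x"] \<open>T > 0\<close> by (simp add: sgn_mult h_def)
  qed
  also have "\<dots> = (LINT z|\<N>. Re (char M (T * z)))" by (rule gauss_kernel)
  finally show ?thesis unfolding eq .
qed

text \<open>The same bump dominates the indicator of 0, so it also controls the atom.\<close>

lemma atom_smoothing: "measure M {0} \<le> (LINT z|\<N>. Re (char M (T * z)))"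
proof -
  have "measure M {0} = (LINT x|M. indicator {0} x)" by simp
  also have "\<dots> \<le> (LINT x|M. exp (- ((T * x)\<^sup>2 / 2)))"
    by (intro integral_mono integrable_const_bound[where B = 1]) (auto simp: indicator_def)
  finally show ?thesis unfolding gauss_kernel .
qed

text \<open>The frequencies \<open>\<bar>t\<bar> > \<delta>\<close> only contribute terms of order \<open>\<rho>\<close>; the scale \<open>T\<close> is free.\<close>

lemma char_gauss_bound:
  assumes T: "T > 0" and \<delta>: "\<delta> > 0" and \<rho>: "\<And>t. \<bar>t\<bar> \<ge> \<delta> \<Longrightarrow> cmod (char M t) \<le> \<rho>"
  shows "(LINT z|\<N>. Re (char M (T * z))) \<le> \<delta> / T + \<rho>"
proof -
  interpret N: real_distribution \<N> by (rule real_dist_normal_dist)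
  have \<rho>0: "\<rho> \<ge> 0" using \<rho>[of \<delta>] \<delta> by (meson abs_ge_self norm_ge_zero order_trans)
  let ?A = "{-(\<delta> / T)..\<delta> / T}"
  have "(LINT z|\<N>. Re (char M (T * z))) \<le> (LINT z|\<N>. indicator ?A z + \<rho>)"
  proof (rule integral_mono)
    show "integrable \<N> (\<lambda>z. Re (char M (T * z)))"
      using cmod_char_le_1 abs_Re_le_cmod order_trans by (intro N.integrable_const_bound[where B = 1]) (auto intro!: AE_I2, blast)
    show "integrable \<N> (\<lambda>z. indicator ?A z + \<rho>)" by (rule N.integrable_const_bound[where B = "1 + \<rho>"]) (auto simp: indicator_def \<rho>0)
    fix z
    show "Re (char M (T * z)) \<le> indicator ?A z + \<rho>"
    proof (cases "z \<in> ?A")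
      case True
      thus ?thesis using cmod_char_le_1[of "T * z"] complex_Re_le_cmod[of "char M (T * z)"] \<rho>0 by simp
    next
      case False
      hence "\<bar>z\<bar> \<ge> \<delta> / T" by auto
      hence "\<bar>T * z\<bar> \<ge> \<delta>" using T by (simp add: abs_mult field_simps)
      thus ?thesis using \<rho> complex_Re_le_cmod[of "char M (T * z)"] False by fastforce
    qed
  qed
  also have "\<dots> = measure \<N> ?A + \<rho>"
    by (subst Bochner_Integration.integral_add) (use N.prob_space in \<open>auto intro: N.integrable_const_bound[where B = 1]\<close>)
  \<comment> \<open>The normal density is at most 1/2 and the interval has length 2 \<delta> /
    T.\<close>
  also have "measure \<N> ?A \<le> \<delta> / T"
  proof -
    have "measure \<N> ?A = (LINT z|\<N>. indicator ?A z)" by simp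
    also have "\<dots> = (LINT z|lborel. std_normal_density z * indicator ?A z)"
      by (subst integral_density) (auto simp: normal_density_nonneg)
    also have "\<dots> \<le> (LINT z|lborel. 1 / 2 * indicator ?A z)"
    proof (rule integral_mono)
      have "std_normal_density z \<le> 1 / 2" for z
      proof -
        have "sqrt (2 * pi) \<ge> 2" using pi_gt3 by (intro real_le_rsqrt) auto
        hence "1 / sqrt (2 * pi) \<le> 1 / 2" by (intro divide_left_mono) auto
        moreover have "exp (- z\<^sup>2 / 2) \<le> 1" by simp
        ultimately have "1 / sqrt (2 * pi) * exp (- z\<^sup>2 / 2) \<le> 1 / 2 * 1" by (intro mult_mono) auto
        thus ?thesis by (simp add: std_normal_density_def)
      qed
      thus "std_normal_density z * indicator ?A z \<le> 1 / 2 * indicator ?A z" for z by (intro mult_right_mono) auto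
      show "integrable lborel (\<lambda>z. std_normal_density z * indicator ?A z)"
        using integrable_mult_indicator[of ?A lborel std_normal_density] integrable_normal_density[of 1 0] by (simp add: mult.commute)
      show "integrable lborel (\<lambda>z. 1 / 2 * indicator ?A z :: real)"
        using \<delta> T by (intro integrable_mult_right integrable_real_indicator) auto
    qed
    also have "\<dots> = \<delta> / T" using \<delta> T by simp
    finally show ?thesis .
  qed
  finally show ?thesis by simp
qed

text \<open>The first two error terms come from the smoothing, the third from the frequencies beyond
  \<delta>, where |Im| / |z| is at most \<rho> T / \<delta>, and the last from replacing the
  Gaussian cutoff exp(-(t/T)^2/2) by 1 on the central interval.\<close>

lemma sgn_fourier_bound:
  assumes x: "integrable M (\<lambda>x. x)" and T: "T > 0" and \<delta>: "0 < \<delta>" "\<delta> \<le> 1" and \<rho>: "\<And>t. \<bar>t\<bar> \<ge> \<delta> \<Longrightarrow> cmod (char M t) \<le> \<rho>"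
  shows "\<bar>(LINT x|M. sgn x) - (1 / pi) * (LINT t:{-\<delta>..\<delta>}|lborel. Im (char M t) / t)\<bar> \<le> \<delta> / T + \<rho> + T / \<delta> * \<rho> + 1 / T\<^sup>2"
proof -
  interpret N: real_distribution \<N> by (rule real_dist_normal_dist)
  have \<rho>0: "\<rho> \<ge> 0" using \<rho>[of \<delta>] \<delta> by (meson abs_ge_self norm_ge_zero order_trans)
  define K where "K = (LINT x|M. \<bar>x\<bar>)"
  have K0: "K \<ge> 0" by (simp add: K_def)
  have ImK: "\<bar>Im (char M t) / t\<bar> \<le> K" for t
  proof (cases "t = 0")
    case False
    thus ?thesis using abs_Im_char_le[OF x, of t] by (simp add: K_def field_simps abs_mult)
  qed (simp add: K0)
  let ?A = "{-(\<delta> / T)..\<delta> / T}"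
  let ?f = "\<lambda>z. Im (char M (T * z)) / z"
  have fK: "\<bar>?f z\<bar> \<le> T * K" for z
  proof (cases "z = 0")
    case False
    have "\<bar>?f z\<bar> = T * \<bar>Im (char M (T * z)) / (T * z)\<bar>" using T by (simp add: abs_mult)
    also have "\<dots> \<le> T * K" using ImK T by (intro mult_left_mono) auto
    finally show ?thesis .
  qed (use T K0 in simp)
  have fm: "?f \<in> borel_measurable borel" by measurable
  have iAm: "(\<lambda>z. indicator B z * ?f z) \<in> borel_measurable borel" if "B \<in> sets borel" for B
    using that fm by (intro borel_measurable_times borel_measurable_indicator)
  have intA: "integrable \<N> (\<lambda>z. indicator B z * ?f z)" if "B \<in> sets borel" for B
  proof (rule N.integrable_const_bound[where B = "T * K"])
    show "AE z in \<N>. norm (indicator B z * ?f z) \<le> T * K"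
    proof (intro AE_I2)
      fix z show "norm (indicator B z * ?f z) \<le> T * K"
        using fK[of z] T K0 by (cases "z \<in> B") auto
    qed
  qed (use iAm[OF that] in simp)
  have 1: "(LINT z|\<N>. ?f z) = (LINT z|\<N>. indicator ?A z * ?f z) + (LINT z|\<N>. indicator (- ?A) z * ?f z)"
  proof -
    have "(LINT z|\<N>. ?f z) = (LINT z|\<N>. indicator ?A z * ?f z + indicator (- ?A) z * ?f z)"
      by (rule Bochner_Integration.integral_cong) (auto simp: indicator_def)
    thus ?thesis using intA[of ?A] intA[of "- ?A"] by simp
  qed
  have 2: "\<bar>LINT z|\<N>. indicator (- ?A) z * ?f z\<bar> \<le> T / \<delta> * \<rho>"
  proof -
    have "norm (LINT z|\<N>. indicator (- ?A) z * ?f z) \<le> (LINT z|\<N>. T / \<delta> * \<rho>)"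
    proof (rule order_trans[OF integral_norm_bound], rule integral_mono)
      show "integrable \<N> (\<lambda>z. norm (indicator (- ?A) z * ?f z))" using intA[of "- ?A"] by (intro integrable_norm) auto
      fix z
      show "norm (indicator (- ?A) z * ?f z) \<le> T / \<delta> * \<rho>"
      proof (cases "z \<in> ?A")
        case True thus ?thesis using T \<delta> \<rho>0 by simp
      next
        case False
        hence z: "\<bar>z\<bar> \<ge> \<delta> / T" by auto
        have z0: "\<bar>z\<bar> > 0" using z \<delta> T by (meson divide_pos_pos less_le_trans)
        have "\<bar>T * z\<bar> \<ge> \<delta>" using z T by (simp add: abs_mult field_simps)
        hence "\<bar>Im (char M (T * z))\<bar> \<le> \<rho>" using \<rho> abs_Im_le_cmod order_trans by blast
        moreover have "1 / \<bar>z\<bar> \<le> T / \<delta>" using z z0 T \<delta> by (simp add: field_simps)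
        ultimately have "1 / \<bar>z\<bar> * \<bar>Im (char M (T * z))\<bar> \<le> T / \<delta> * \<rho>" using T \<delta> by (intro mult_mono) auto
        thus ?thesis using False by (simp add: abs_mult)
      qed
    qed simp
    thus ?thesis using N.prob_space by simp
  qed
  let ?e = "\<lambda>t. exp (- ((t / T)\<^sup>2 / 2))"
  \<comment> \<open>Substitution t = T z; the constants match because sqrt(2 pi) / pi = sqrt(2 /
    pi).\<close>
  have 3: "sqrt (2 / pi) * (LINT z|\<N>. indicator ?A z * ?f z) = (1 / pi) * (LINT t:{-\<delta>..\<delta>}|lborel. ?e t * (Im (char M t) / t))"
  proof -
    have "(LINT t:{-\<delta>..\<delta>}|lborel. ?e t * (Im (char M t) / t)) =
        T * (LINT z|lborel. indicator {-\<delta>..\<delta>} (0 + T * z) *\<^sub>R (?e (0 + T * z) * (Im (char M (0 + T * z)) / (0 + T * z))))"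
      unfolding set_lebesgue_integral_def using T by (subst lborel_integral_real_affine[where c = T and t = 0]) auto
    also have "\<dots> = (LINT z|lborel. T * (indicator {-\<delta>..\<delta>} (0 + T * z) *\<^sub>R (?e (0 + T * z) * (Im (char M (0 + T * z)) / (0 + T * z)))))"
      by (rule Bochner_Integration.integral_mult_right_zero[symmetric])
    also have "(\<lambda>z. T * (indicator {-\<delta>..\<delta>} (0 + T * z) *\<^sub>R (?e (0 + T * z) * (Im (char M (0 + T * z)) / (0 + T * z))))) =
        (\<lambda>z. sqrt (2 * pi) * (std_normal_density z * (indicator ?A z * ?f z)))"
    proof
      fix z
      have "T * z \<in> {-\<delta>..\<delta>} \<longleftrightarrow> z \<in> ?A"
        using pos_divide_le_eq[OF T, of "- \<delta>" z] pos_le_divide_eq[OF T, of z \<delta>] by (simp add: mult.commute)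
      hence ind: "indicator {-\<delta>..\<delta>} (T * z) = (indicator ?A z :: real)" by (simp only: indicator_def)
      have e: "?e (0 + T * z) = exp (- z\<^sup>2 / 2)" using T by simp
      have "T * (i * (E * (I / (T * z)))) = c * (1 / c * E * (i * (I / z)))" if "c > 0" for i E I c :: real
        using T that by (cases "z = 0") simp_all
      from this[of "sqrt (2 * pi)" "indicator ?A z" "exp (- z\<^sup>2 / 2)" "Im (char M (T * z))"]
      show "T * (indicator {-\<delta>..\<delta>} (0 + T * z) *\<^sub>R (?e (0 + T * z) * (Im (char M (0 + T * z)) / (0 + T * z)))) =
        sqrt (2 * pi) * (std_normal_density z * (indicator ?A z * ?f z))"
        unfolding e std_normal_density_def real_scaleR_def add_0_left ind using T by simp
    qed
    also have "(LINT z|lborel. sqrt (2 * pi) * (std_normal_density z * (indicator ?A z * ?f z))) = sqrt (2 * pi) * (LINT z|\<N>. indicator ?A z * ?f z)"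
    proof -
      have "(LINT z|\<N>. indicator ?A z * ?f z) = (LINT z|lborel. std_normal_density z *\<^sub>R (indicator ?A z * ?f z))"
        by (rule integral_density) (use iAm[of ?A] in \<open>auto simp: normal_density_nonneg\<close>)
      thus ?thesis by (simp only: real_scaleR_def integral_mult_right_zero)
    qed
    finally have "(1 / pi) * (LINT t:{-\<delta>..\<delta>}|lborel. ?e t * (Im (char M t) / t)) = (sqrt (2 * pi) / pi) * (LINT z|\<N>. indicator ?A z * ?f z)"
      by simp
    also have "sqrt (2 * pi) / pi = sqrt (2 / pi)"
    proof -
      have "sqrt (2 / pi) = sqrt (2 * pi / pi\<^sup>2)" by (simp add: power2_eq_square)
      thus ?thesis by (simp add: real_sqrt_divide)
    qed
    finally show ?thesis ..
  qed
  have si: "set_integrable lborel {-\<delta>..\<delta>} (\<lambda>t. h t * (Im (char M t) / t))"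
    if h: "h \<in> borel_measurable borel" "\<And>t. \<bar>h t\<bar> \<le> 1" for h
    unfolding set_integrable_def
  proof (rule Bochner_Integration.integrable_bound[where f = "\<lambda>t. indicator {-\<delta>..\<delta>} t * K"])
    show "integrable lborel (\<lambda>t. indicator {-\<delta>..\<delta>} t * K)" using \<delta> by (intro integrable_mult_left integrable_real_indicator) auto
    show "(\<lambda>t. indicator {-\<delta>..\<delta>} t *\<^sub>R (h t * (Im (char M t) / t))) \<in> borel_measurable lborel"
      using h(1) by measurable
    have hK: "\<bar>h t * (Im (char M t) / t)\<bar> \<le> 1 * K" for t
      unfolding abs_mult[of "h t"] using h(2) ImK by (intro mult_mono) auto
    show "AE t in lborel. norm (indicator {-\<delta>..\<delta>} t *\<^sub>R (h t * (Im (char M t) / t))) \<le> norm (indicator {-\<delta>..\<delta>} t * K)"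
    proof (intro AE_I2)
      fix t show "norm (indicator {-\<delta>..\<delta>} t *\<^sub>R (h t * (Im (char M t) / t))) \<le> norm (indicator {-\<delta>..\<delta>} t * K)"
        using hK[of t] K0 by (cases "t \<in> {-\<delta>..\<delta>}") simp_all
    qed
  qed
  have 4: "\<bar>(LINT t:{-\<delta>..\<delta>}|lborel. ?e t * (Im (char M t) / t)) - (LINT t:{-\<delta>..\<delta>}|lborel. Im (char M t) / t)\<bar> \<le> 1 / T\<^sup>2"
  proof -
    have "(LINT t:{-\<delta>..\<delta>}|lborel. ?e t * (Im (char M t) / t)) - (LINT t:{-\<delta>..\<delta>}|lborel. Im (char M t) / t)
       = (LINT t:{-\<delta>..\<delta>}|lborel. ?e t * (Im (char M t) / t) - Im (char M t) / t)"
      using si[of ?e] si[of "\<lambda>_. 1"] by (subst set_integral_diff) auto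
    also have "norm \<dots> \<le> (LINT t:{-\<delta>..\<delta>}|lborel. 1 / (2 * T\<^sup>2))"
      unfolding set_lebesgue_integral_def
    proof (rule order_trans[OF integral_norm_bound], rule integral_mono)
      have "set_integrable lborel {-\<delta>..\<delta>} (\<lambda>t. ?e t * (Im (char M t) / t) - Im (char M t) / t)"
        using si[of ?e] si[of "\<lambda>_. 1"] by (intro set_integral_diff) auto
      thus "integrable lborel (\<lambda>t. norm (indicator {-\<delta>..\<delta>} t *\<^sub>R (?e t * (Im (char M t) / t) - Im (char M t) / t)))"
        unfolding set_integrable_def by (rule integrable_norm)
      show "integrable lborel (\<lambda>t. indicator {-\<delta>..\<delta>} t *\<^sub>R (1 / (2 * T\<^sup>2)))"
        using \<delta> by (intro integrable_scaleR_left integrable_real_indicator) auto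
      fix t
      show "norm (indicator {-\<delta>..\<delta>} t *\<^sub>R (?e t * (Im (char M t) / t) - Im (char M t) / t)) \<le> indicator {-\<delta>..\<delta>} t *\<^sub>R (1 / (2 * T\<^sup>2))"
      proof (cases "t \<in> {-\<delta>..\<delta>} \<and> t \<noteq> 0")
        case True
        have e: "1 - exp (- v) \<le> v" for v :: real using exp_ge_add_one_self[of "- v"] by linarith
        have e1: "?e t \<le> 1" by simp
        \<comment> \<open>The inequality 1 - exp(-v) <= v with v = (t/T)^2/2 supplies a factor t^2,
          which compensates the division by |t|.\<close>
        have "\<bar>?e t * (Im (char M t) / t) - Im (char M t) / t\<bar> = \<bar>(1 - ?e t) * (Im (char M t) / t)\<bar>"
          by (simp only: abs_minus_commute[of _ "Im (char M t) / t"] left_diff_distrib mult_1_left)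
        also have "\<dots> = (1 - ?e t) * (\<bar>Im (char M t)\<bar> / \<bar>t\<bar>)"
          using e1 by (simp only: abs_mult abs_divide abs_of_nonneg[of "1 - ?e t"] diff_ge_0_iff_ge)
        also have "\<dots> \<le> (t / T)\<^sup>2 / 2 * (1 / \<bar>t\<bar>)"
          using abs_Im_le_cmod[of "char M t"] cmod_char_le_1[of t] by (intro mult_mono divide_right_mono e) auto
        also have "\<dots> = \<bar>t\<bar> / (2 * T\<^sup>2)" proof -
          have "(t / T)\<^sup>2 = \<bar>t\<bar> * \<bar>t\<bar> / T\<^sup>2" by (simp add: power_divide power2_eq_square)
          moreover have "a * a / X / 2 * (1 / a) = a / (2 * X)" if "a \<noteq> 0" for a X :: real
            using that by simp
          ultimately show ?thesis using True by (simp only: abs_eq_0 simp_thms)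
        qed
        also have "\<dots> \<le> 1 / (2 * T\<^sup>2)" using True \<delta> T by (intro divide_right_mono) auto
        finally show ?thesis using True by simp
      next
        case False
        thus ?thesis by (cases "t = 0") simp_all
      qed
    qed
    also have "\<dots> = 2 * \<delta> / (2 * T\<^sup>2)" using \<delta> by (simp add: set_lebesgue_integral_def)
    also have "\<dots> \<le> 1 / T\<^sup>2" using \<delta> T by (simp add: divide_right_mono)
    finally show ?thesis by simp
  qed
  have contr: "\<bar>s * q\<bar> \<le> c" if "0 \<le> s" "s \<le> 1" "\<bar>q\<bar> \<le> c" for s q c :: real
  proof -
    have "\<bar>s * q\<bar> = s * \<bar>q\<bar>" using that by (simp add: abs_mult)
    also have "\<dots> \<le> 1 * c" using that by (intro mult_mono) auto
    finally show ?thesis by simp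
  qed
  have tri: "\<bar>a - f\<bar> \<le> A + B + C" if "\<bar>a - (e + q)\<bar> \<le> A" "\<bar>q\<bar> \<le> B" "\<bar>e - f\<bar> \<le> C" for a e f q A B C :: real
    using that by linarith
  have s: "0 \<le> sqrt (2 / pi)" "sqrt (2 / pi) \<le> 1" "0 \<le> 1 / pi" "1 / pi \<le> 1" using pi_gt3 by simp_all
  have A: "\<bar>(LINT x|M. sgn x) - sqrt (2 / pi) * (LINT z|\<N>. ?f z)\<bar> \<le> \<delta> / T + \<rho>"
    by (rule order_trans[OF sgn_smoothing[OF x T] char_gauss_bound[OF T \<delta>(1) \<rho>]])
  have B: "\<bar>sqrt (2 / pi) * (LINT z|\<N>. indicator (- ?A) z * ?f z)\<bar> \<le> T / \<delta> * \<rho>"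
    by (rule contr[OF s(1,2) 2])
  have C: "\<bar>(1 / pi) * (LINT t:{-\<delta>..\<delta>}|lborel. ?e t * (Im (char M t) / t)) - (1 / pi) * (LINT t:{-\<delta>..\<delta>}|lborel. Im (char M t) / t)\<bar> \<le> 1 / T\<^sup>2"
    unfolding right_diff_distrib[symmetric] by (rule contr[OF s(3,4) 4])
  show ?thesis
    by (rule tri[OF A[unfolded 1 distrib_left 3] B C])
qed

end

section \<open>Expansion of the sign expectation\<close>

text \<open>Taking the K-th root x of \<rho>, with K larger than k + |e|, reduces the claim to n x^n
  -> 0.\<close>

lemma pow_mult_power_bigo:
  assumes "0 \<le> \<rho>" "\<rho> < 1"
  shows "(\<lambda>n. real n ^ k * \<rho> ^ n) \<in> O(\<lambda>n. real n powr e)"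
proof -
  define K where "K = Suc (k + nat \<lceil>\<bar>e\<bar>\<rceil>)"
  define x where "x = root K \<rho>"
  have x: "0 \<le> x" "x < 1" using assms by (auto simp: x_def K_def)
  have xK: "x ^ K = \<rho>" unfolding x_def using assms by (intro real_root_pow_pos2) (auto simp: K_def)
  have "(\<lambda>n. real n * x ^ n) \<longlonglongrightarrow> 0" using x by (intro powser_times_n_limit_0) auto
  hence "(\<lambda>n. (real n * x ^ n) ^ K) \<longlonglongrightarrow> 0 ^ K" by (rule tendsto_power)
  hence "(\<lambda>n. real n ^ K * \<rho> ^ n) \<longlonglongrightarrow> 0"
  proof -
    have "(real n * x ^ n) ^ K = real n ^ K * \<rho> ^ n" for n
      by (simp only: power_mult_distrib xK[symmetric] power_mult[symmetric] mult.commute)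
    moreover have "(0::real) ^ K = 0" by (simp add: K_def)
    ultimately show ?thesis using \<open>(\<lambda>n. (real n * x ^ n) ^ K) \<longlonglongrightarrow> 0 ^ K\<close> by (simp only:)
  qed
  hence "(\<lambda>n. real n ^ K * \<rho> ^ n) \<in> O(\<lambda>_. 1)"
    by (intro bigoI_tendsto[where c = 0]) auto
  hence "(\<lambda>n. real n powr e * (real n ^ K * \<rho> ^ n)) \<in> O(\<lambda>n. real n powr e * 1)"
    by (intro landau_o.big.mult) auto
  moreover have "(\<lambda>n. real n ^ k * \<rho> ^ n) \<in> O(\<lambda>n. real n powr e * (real n ^ K * \<rho> ^ n))"
  proof (intro bigoI[where c = 1] eventually_mono[OF eventually_ge_at_top[of 1]])
    fix n :: nat assume n: "1 \<le> n"
    have "real k \<le> e + real K" unfolding K_def by linarith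
    hence "real n powr real k \<le> real n powr (e + real K)" using n by (intro powr_mono) auto
    hence "real n ^ k \<le> real n powr e * real n ^ K" using n by (simp add: powr_add powr_realpow)
    thus "norm (real n ^ k * \<rho> ^ n) \<le> 1 * norm (real n powr e * (real n ^ K * \<rho> ^ n))"
      using assms mult_right_mono[of "real n ^ k" "real n powr e * real n ^ K" "\<rho> ^ n"]
      by (simp add: abs_mult mult.assoc)
  qed
  ultimately show ?thesis using landau_o.big_trans by fastforce
qed

text \<open>The Taylor bound from \<open>N\<close> moments concerns the sum up to degree
  \<open>N\<close>, with error O(t^N). The term of degree \<open>N\<close> has that order too and
  moves into the error.\<close>

lemma (in real_distribution) imag_expansion_char:
  assumes "\<And>k. k \<le> N \<Longrightarrow> integrable M (\<lambda>x. x ^ k)"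
  shows "imag_expansion N (char M) (Abs_fps (\<lambda>k. expectation (\<lambda>x. x ^ k) / fact k))" (is "imag_expansion N _ ?F")
proof -
  let ?S = "\<lambda>t. (\<Sum>k\<le>N. (\<i> * complex_of_real t) ^ k / fact k * expectation (\<lambda>x. x ^ k))"
  have "(\<lambda>t. char M t - ?S t) \<in> O[at 0](\<lambda>t. of_real t ^ N)"
  proof (rule bigoI[where c = "2 / fact N * expectation (\<lambda>x. \<bar>x\<bar> ^ N)"], intro always_eventually allI)
    fix t :: real
    show "cmod (char M t - ?S t) \<le> 2 / fact N * expectation (\<lambda>x. \<bar>x\<bar> ^ N) * cmod (of_real t ^ N)"
      using char_approx1[OF assms, of N t] by (simp add: norm_power mult_ac)
  qed
  moreover have "(\<lambda>t. complex_of_real (?F $ N) * (\<i> * of_real t) ^ N) \<in> O[at 0](\<lambda>t. of_real t ^ N)"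
    by (rule ipow_bigo_at_0) simp
  ultimately have "(\<lambda>t. (char M t - ?S t) + complex_of_real (?F $ N) * (\<i> * of_real t) ^ N) \<in> O[at 0](\<lambda>t. of_real t ^ N)"
    by (rule sum_in_bigo)
  moreover have "(char M t - ?S t) + complex_of_real (?F $ N) * (\<i> * of_real t) ^ N =
      char M t - (\<Sum>m<N. complex_of_real (?F $ m) * (\<i> * of_real t) ^ m)" for t
    by (simp add: lessThan_Suc_atMost[symmetric] mult.commute)
  ultimately show ?thesis unfolding imag_expansion_def by (simp only:)
qed

section \<open>Bounds below one for characteristic functions away from the origin\<close>

lemma (in real_distribution) AE_iexp_eq_char:
  assumes "cmod (char M t) = 1"
  shows "AE x in M. iexp (t * x) = char M t"
proof -
  let ?c = "cnj (char M t)"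
  have int: "integrable M (\<lambda>x. ?c * iexp (t * x))"
    by (intro integrable_mult_right integrable_iexp) auto
  have "(LINT x|M. ?c * iexp (t * x)) = ?c * char M t"
    unfolding char_def by (rule integral_mult_right_zero)
  also have "\<dots> = 1" using assms by (simp add: complex_norm_square[symmetric] mult.commute)
  finally have "(LINT x|M. ?c * iexp (t * x)) = 1" .
  \<comment> \<open>The rotated exponential has real part at most 1 with mean 1, so the real part is
    1 almost surely; as the modulus is 1, this fixes the value.\<close>
  hence "(LINT x|M. Re (?c * iexp (t * x))) = 1" using integral_Re[OF int] by simp
  hence "(LINT x|M. 1 - Re (?c * iexp (t * x))) = 0"
    using integrable_Re[OF int] prob_space by (subst Bochner_Integration.integral_diff) auto
  moreover have nn: "0 \<le> 1 - Re (?c * iexp (t * x))" for x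
    using complex_Re_le_cmod[of "?c * iexp (t * x)"] assms by (simp add: norm_mult)
  ultimately have "AE x in M. 1 - Re (?c * iexp (t * x)) = 0"
    using integrable_Re[OF int] by (subst (asm) integral_nonneg_eq_0_iff_AE) auto
  thus ?thesis
  proof eventually_elim
    case (elim x)
    let ?z = "?c * iexp (t * x)"
    have one: "z = 1" if "cmod z = 1" "1 - Re z = 0" for z
      using cmod_power2[of z] that by (simp add: complex_eq_iff)
    have "cmod ?z = 1" using assms by (simp add: norm_mult)
    hence "?z = 1" using one elim by blast
    hence "char M t * ?z = char M t" by simp
    moreover have "char M t * ?c = 1" using assms by (simp add: complex_norm_square[symmetric])
    ultimately show ?case by (simp add: mult.assoc[symmetric])
  qed
qed

text \<open>Modulus 1 at \<open>t\<close> makes \<open>iexp (t * x)\<close> almost surely constant,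
  hence also its powers.\<close>

lemma (in real_distribution) char_multiple_unit:
  assumes "cmod (char M t) = 1"
  shows "cmod (char M (real k * t)) = 1"
proof -
  have "char M (real k * t) = (LINT x|M. char M t ^ k)"
    unfolding char_def[of M "real k * t"]
  proof (rule integral_cong_AE)
    show "AE x in M. iexp (real k * t * x) = char M t ^ k"
      using AE_iexp_eq_char[OF assms]
    proof eventually_elim
      case (elim x)
      thus ?case by (simp flip: elim add: exp_of_nat_mult[symmetric] mult_ac)
    qed
  qed auto
  also have "\<dots> = char M t ^ k" using prob_space by simp
  finally show ?thesis using assms by (simp add: norm_power)
qed

lemma char_bound_compact:
  assumes "real_distribution M" "0 < \<delta>" and lt: "\<And>t. \<delta> \<le> \<bar>t\<bar> \<Longrightarrow> \<bar>t\<bar> \<le> A \<Longrightarrow> cmod (char M t) < 1"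
  shows "\<exists>\<rho>. 0 \<le> \<rho> \<and> \<rho> < 1 \<and> (\<forall>t. \<delta> \<le> \<bar>t\<bar> \<and> \<bar>t\<bar> \<le> A \<longrightarrow> cmod (char M t) \<le> \<rho>)"
proof -
  interpret real_distribution M by fact
  let ?K = "{-A..-\<delta>} \<union> {\<delta>..A}"
  have K: "t \<in> ?K \<longleftrightarrow> \<delta> \<le> \<bar>t\<bar> \<and> \<bar>t\<bar> \<le> A" for t using assms(2) by auto
  show ?thesis
  proof (cases "?K = {}")
    case True
    thus ?thesis using K by (intro exI[of _ 0]) auto
  next
    case False
    have "continuous_on ?K (\<lambda>t. cmod (char M t))"
      by (intro continuous_at_imp_continuous_on ballI continuous_norm isCont_char)
    from continuous_attains_sup[OF _ False this] obtain s where s: "s \<in> ?K" "\<forall>t\<in>?K. cmod (char M t) \<le> cmod (char M s)"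
      using compact_Un[OF compact_Icc compact_Icc] by blast
    show ?thesis
    proof (intro exI[of _ "cmod (char M s)"] conjI allI impI)
      show "cmod (char M s) < 1" using s(1) K[of s] lt[of s] by blast
      show "cmod (char M t) \<le> cmod (char M s)" if "\<delta> \<le> \<bar>t\<bar> \<and> \<bar>t\<bar> \<le> A" for t
        using s(2) K[of t] that by blast
    qed simp
  qed
qed

text \<open>The limsup gives the bound near infinity and leaves a compact range. A point of modulus
  1 there would, by \<open>char_multiple_unit\<close>, produce such points arbitrarily far
  out.\<close>

lemma char_bound_limsup:
  assumes "real_distribution M" "Limsup at_infinity (\<lambda>t. ereal (cmod (char M t))) < 1" "0 < \<delta>"
  shows "\<exists>\<rho>. 0 \<le> \<rho> \<and> \<rho> < 1 \<and> (\<forall>t. \<delta> \<le> \<bar>t\<bar> \<longrightarrow> cmod (char M t) \<le> \<rho>)"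
proof -
  interpret real_distribution M by fact
  obtain c where c: "Limsup at_infinity (\<lambda>t. ereal (cmod (char M t))) < ereal c" "ereal c < 1"
    using ereal_dense2[OF assms(2)] by blast
  have "eventually (\<lambda>t. ereal (cmod (char M t)) < ereal c) at_infinity"
    using c(1) by (rule Limsup_lessD)
  then obtain A where A: "\<And>t. A \<le> \<bar>t\<bar> \<Longrightarrow> cmod (char M t) < c"
    unfolding eventually_at_infinity by auto
  have c1: "c < 1" using c(2) by simp
  have lt: "cmod (char M t) < 1" if "\<delta> \<le> \<bar>t\<bar>" for t
  proof (rule ccontr)
    assume "\<not> cmod (char M t) < 1"
    hence one: "cmod (char M t) = 1" using cmod_char_le_1[of t] by simp
    have "\<bar>t\<bar> > 0" using that assms(3) by linarith
    then obtain k :: nat where "A < real k * \<bar>t\<bar>" using reals_Archimedean3 by blast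
    hence "A \<le> \<bar>real k * t\<bar>" by (simp add: abs_mult)
    from A[OF this] char_multiple_unit[OF one, of k] c1 show False by simp
  qed
  from char_bound_compact[OF assms(1,3), of A] lt obtain \<rho> where
    \<rho>: "0 \<le> \<rho>" "\<rho> < 1" "\<And>t. \<delta> \<le> \<bar>t\<bar> \<Longrightarrow> \<bar>t\<bar> \<le> A \<Longrightarrow> cmod (char M t) \<le> \<rho>" by blast
  show ?thesis
  proof (intro exI[of _ "max \<rho> c"] conjI allI impI)
    fix t assume "\<delta> \<le> \<bar>t\<bar>"
    thus "cmod (char M t) \<le> max \<rho> c" using A[of t] \<rho>(3)[of t] by (cases "\<bar>t\<bar> \<le> A") auto
  qed (use \<rho> c1 in auto)
qed

text \<open>The least positive element divides all the others and is not 1. The trivial subgroup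
  lies in the multiples of 2.\<close>

lemma int_subgroup_proper:
  fixes D :: "int set"
  assumes "0 \<in> D" "\<And>x y. x \<in> D \<Longrightarrow> y \<in> D \<Longrightarrow> x - y \<in> D" "1 \<notin> D"
  shows "\<exists>h\<ge>2. \<forall>x\<in>D. h dvd x"
proof (cases "D = {0}")
  case True thus ?thesis by (intro exI[of _ 2]) auto
next
  case False
  have neg: "- x \<in> D" if "x \<in> D" for x using assms(2)[OF assms(1) that] by simp
  have add: "x + y \<in> D" if "x \<in> D" "y \<in> D" for x y using assms(2)[OF that(1) neg[OF that(2)]] by simp
  have mult: "int k * x \<in> D" if "x \<in> D" for x k
    by (induction k) (use assms(1) add that in \<open>auto simp: distrib_right\<close>)
  have multi: "k * x \<in> D" if "x \<in> D" for x k
    using mult[OF that, of "nat \<bar>k\<bar>"] neg by (cases "k \<ge> 0") fastforce+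
  obtain x where "x \<in> D" "x \<noteq> 0" using False assms(1) by blast
  hence "\<exists>m::nat. m > 0 \<and> int m \<in> D" using neg by (intro exI[of _ "nat \<bar>x\<bar>"]) (auto simp: abs_if)
  define d where "d = (LEAST m::nat. m > 0 \<and> int m \<in> D)"
  have d: "d > 0" "int d \<in> D" using LeastI_ex[OF \<open>\<exists>m::nat. m > 0 \<and> int m \<in> D\<close>] by (auto simp: d_def)
  have dl: "\<not> (m > 0 \<and> int m \<in> D)" if "m < d" for m using not_less_Least that unfolding d_def by blast
  have "d \<noteq> 1" using d assms(3) by auto
  moreover have "int d dvd y" if "y \<in> D" for y
  proof -
    have "y mod int d = y - (y div int d) * int d" by (simp add: minus_div_mult_eq_mod)
    hence "y mod int d \<in> D" using assms(2)[OF that multi[OF d(2)]] by simp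
    moreover have "0 \<le> y mod int d" "y mod int d < int d" using d by auto
    ultimately have "y mod int d = 0" using dl[of "nat (y mod int d)"] by auto
    thus ?thesis by auto
  qed
  ultimately show ?thesis using d by (intro exI[of _ "int d"]) auto
qed

text \<open>If the modulus is 1 at t, the values of the variable almost surely differ from some
  integer a by elements of D, the group of integers m with exp(i t m) = 1. As 0 < |t| <= pi rules
  out exp(i t) = 1, D lies in the multiples of some h >= 2, against the maximal span.\<close>

lemma char_bound_lattice:
  assumes "real_distribution M" "lattice_max_span_1 M" "0 < \<delta>"
  shows "\<exists>\<rho>. 0 \<le> \<rho> \<and> \<rho> < 1 \<and> (\<forall>t. \<delta> \<le> \<bar>t\<bar> \<and> \<bar>t\<bar> \<le> pi \<longrightarrow> cmod (char M t) \<le> \<rho>)"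
proof (rule char_bound_compact[OF assms(1,3)])
  interpret real_distribution M by fact
  fix t assume t: "\<delta> \<le> \<bar>t\<bar>" "\<bar>t\<bar> \<le> pi"
  show "cmod (char M t) < 1"
  proof (rule ccontr)
    assume "\<not> cmod (char M t) < 1"
    hence one: "cmod (char M t) = 1" using cmod_char_le_1[of t] by simp
    have "prob \<int> = 1" using assms(2) by (simp add: lattice_max_span_1_def)
    hence "AE x in M. x \<in> \<int>" using prob_eq_1[of "\<int>"] by simp
    with AE_iexp_eq_char[OF one] have ae: "AE x in M. x \<in> \<int> \<and> iexp (t * x) = char M t"
      by eventually_elim simp
    have "\<exists>x. x \<in> \<int> \<and> iexp (t * x) = char M t"
    proof (rule ccontr)
      assume "\<nexists>x. x \<in> \<int> \<and> iexp (t * x) = char M t"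
      with ae have "AE x in M. False" by (elim eventually_mono) blast
      thus False by simp
    qed
    then obtain a :: int where a: "iexp (t * of_int a) = char M t" by (auto elim: Ints_cases)
    define D where "D = {m::int. iexp (t * of_int m) = 1}"
    have "\<exists>h\<ge>2. \<forall>x\<in>D. h dvd x"
    proof (rule int_subgroup_proper)
      show "0 \<in> D" by (simp add: D_def)
      show "x - y \<in> D" if "x \<in> D" "y \<in> D" for x y
        using that by (simp add: D_def algebra_simps exp_diff)
      show "1 \<notin> D"
      proof
        assume "1 \<in> D"
        hence "exp (\<i> * complex_of_real t) = 1" by (simp add: D_def)
        hence "cos t = 1" by (metis cis_conv_exp cis.simps(1) one_complex.sel(1))
        then obtain n :: int where n: "t = of_int n * 2 * pi" by (auto simp: cos_one_2pi_int)
        have "n \<noteq> 0" using n t assms(3) by auto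
        hence "\<bar>real_of_int n\<bar> \<ge> 1" by linarith
        hence "\<bar>t\<bar> \<ge> 2 * pi" unfolding n by (simp add: abs_mult)
        thus False using t pi_gt_zero by linarith
      qed
    qed
    then obtain h where h: "h \<ge> 2" "\<And>x. x \<in> D \<Longrightarrow> h dvd x" by blast
    have "AE x in M. x \<in> range (\<lambda>k::int. real_of_int (a + h * k))"
      using ae
    proof eventually_elim
      case (elim x)
      then obtain m :: int where m: "x = of_int m" by (auto elim: Ints_cases)
      have "iexp (t * of_int (m - a)) = iexp (t * of_int m) / iexp (t * of_int a)"
        by (simp add: exp_diff algebra_simps)
      also have "\<dots> = 1"
      proof -
        have "char M t \<noteq> 0" using one by auto
        thus ?thesis using elim unfolding a m by simp
      qed
      finally have "m - a \<in> D" by (simp add: D_def)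
      then obtain k where "m - a = h * k" using h(2) by (auto elim: dvdE)
      hence "x = real_of_int (a + h * k)" using m by (simp add: algebra_simps flip: of_int_mult of_int_add)
      thus ?case by blast
    qed
    moreover have "range (\<lambda>k::int. real_of_int (a + h * k)) \<in> sets M"
      by (rule sets.countable) auto
    ultimately have "prob (range (\<lambda>k::int. real_of_int (a + h * k))) = 1"
      by (simp add: prob_eq_1)
    with h(1) assms(2) show False unfolding lattice_max_span_1_def by blast
  qed
qed

section \<open>Fourier inversion for integer-valued variables\<close>

lemma lattice_kernel_sum:
  assumes "sin (t / 2) \<noteq> 0"
  shows "sin (real m * t) * cot (t / 2) = (\<Sum>j<m. cos (real (Suc j) * t) + cos (real j * t))"
proof (induction m)
  case (Suc m)
  define a b where "a = (real m + 1 / 2) * t" and "b = t / 2"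
  have ab: "real (Suc m) * t = a + b" "real m * t = a - b" by (simp_all add: a_def b_def algebra_simps)
  \<comment> \<open>Both sides grow by 2 cos a cos b when \<open>m\<close> grows by one.\<close>
  have "sin (a + b) * cot b - sin (a - b) * cot b = 2 * cos a * sin b * cot b"
    by (simp add: sin_add sin_diff algebra_simps)
  also have "\<dots> = 2 * cos a * cos b" using assms by (simp add: b_def cot_def)
  also have "\<dots> = cos (a + b) + cos (a - b)" by (simp add: cos_add cos_diff)
  finally show ?case using Suc by (simp add: ab b_def del: of_nat_Suc)
qed simp

lemma lattice_kernel_bound: "\<bar>sin (real_of_int m * t) * cot (t / 2)\<bar> \<le> 2 * \<bar>real_of_int m\<bar>"
proof (cases "sin (t / 2) = 0")
  case True thus ?thesis by (simp add: cot_def)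
next
  case False
  have nat: "\<bar>sin (real m * t) * cot (t / 2)\<bar> \<le> 2 * real m" for m
  proof -
    have "\<bar>\<Sum>j<m. cos (real (Suc j) * t) + cos (real j * t)\<bar> \<le> (\<Sum>j<m. \<bar>cos (real (Suc j) * t) + cos (real j * t)\<bar>)"
      by (rule sum_abs)
    also have "\<dots> \<le> (\<Sum>j<m. 2)"
    proof (rule sum_mono)
      fix j show "\<bar>cos (real (Suc j) * t) + cos (real j * t)\<bar> \<le> 2"
        using abs_cos_le_one[of "real (Suc j) * t"] abs_cos_le_one[of "real j * t"] by linarith
    qed
    finally show ?thesis unfolding lattice_kernel_sum[OF False] by simp
  qed
  show ?thesis
  proof (cases "m \<ge> 0")
    case True thus ?thesis using nat[of "nat m"] by simp
  next
    case False
    have "sin (real_of_int m * t) * cot (t / 2) = - (sin (real (nat (- m)) * t) * cot (t / 2))"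
      using False by simp
    thus ?thesis using nat[of "nat (- m)"] False by simp
  qed
qed

lemma integral_cos_period: "(LINT t:{-pi..pi}|lborel. cos (real k * t)) = (if k = 0 then 2 * pi else 0)"
proof (cases "k = 0")
  case False
  have "(\<integral>t. cos (real k * t) * indicator {-pi..pi} t \<partial>lborel) = sin (real k * pi) / real k - sin (real k * (-pi)) / real k"
    using False by (intro integral_FTC_Icc_real) (auto intro!: derivative_eq_intros continuous_intros)
  thus ?thesis using False by (simp add: set_lebesgue_integral_def mult.commute)
qed (simp add: set_lebesgue_integral_def)

text \<open>In the cosine sum only cos 0 survives integration over a period, and it occurs exactly
  once when m >= 1; negative m follow by oddness.\<close>

lemma lattice_kernel_integral:
  "(LINT t:{-pi..pi}|lborel. sin (real_of_int m * t) * cot (t / 2)) = 2 * pi * sgn (real_of_int m)"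
proof -
  have ae: "AE t in lborel. t \<in> {-pi..pi} \<longrightarrow> sin (t / 2) \<noteq> 0"
  proof (rule AE_mp[OF AE_lborel_singleton[of 0]], intro AE_I2 impI)
    fix t :: real assume t: "t \<noteq> 0" "t \<in> {-pi..pi}"
    show "sin (t / 2) \<noteq> 0"
    proof (cases "t > 0")
      case True thus ?thesis using sin_gt_zero[of "t / 2"] t by auto
    next
      case False thus ?thesis using sin_gt_zero[of "- t / 2"] t by auto
    qed
  qed
  have nat: "(LINT t:{-pi..pi}|lborel. sin (real m * t) * cot (t / 2)) = 2 * pi * sgn (real m)" for m
  proof -
    have c: "set_integrable lborel {-pi..pi} (\<lambda>t. cos (real k * t))" for k
      by (intro borel_integrable_atLeastAtMost' continuous_intros)
    have "(LINT t:{-pi..pi}|lborel. sin (real m * t) * cot (t / 2)) =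
       (LINT t:{-pi..pi}|lborel. (\<Sum>j<m. cos (real (Suc j) * t) + cos (real j * t)))"
      unfolding set_lebesgue_integral_def
    proof (rule integral_cong_AE)
      show "AE t in lborel. indicator {-pi..pi} t *\<^sub>R (sin (real m * t) * cot (t / 2)) =
        indicator {-pi..pi} t *\<^sub>R (\<Sum>j<m. cos (real (Suc j) * t) + cos (real j * t))"
        using ae
      proof eventually_elim
        case (elim t)
        thus ?case using lattice_kernel_sum[of t m] by (cases "t \<in> {-pi..pi}") (simp_all del: of_nat_Suc)
      qed
    qed (unfold cot_def, measurable)
    also have "\<dots> = (\<Sum>j<m. LINT t:{-pi..pi}|lborel. cos (real (Suc j) * t) + cos (real j * t))"
      by (intro set_integrable_sum' set_integral_add c)
    also have "\<dots> = (\<Sum>j<m. (LINT t:{-pi..pi}|lborel. cos (real (Suc j) * t)) + (LINT t:{-pi..pi}|lborel. cos (real j * t)))"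
      by (intro sum.cong refl set_integral_add c)
    also have "\<dots> = (\<Sum>j<m. if j = 0 then 2 * pi else 0)"
      unfolding integral_cos_period by (intro sum.cong refl) auto
    also have "\<dots> = 2 * pi * sgn (real m)" by (cases m) (auto simp: sum.lessThan_Suc_shift)
    finally show ?thesis .
  qed
  show ?thesis
  proof (cases "m \<ge> 0")
    case True thus ?thesis using nat[of "nat m"] by simp
  next
    case False
    have p: "sin (real_of_int m * t) * cot (t / 2) = - (sin (real (nat (- m)) * t) * cot (t / 2))" for t
      using False by simp
    have "(LINT t:{-pi..pi}|lborel. sin (real_of_int m * t) * cot (t / 2)) = - (2 * pi * sgn (real (nat (- m))))"
      unfolding nat[symmetric] set_lebesgue_integral_def p scaleR_minus_right by (rule Bochner_Integration.integral_minus)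
    thus ?thesis using False by simp
  qed
qed

text \<open>Fubini with the kernels sin(m t) cot(t/2) and cos(m t), whose integrals over a period
  are 2 pi sgn m and 2 pi times the indicator of m = 0.\<close>

lemma (in real_distribution) lattice_inversion:
  assumes Z: "prob \<int> = 1" and x: "integrable M (\<lambda>x. x)"
  shows "set_integrable lborel {-pi..pi} (\<lambda>t. Im (char M t) * cot (t / 2))"
    and "(LINT x|M. sgn x) = 1 / (2 * pi) * (LINT t:{-pi..pi}|lborel. Im (char M t) * cot (t / 2))"
    and "set_integrable lborel {-pi..pi} (\<lambda>t. Re (char M t))"
    and "prob {0} = 1 / (2 * pi) * (LINT t:{-pi..pi}|lborel. Re (char M t))"
proof -
  let ?L = "restrict_space lborel {-pi..pi}"
  have L: "finite_measure ?L"
    by (rule finite_measureI) (simp add: emeasure_restrict_space space_restrict_space)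
  have intL: "integral\<^sup>L ?L f = (LINT y:{-pi..pi}|lborel. f y)" for f :: "real \<Rightarrow> real"
    by (simp add: integral_restrict_space set_lebesgue_integral_def)
  have intbL: "integrable ?L f \<longleftrightarrow> set_integrable lborel {-pi..pi} f" for f :: "real \<Rightarrow> real"
    by (simp add: integrable_restrict_space set_integrable_def)
  have pm: "(\<lambda>p. p) \<in> M \<Otimes>\<^sub>M ?L \<rightarrow>\<^sub>M (borel \<Otimes>\<^sub>M borel)"
    by (intro measurable_pair) (auto simp: comp_def intro!: measurable_compose[OF measurable_fst] measurable_compose[OF measurable_snd] measurable_restrict_space1)
  have aeZ: "AE x in M. x \<in> \<int>" using Z prob_eq_1[of "\<int>"] by simp
  have cong: "(LINT x|M. f x) = (LINT x|M. g x)"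
    if "f \<in> borel_measurable M" "g \<in> borel_measurable M" "\<And>m::int. f (of_int m) = g (of_int m)" for f g :: "real \<Rightarrow> real"
  proof (rule integral_cong_AE[OF that(1,2)])
    show "AE x in M. f x = g x" using aeZ by eventually_elim (auto elim!: Ints_cases simp: that(3))
  qed
  have h: "integrable M (\<lambda>x. 2 * \<bar>real_of_int \<lfloor>x\<rfloor>\<bar>)"
  proof (rule Bochner_Integration.integrable_bound[where f = "\<lambda>x. 2 * x"])
    show "AE x in M. norm (2 * \<bar>real_of_int \<lfloor>x\<rfloor>\<bar>) \<le> norm (2 * x)"
      using aeZ by eventually_elim (auto elim!: Ints_cases)
  qed (use x in auto)
  \<comment> \<open>The floor makes the argument an integer for every x, so that the domination by 2
    |m| holds pointwise; almost surely it equals x.\<close>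
  let ?f = "\<lambda>x t. sin (real_of_int \<lfloor>x\<rfloor> * t) * cot (t / 2)"
  have fm: "case_prod ?f \<in> borel_measurable (M \<Otimes>\<^sub>M ?L)"
    by (rule measurable_compose[OF pm]) (unfold cot_def, measurable)
  note fub = fubini_dominated[OF finite_measure_axioms L fm h lattice_kernel_bound]
  have Imc: "(LINT x|M. ?f x t) = Im (char M t) * cot (t / 2)" for t
  proof -
    have "(LINT x|M. ?f x t) = (LINT x|M. sin (t * x) * cot (t / 2))"
      by (rule cong) (measurable, measurable, simp add: mult.commute)
    thus ?thesis by (simp add: Im_char)
  qed
  show "set_integrable lborel {-pi..pi} (\<lambda>t. Im (char M t) * cot (t / 2))"
    using fub(3) unfolding Imc intbL .
  have "(LINT x|M. LINT t|?L. ?f x t) = (LINT x|M. 2 * pi * sgn x)"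
    unfolding intL lattice_kernel_integral by (rule cong) simp_all
  hence "2 * pi * (LINT x|M. sgn x) = (LINT t:{-pi..pi}|lborel. Im (char M t) * cot (t / 2))"
    using fub(1) unfolding Imc intL by simp
  thus "(LINT x|M. sgn x) = 1 / (2 * pi) * (LINT t:{-pi..pi}|lborel. Im (char M t) * cot (t / 2))"
    by (simp add: field_simps)
  let ?g = "\<lambda>x t. cos (real_of_int \<lfloor>x\<rfloor> * t)"
  have gm: "case_prod ?g \<in> borel_measurable (M \<Otimes>\<^sub>M ?L)"
    by (rule measurable_compose[OF pm]) measurable
  have one: "integrable M (\<lambda>x. 1 :: real)" by simp
  note fub = fubini_dominated[OF finite_measure_axioms L gm one abs_cos_le_one]
  have Rec: "(LINT x|M. ?g x t) = Re (char M t)" for t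
    unfolding Re_char
    by (rule cong) (measurable, measurable, simp add: mult.commute)
  show "set_integrable lborel {-pi..pi} (\<lambda>t. Re (char M t))"
    using fub(3) unfolding Rec intbL .
  have gi: "(LINT t:{-pi..pi}|lborel. cos (real_of_int m * t)) = 2 * pi * indicator {0} (real_of_int m)" for m
  proof -
    have "(LINT t:{-pi..pi}|lborel. cos (real_of_int m * t)) = (LINT t:{-pi..pi}|lborel. cos (real (nat \<bar>m\<bar>) * t))"
      by (cases "m \<ge> 0") auto
    thus ?thesis unfolding integral_cos_period by (auto simp: indicator_def)
  qed
  have "(LINT x|M. LINT t|?L. ?g x t) = (LINT x|M. 2 * pi * indicator {0} x)"
    unfolding intL gi
  proof (rule cong)
    have ind: "(\<lambda>x::real. indicator {0} x :: real) \<in> borel_measurable borel" by simp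
    show "(\<lambda>x. 2 * pi * indicator {0} x) \<in> borel_measurable M" by simp
    show "(\<lambda>x. 2 * pi * indicator {0} (real_of_int \<lfloor>x\<rfloor>)) \<in> borel_measurable M"
      by (intro borel_measurable_times borel_measurable_const measurable_compose[OF _ ind]) measurable
  qed simp
  hence "2 * pi * prob {0} = (LINT t:{-pi..pi}|lborel. Re (char M t))"
    using fub(1) unfolding Rec intL by simp
  thus "prob {0} = 1 / (2 * pi) * (LINT t:{-pi..pi}|lborel. Re (char M t))"
    by (simp add: field_simps)
qed

lemma central_integral_diff:
  fixes g :: "real \<Rightarrow> real"
  assumes g: "set_integrable lborel {-pi..pi} g" and \<delta>: "0 < \<delta>" "\<delta> \<le> 1" and B: "0 \<le> B"
    and bd: "\<And>t. \<delta> \<le> \<bar>t\<bar> \<Longrightarrow> \<bar>t\<bar> \<le> pi \<Longrightarrow> \<bar>g t\<bar> \<le> B"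
  shows "\<bar>(LINT t:{-pi..pi}|lborel. g t) - (LINT t:{-\<delta>..\<delta>}|lborel. g t)\<bar> \<le> 2 * pi * B"
proof -
  have \<delta>pi: "\<delta> \<le> pi" using \<delta> pi_gt3 by linarith
  let ?A = "{-pi..pi} - {-\<delta>..\<delta>}"
  have s1: "set_integrable lborel {-\<delta>..\<delta>} g" by (rule set_integrable_subset[OF g]) (use \<delta>pi in auto)
  have s2: "set_integrable lborel ?A g" by (rule set_integrable_subset[OF g]) auto
  have "{-pi..pi} = {-\<delta>..\<delta>} \<union> ?A" using \<delta>pi by auto
  hence "(LINT t:{-pi..pi}|lborel. g t) = (LINT t:{-\<delta>..\<delta>} \<union> ?A|lborel. g t)" by (rule arg_cong)
  also have "\<dots> = (LINT t:{-\<delta>..\<delta>}|lborel. g t) + (LINT t:?A|lborel. g t)"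
    by (rule set_integral_Un) (use s1 s2 in auto)
  finally have eq: "(LINT t:{-pi..pi}|lborel. g t) - (LINT t:{-\<delta>..\<delta>}|lborel. g t) = (LINT t:?A|lborel. g t)" by simp
  have "norm (LINT t:?A|lborel. g t) \<le> (LINT t|lborel. indicator {-pi..pi} t *\<^sub>R B)"
    unfolding set_lebesgue_integral_def
  proof (rule order_trans[OF integral_norm_bound], rule integral_mono)
    show "integrable lborel (\<lambda>t. norm (indicator ?A t *\<^sub>R g t))"
      using s2 unfolding set_integrable_def by (rule integrable_norm)
    show "integrable lborel (\<lambda>t. indicator {-pi..pi} t *\<^sub>R B)"
      by (intro integrable_scaleR_left integrable_real_indicator) auto
    fix t show "norm (indicator ?A t *\<^sub>R g t) \<le> indicator {-pi..pi} t *\<^sub>R B"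
      using bd[of t] B by (cases "t \<in> ?A") auto
  qed
  also have "\<dots> = 2 * pi * B" by simp
  finally show ?thesis unfolding eq by simp
qed

lemma imag_expansion_sinc: "imag_expansion N (\<lambda>t. of_real (sin (t / 2) / t)) (fps_shift 1 (fps_const (1 / 2) * (fps_exp (1 / 2) - fps_exp (- 1 / 2))))"
proof -
  have "imag_expansion (N + 1) (\<lambda>t. of_real (1 / 2) * (iexp (1 / 2 * t) + of_real (- 1) * iexp (- 1 / 2 * t)))
     (fps_const (1 / 2) * (fps_exp (1 / 2) + fps_const (- 1) * fps_exp (- 1 / 2)))"
    by (intro imag_expansion_cmult imag_expansion_add imag_expansion_iexp)
  moreover have "fps_const (1 / 2) * (fps_exp (1 / 2) + fps_const (- 1) * fps_exp (- 1 / 2)) = fps_const (1 / 2) * (fps_exp (1 / 2) - fps_exp (- 1 / 2 :: real))"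
    by (simp flip: fps_const_neg)
  ultimately have "imag_expansion N (\<lambda>t. of_real (1 / 2) * (iexp (1 / 2 * t) + of_real (- 1) * iexp (- 1 / 2 * t)) / (\<i> * of_real t) ^ 1)
      (fps_shift 1 (fps_const (1 / 2) * (fps_exp (1 / 2) - fps_exp (- 1 / 2))))"
    by (intro imag_expansion_shift) auto
  moreover have "of_real (1 / 2) * (iexp (1 / 2 * t) + of_real (- 1) * iexp (- 1 / 2 * t)) / (\<i> * of_real t) ^ 1 = of_real (sin (t / 2) / t)" for t
  proof -
    have "iexp (1 / 2 * t) = cis (t / 2)" "iexp (- 1 / 2 * t) = cis (- (t / 2))"
      by (simp_all add: cis_conv_exp)
    hence "of_real (1 / 2) * (iexp (1 / 2 * t) + of_real (- 1) * iexp (- 1 / 2 * t)) = \<i> * of_real (sin (t / 2))"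
      by (simp add: complex_eq_iff)
    thus ?thesis by simp
  qed
  ultimately show ?thesis by (simp only:)
qed

lemma imag_expansion_cos_half: "\<exists>G. imag_expansion N (\<lambda>t. of_real (cos (t / 2))) G"
proof -
  have "imag_expansion N (\<lambda>t. of_real (1 / 2) * (iexp (1 / 2 * t) + iexp (- 1 / 2 * t)))
     (fps_const (1 / 2) * (fps_exp (1 / 2) + fps_exp (- 1 / 2)))"
    by (intro imag_expansion_cmult imag_expansion_add imag_expansion_iexp)
  moreover have "of_real (1 / 2) * (iexp (1 / 2 * t) + iexp (- 1 / 2 * t)) = of_real (cos (t / 2))" for t
  proof -
    have "iexp (1 / 2 * t) = cis (t / 2)" "iexp (- 1 / 2 * t) = cis (- (t / 2))"
      by (simp_all add: cis_conv_exp)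
    thus ?thesis by (simp add: complex_eq_iff)
  qed
  ultimately show ?thesis by (metis (no_types, lifting) ext)
qed

text \<open>The weight that turns the division by i t into the lattice kernel, as t cot(t/2) / (i t)
  = cot(t/2) / i. It is cos(t/2) divided by sin(t/2)/t, whose constant coefficient 1/2 makes it
  invertible.\<close>

lemma imag_expansion_cot: "\<exists>G. imag_expansion (Suc N) (\<lambda>t. of_real (t * cot (t / 2))) G"
proof -
  let ?S = "fps_shift 1 (fps_const (1 / 2) * (fps_exp (1 / 2) - fps_exp (- 1 / 2))) :: real fps"
  have "?S $ 0 \<noteq> 0" by simp
  from imag_expansion_inverse[OF imag_expansion_sinc this] have i: "imag_expansion (Suc N) (\<lambda>t. inverse (of_real (sin (t / 2) / t))) (inverse ?S)" by simp
  obtain G where "imag_expansion (Suc N) (\<lambda>t. of_real (cos (t / 2))) G" using imag_expansion_cos_half by blast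
  from imag_expansion_mult[OF this i] have "imag_expansion (Suc N) (\<lambda>t. of_real (cos (t / 2)) * inverse (of_real (sin (t / 2) / t))) (G * inverse ?S)" .
  moreover have "of_real (cos (t / 2)) * inverse (complex_of_real (sin (t / 2) / t)) = of_real (t * cot (t / 2))" for t
    by (simp add: cot_def field_simps)
  ultimately show ?thesis by auto
qed

text \<open>The measure \<open>\<nu> n\<close> stands for the law of S_n; what is recorded of it is
  integrability and the characteristic function.\<close>

locale edgeworth_setting = real_distribution M for M +
  fixes r :: nat and \<nu> :: "nat \<Rightarrow> real measure"
  assumes moments: "integrable M (\<lambda>x. \<bar>x\<bar> ^ (r + 3))"
    and mean: "expectation (\<lambda>x. x) = 0" and var: "expectation (\<lambda>x. x\<^sup>2) > 0"
    and \<nu>: "\<And>n. real_distribution (\<nu> n)" "\<And>n. integrable (\<nu> n) (\<lambda>x. x)"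
    and char_\<nu>: "\<And>n t. char (\<nu> n) t = char M t ^ n"
begin

lemma moment_le: "k \<le> r + 3 \<Longrightarrow> integrable M (\<lambda>x. x ^ k)"
proof -
  assume k: "k \<le> r + 3"
  show ?thesis
  proof (rule Bochner_Integration.integrable_bound[where f = "\<lambda>x. 1 + \<bar>x\<bar> ^ (r + 3)"])
    show "integrable M (\<lambda>x. 1 + \<bar>x\<bar> ^ (r + 3))" using moments by simp
    show "AE x in M. norm (x ^ k) \<le> norm (1 + \<bar>x\<bar> ^ (r + 3))"
    proof (rule AE_I2)
      fix x :: real
      have "\<bar>x\<bar> ^ k \<le> 1 + \<bar>x\<bar> ^ (r + 3)"
      proof (cases "\<bar>x\<bar> \<le> 1")
        case True
        thus ?thesis using power_le_one[of "\<bar>x\<bar>" k] zero_le_power[of "\<bar>x\<bar>" "r + 3"] by linarith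
      next
        case False
        thus ?thesis using power_increasing[OF k, of "\<bar>x\<bar>"] by linarith
      qed
      thus "norm (x ^ k) \<le> norm (1 + \<bar>x\<bar> ^ (r + 3))" by (simp add: power_abs)
    qed
  qed simp
qed

lemma edgeworth_V:
  assumes "V \<in> borel_measurable borel" "imag_expansion (r + 1) V G"
  shows "\<exists>\<delta>>0. \<delta> \<le> 1 \<and> half_int_expansion r (\<lambda>n. LINT t:{-\<delta>..\<delta>}|lborel. Re (char M t ^ n * V t / (\<i> * of_real t))) \<and>
     (\<forall>n>0. set_integrable lborel {-\<delta>..\<delta>} (\<lambda>t. Re (char M t ^ n * V t / (\<i> * of_real t))))"
proof (rule edgeworth_integral[OF _ imag_expansion_char[of "r + 3"] _ _ _ assms])
  show "integrable M (\<lambda>x. x ^ k)" if "k \<le> r + 3" for k using moment_le that .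
qed (use prob_space mean var in \<open>auto\<close>)

theorem expansion_smooth:
  assumes \<rho>: "\<And>\<delta>. 0 < \<delta> \<Longrightarrow> \<exists>\<rho>. 0 \<le> \<rho> \<and> \<rho> < 1 \<and> (\<forall>t. \<delta> \<le> \<bar>t\<bar> \<longrightarrow> cmod (char M t) \<le> \<rho>)"
  shows "half_int_expansion r (\<lambda>n. LINT x|\<nu> n. sgn x)" "half_int_expansion r (\<lambda>n. measure (\<nu> n) {0})"
proof -
  have "imag_expansion (r + 1) (\<lambda>_. of_real 1) (fps_const 1)" by (rule imag_expansion_const)
  from edgeworth_V[OF _ this] obtain \<delta> where \<delta>: "0 < \<delta>" "\<delta> \<le> 1"
    "half_int_expansion r (\<lambda>n. LINT t:{-\<delta>..\<delta>}|lborel. Re (char M t ^ n * of_real 1 / (\<i> * of_real t)))"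
    by auto
  obtain \<rho> where \<rho>: "0 \<le> \<rho>" "\<rho> < 1" "\<And>t. \<delta> \<le> \<bar>t\<bar> \<Longrightarrow> cmod (char M t) \<le> \<rho>" using assms \<delta> by blast
  \<comment> \<open>The scale makes 1/T smaller than n^(-(r + 1)/2) and stays polynomial, so that T
    \<rho>^n is still negligible.\<close>
  define T where "T n = real n ^ (r + 1)" for n
  have T: "T n > 0" if "n > 0" for n using that by (simp add: T_def)
  have \<rho>n: "cmod (char (\<nu> n) t) \<le> \<rho> ^ n" if "\<delta> \<le> \<bar>t\<bar>" for n t
    unfolding char_\<nu> norm_power using \<rho>(3)[OF that] by (intro power_mono) auto
  let ?e = "-((real r + 1) / 2)"
  have o1: "(\<lambda>n. \<rho> ^ n) \<in> O(\<lambda>n. real n powr ?e)" using pow_mult_power_bigo[OF \<rho>(1,2), of 0] by simp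
  have o2: "(\<lambda>n. T n / \<delta> * \<rho> ^ n) \<in> O(\<lambda>n. real n powr ?e)"
    using pow_mult_power_bigo[OF \<rho>(1,2), of "r + 1" ?e] \<delta> by (simp add: T_def)
  have o3: "(\<lambda>n. \<delta> / T n) \<in> O(\<lambda>n. real n powr ?e)"
  proof -
    have "(\<lambda>n. real n powr (- real (r + 1))) \<in> O(\<lambda>n. real n powr ?e)" by (rule powr_bigo_nat) (simp add: field_simps)
    moreover have "(\<lambda>n. \<delta> / T n) \<in> O(\<lambda>n. real n powr (- real (r + 1)))"
    proof (intro bigoI[where c = \<delta>] eventually_mono[OF eventually_gt_at_top[of 0]])
      fix n :: nat assume n: "n > 0"
      have "\<delta> / T n = \<delta> * real n powr (- real (r + 1))"
        using n by (simp only: T_def powr_minus powr_realpow of_nat_0_less_iff divide_inverse)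
      thus "norm (\<delta> / T n) \<le> \<delta> * norm (real n powr (- real (r + 1)))"
        using \<delta>(1) by (simp only:) (simp add: abs_mult)
    qed
    ultimately show ?thesis using landau_o.big_trans by blast
  qed
  have o4: "(\<lambda>n. 1 / (T n)\<^sup>2) \<in> O(\<lambda>n. real n powr ?e)"
  proof -
    have "(\<lambda>n. real n powr (- real (2 * (r + 1)))) \<in> O(\<lambda>n. real n powr ?e)" by (rule powr_bigo_nat) (simp add: field_simps)
    moreover have "(\<lambda>n. 1 / (T n)\<^sup>2) \<in> O(\<lambda>n. real n powr (- real (2 * (r + 1))))"
    proof (intro bigoI[where c = 1] eventually_mono[OF eventually_gt_at_top[of 0]])
      fix n :: nat assume n: "n > 0"
      have "(T n)\<^sup>2 = real n ^ (2 * (r + 1))" by (simp add: T_def power_mult[symmetric] mult.commute del: power_Suc)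
      also have "\<dots> = real n powr real (2 * (r + 1))" using n by (simp only: powr_realpow of_nat_0_less_iff)
      finally show "norm (1 / (T n)\<^sup>2) \<le> 1 * norm (real n powr (- real (2 * (r + 1))))"
        by (simp only: powr_minus) (simp add: divide_inverse)
    qed
    ultimately show ?thesis using landau_o.big_trans by blast
  qed
  \<comment> \<open>The weight is V = 1, and Re (z / (i t)) = Im z / t; at t = 0 both sides are 0 by
    the convention for division by zero.\<close>
  have ReIm: "Re (char M t ^ n * of_real 1 / (\<i> * of_real t)) = Im (char (\<nu> n) t) / t" for n t
    by (cases "t = 0") (simp_all add: char_\<nu> Re_divide power2_eq_square)
  have "half_int_expansion r (\<lambda>n. (1 / pi) * (LINT t:{-\<delta>..\<delta>}|lborel. Im (char (\<nu> n) t) / t))"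
    using \<delta>(3) unfolding ReIm by (rule half_int_expansion_cmult)
  thus "half_int_expansion r (\<lambda>n. LINT x|\<nu> n. sgn x)"
  proof (rule half_int_expansion_diff_bigo)
    let ?B = "\<lambda>n. \<delta> / T n + \<rho> ^ n + T n / \<delta> * \<rho> ^ n + 1 / (T n)\<^sup>2"
    have "?B \<in> O(\<lambda>n. real n powr ?e)" by (intro sum_in_bigo o1 o2 o3 o4)
    moreover have "(\<lambda>n. (LINT x|\<nu> n. sgn x) - (1 / pi) * (LINT t:{-\<delta>..\<delta>}|lborel. Im (char (\<nu> n) t) / t)) \<in> O(?B)"
    proof (intro bigoI[where c = 1] eventually_mono[OF eventually_gt_at_top[of 0]])
      fix n :: nat assume n: "n > 0"
      have "\<bar>(LINT x|\<nu> n. sgn x) - (1 / pi) * (LINT t:{-\<delta>..\<delta>}|lborel. Im (char (\<nu> n) t) / t)\<bar> \<le> ?B n"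
        by (rule real_distribution.sgn_fourier_bound[OF \<nu>(1) \<nu>(2) T[OF n] \<delta>(1,2) \<rho>n])
      also have "?B n \<le> 1 * norm (?B n)" by simp
      finally show "norm ((LINT x|\<nu> n. sgn x) - (1 / pi) * (LINT t:{-\<delta>..\<delta>}|lborel. Im (char (\<nu> n) t) / t)) \<le> 1 * norm (?B n)"
        by (simp only: real_norm_def)
    qed
    ultimately show "(\<lambda>n. (LINT x|\<nu> n. sgn x) - (1 / pi) * (LINT t:{-\<delta>..\<delta>}|lborel. Im (char (\<nu> n) t) / t)) \<in> O(\<lambda>n. real n powr ?e)"
      using landau_o.big_trans by blast
  qed
  show "half_int_expansion r (\<lambda>n. measure (\<nu> n) {0})"
  proof (rule half_int_expansion_bigo)
    have "(\<lambda>n. \<delta> / T n + \<rho> ^ n) \<in> O(\<lambda>n. real n powr ?e)" by (intro sum_in_bigo o1 o3)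
    moreover have "(\<lambda>n. measure (\<nu> n) {0}) \<in> O(\<lambda>n. \<delta> / T n + \<rho> ^ n)"
    proof (intro bigoI[where c = 1] eventually_mono[OF eventually_gt_at_top[of 0]])
      fix n :: nat assume n: "n > 0"
      have "measure (\<nu> n) {0} \<le> \<delta> / T n + \<rho> ^ n"
        by (rule order_trans[OF real_distribution.atom_smoothing[OF \<nu>(1)] real_distribution.char_gauss_bound[OF \<nu>(1) T[OF n] \<delta>(1) \<rho>n]])
      thus "norm (measure (\<nu> n) {0}) \<le> 1 * norm (\<delta> / T n + \<rho> ^ n)" by simp
    qed
    ultimately show "(\<lambda>n. measure (\<nu> n) {0}) \<in> O(\<lambda>n. real n powr ?e)" using landau_o.big_trans by blast
  qed
qed

theorem expansion_lattice:
  assumes \<rho>: "\<And>\<delta>. 0 < \<delta> \<Longrightarrow> \<exists>\<rho>. 0 \<le> \<rho> \<and> \<rho> < 1 \<and> (\<forall>t. \<delta> \<le> \<bar>t\<bar> \<and> \<bar>t\<bar> \<le> pi \<longrightarrow> cmod (char M t) \<le> \<rho>)"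
    and Z: "\<And>n. measure (\<nu> n) \<int> = 1"
  shows "half_int_expansion r (\<lambda>n. LINT x|\<nu> n. sgn x)" "half_int_expansion r (\<lambda>n. measure (\<nu> n) {0})"
proof -
  let ?e = "-((real r + 1) / 2)"
  \<comment> \<open>Outside the central interval the integrand is at most C \<rho>^n, so the
    integral over the full period may be replaced by the one over the central interval.\<close>
  have half: "half_int_expansion r (\<lambda>n. LINT t:{-pi..pi}|lborel. g n t)"
    if h: "half_int_expansion r (\<lambda>n. LINT t:{-\<delta>..\<delta>}|lborel. g n t)" and g: "\<And>n. set_integrable lborel {-pi..pi} (g n)"
      and \<delta>: "0 < \<delta>" "\<delta> \<le> 1" and bd: "\<And>n t. \<delta> \<le> \<bar>t\<bar> \<Longrightarrow> \<bar>t\<bar> \<le> pi \<Longrightarrow> \<bar>g n t\<bar> \<le> C * cmod (char M t) ^ n"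
      and C: "0 \<le> C" for g :: "nat \<Rightarrow> real \<Rightarrow> real" and \<delta> C
  proof -
    obtain \<rho> where \<rho>: "0 \<le> \<rho>" "\<rho> < 1" "\<And>t. \<delta> \<le> \<bar>t\<bar> \<Longrightarrow> \<bar>t\<bar> \<le> pi \<Longrightarrow> cmod (char M t) \<le> \<rho>" using assms(1)[OF \<delta>(1)] by blast
    have "(\<lambda>n. (LINT t:{-pi..pi}|lborel. g n t) - (LINT t:{-\<delta>..\<delta>}|lborel. g n t)) \<in> O(\<lambda>n. \<rho> ^ n)"
    proof (intro bigoI[where c = "2 * pi * C"] always_eventually allI)
      fix n
      have "\<bar>(LINT t:{-pi..pi}|lborel. g n t) - (LINT t:{-\<delta>..\<delta>}|lborel. g n t)\<bar> \<le> 2 * pi * (C * \<rho> ^ n)"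
      proof (rule central_integral_diff[OF g \<delta>])
        fix t assume t: "\<delta> \<le> \<bar>t\<bar>" "\<bar>t\<bar> \<le> pi"
        have "C * cmod (char M t) ^ n \<le> C * \<rho> ^ n" using \<rho>(3)[OF t] C by (intro mult_left_mono power_mono) auto
        with bd[OF t, of n] show "\<bar>g n t\<bar> \<le> C * \<rho> ^ n" by linarith
      qed (use C \<rho> in simp)
      thus "norm ((LINT t:{-pi..pi}|lborel. g n t) - (LINT t:{-\<delta>..\<delta>}|lborel. g n t)) \<le> 2 * pi * C * norm (\<rho> ^ n)"
        using \<rho>(1) by (simp add: mult.assoc)
    qed
    moreover have "(\<lambda>n. \<rho> ^ n) \<in> O(\<lambda>n. real n powr ?e)" using pow_mult_power_bigo[OF \<rho>(1,2), of 0] by simp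
    ultimately have "(\<lambda>n. (LINT t:{-pi..pi}|lborel. g n t) - (LINT t:{-\<delta>..\<delta>}|lborel. g n t)) \<in> O(\<lambda>n. real n powr ?e)"
      by (rule landau_o.big_trans)
    thus ?thesis by (rule half_int_expansion_diff_bigo[OF h])
  qed
  note inv = real_distribution.lattice_inversion[OF \<nu>(1) Z \<nu>(2)]
  show "half_int_expansion r (\<lambda>n. LINT x|\<nu> n. sgn x)"
    unfolding inv(2)
  proof (rule half_int_expansion_cmult)
    obtain G where G: "imag_expansion (Suc r) (\<lambda>t. of_real (t * cot (t / 2))) G" using imag_expansion_cot by blast
    have Vm: "(\<lambda>t. complex_of_real (t * cot (t / 2))) \<in> borel_measurable borel" unfolding cot_def by measurable
    from edgeworth_V[OF Vm] G obtain \<delta> where \<delta>: "0 < \<delta>" "\<delta> \<le> 1"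
      "half_int_expansion r (\<lambda>n. LINT t:{-\<delta>..\<delta>}|lborel. Re (char M t ^ n * of_real (t * cot (t / 2)) / (\<i> * of_real t)))"
      by auto
    have Re: "Re (char M t ^ n * of_real (t * cot (t / 2)) / (\<i> * of_real t)) = Im (char (\<nu> n) t) * cot (t / 2)" for n t
    proof (cases "t = 0")
      case False
      have "char M t ^ n * of_real (t * cot (t / 2)) / (\<i> * of_real t) = of_real (cot (t / 2)) * (- \<i> * char M t ^ n)"
        using False by (simp add: field_simps)
      thus ?thesis by (simp only: Re_real_mult char_\<nu>) simp
    qed (simp add: cot_def)
    have sd: "sin (\<delta> / 2) > 0" using \<delta> pi_gt3 by (intro sin_gt_zero) auto
    show "half_int_expansion r (\<lambda>n. LINT t:{-pi..pi}|lborel. Im (char (\<nu> n) t) * cot (t / 2))"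
    proof (rule half[of \<delta> _ "1 / sin (\<delta> / 2)", OF \<delta>(3)[unfolded Re] inv(1) \<delta>(1,2)])
      fix n t assume t: "\<delta> \<le> \<bar>t\<bar>" "\<bar>t\<bar> \<le> pi"
      have "sin (\<delta> / 2) \<le> sin (\<bar>t\<bar> / 2)" using t \<delta> by (intro sin_monotone_2pi_le) auto
      also have "\<dots> \<le> \<bar>sin (t / 2)\<bar>" by (cases "t \<ge> 0") auto
      finally have s: "sin (\<delta> / 2) \<le> \<bar>sin (t / 2)\<bar>" .
      have "\<bar>cot (t / 2)\<bar> = \<bar>cos (t / 2)\<bar> / \<bar>sin (t / 2)\<bar>" by (simp add: cot_def)
      also have "\<dots> \<le> 1 / sin (\<delta> / 2)" using s sd by (intro frac_le) auto
      finally have c: "\<bar>cot (t / 2)\<bar> \<le> 1 / sin (\<delta> / 2)" .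
      have "\<bar>Im (char (\<nu> n) t)\<bar> \<le> cmod (char M t) ^ n"
        using abs_Im_le_cmod[of "char (\<nu> n) t"] by (simp add: char_\<nu> norm_power)
      hence "\<bar>cot (t / 2)\<bar> * \<bar>Im (char (\<nu> n) t)\<bar> \<le> 1 / sin (\<delta> / 2) * cmod (char M t) ^ n"
        using c sd by (intro mult_mono) auto
      thus "\<bar>Im (char (\<nu> n) t) * cot (t / 2)\<bar> \<le> 1 / sin (\<delta> / 2) * cmod (char M t) ^ n"
        by (simp add: abs_mult mult.commute)
    qed (use sd in simp)
  qed
  show "half_int_expansion r (\<lambda>n. measure (\<nu> n) {0})"
    unfolding inv(4)
  proof (rule half_int_expansion_cmult)
    \<comment> \<open>The weight i t cancels the division by i t and leaves the real part of the
      characteristic function.\<close>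
    have V: "imag_expansion (r + 1) (\<lambda>t. \<i> * of_real t) fps_X"
    proof (rule imag_expansion_poly[where M = 2])
      show "\<i> * complex_of_real t = (\<Sum>m<2. complex_of_real (fps_X $ m) * (\<i> * complex_of_real t) ^ m)" for t
        by (simp add: numeral_2_eq_2)
    qed (auto simp: fps_X_def)
    have Vm: "(\<lambda>t. \<i> * complex_of_real t) \<in> borel_measurable borel" by measurable
    from edgeworth_V[OF Vm V] obtain \<delta> where \<delta>: "0 < \<delta>" "\<delta> \<le> 1"
      "half_int_expansion r (\<lambda>n. LINT t:{-\<delta>..\<delta>}|lborel. Re (char M t ^ n * (\<i> * of_real t) / (\<i> * of_real t)))"
      by auto
    have "(LINT t:{-\<delta>..\<delta>}|lborel. Re (char M t ^ n * (\<i> * of_real t) / (\<i> * of_real t))) = (LINT t:{-\<delta>..\<delta>}|lborel. Re (char (\<nu> n) t))" for n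
      unfolding set_lebesgue_integral_def
    proof (rule integral_cong_AE)
      show "AE t in lborel. indicator {-\<delta>..\<delta>} t *\<^sub>R Re (char M t ^ n * (\<i> * of_real t) / (\<i> * of_real t)) = indicator {-\<delta>..\<delta>} t *\<^sub>R Re (char (\<nu> n) t)"
        by (rule AE_mp[OF AE_lborel_singleton[of 0]]) (auto intro!: AE_I2 simp: char_\<nu>)
      have [measurable]: "char (\<nu> n) \<in> borel_measurable borel" by (rule real_distribution.char_measurable[OF \<nu>(1)])
      show "(\<lambda>t. indicator {-\<delta>..\<delta>} t *\<^sub>R Re (char (\<nu> n) t)) \<in> borel_measurable lborel" by measurable
    qed measurable
    with \<delta>(3) have h: "half_int_expansion r (\<lambda>n. LINT t:{-\<delta>..\<delta>}|lborel. Re (char (\<nu> n) t))" by (simp only:)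
    show "half_int_expansion r (\<lambda>n. LINT t:{-pi..pi}|lborel. Re (char (\<nu> n) t))"
    proof (rule half[of \<delta> _ 1, OF h inv(3) \<delta>(1,2)])
      fix n t
      show "\<bar>Re (char (\<nu> n) t)\<bar> \<le> 1 * cmod (char M t) ^ n"
        using abs_Re_le_cmod[of "char (\<nu> n) t"] by (simp add: char_\<nu> norm_power)
    qed simp
  qed
qed

end

section \<open>Power series with polynomially decaying coefficients\<close>

text \<open>The formal power series (1 - X)^\<gamma>; for \<gamma> = j - 3/2 its coefficients are
  \<open>acoeff j\<close>.\<close>

definition binom_series :: "real \<Rightarrow> real fps" where
  "binom_series \<gamma> = Abs_fps (\<lambda>n. (-1) ^ n * (\<gamma> gchoose n))"

lemma binom_series_acoeff: "binom_series (real j - 3 / 2) $ n = acoeff j n"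
  by (simp add: binom_series_def acoeff_def)

lemma binom_series_add: "binom_series (a + b) = binom_series a * binom_series b"
proof (rule fps_ext)
  fix n
  have "(binom_series a * binom_series b) $ n = (\<Sum>i=0..n. (-1) ^ n * ((a gchoose i) * (b gchoose (n - i))))"
    unfolding fps_mult_nth
  proof (rule sum.cong[OF refl])
    fix i assume "i \<in> {0..n}"
    hence "(-1::real) ^ n = (-1) ^ i * (-1) ^ (n - i)" by (simp flip: power_add)
    thus "binom_series a $ i * binom_series b $ (n - i) = (-1) ^ n * ((a gchoose i) * (b gchoose (n - i)))"
      by (simp add: binom_series_def)
  qed
  also have "\<dots> = (-1) ^ n * (fps_binomial a * fps_binomial b) $ n"
    by (simp add: fps_mult_nth sum_distrib_left)
  also have "\<dots> = binom_series (a + b) $ n" by (simp add: fps_binomial_add_mult[symmetric] binom_series_def)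
  finally show "binom_series (a + b) $ n = (binom_series a * binom_series b) $ n" ..
qed

lemma binom_series_0 [simp]: "binom_series 0 = 1"
  by (rule fps_ext) (simp add: binom_series_def gbinomial_0_left)

lemma binom_series_1: "binom_series 1 = 1 - fps_X"
proof (rule fps_ext)
  fix n :: nat
  have "(1::real) gchoose n = (if n \<le> 1 then 1 else 0)"
    using binomial_gbinomial[of 1 n, where ?'a = real] by (cases n) (auto simp: binomial_eq_0)
  thus "binom_series 1 $ n = (1 - fps_X) $ n" by (cases n) (auto simp: binom_series_def fps_X_def)
qed

lemma binom_series_nat: "binom_series (real k) = (1 - fps_X) ^ k"
  by (induction k) (simp_all add: binom_series_add binom_series_1)

lemma binom_series_deriv: "fps_deriv (binom_series a) * (1 - fps_X) = - (fps_const a * binom_series a)"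
proof (rule fps_ext)
  fix n
  have s: "(-1::real) ^ n * (real (Suc n) * (a gchoose Suc n)) = (-1) ^ n * ((a - real n) * (a gchoose n))"
    using gbinomial_mult_1[of a n] by (simp add: algebra_simps)
  have "(fps_deriv (binom_series a) * (1 - fps_X)) $ n = real (Suc n) * binom_series a $ Suc n - real n * binom_series a $ n"
    by (cases n) (simp_all add: right_diff_distrib mult.commute[of _ fps_X])
  also have "\<dots> = - ((-1) ^ n * (real (Suc n) * (a gchoose Suc n))) - real n * ((-1) ^ n * (a gchoose n))"
    by (simp add: binom_series_def mult_ac)
  also have "\<dots> = - (a * binom_series a $ n)" unfolding s by (simp add: binom_series_def algebra_simps)
  finally show "(fps_deriv (binom_series a) * (1 - fps_X)) $ n = (- (fps_const a * binom_series a)) $ n" by simp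
qed

text \<open>The geometric series is 1/(1 - X). For a = 1/2 the factor in front matches the constant
  1/2 in P(S_n > 0).\<close>

lemma binom_series_half_deriv: "fps_deriv (binom_series a) = - (fps_const a * Abs_fps (\<lambda>_. 1) * binom_series a)"
proof -
  have g: "(1 - fps_X) * Abs_fps (\<lambda>_. 1) = (1 :: real fps)"
  proof (rule fps_ext)
    fix n show "((1 - fps_X) * Abs_fps (\<lambda>_. 1)) $ n = (1 :: real fps) $ n"
      by (cases n) (simp_all add: left_diff_distrib)
  qed
  have "fps_deriv (binom_series a) = fps_deriv (binom_series a) * (1 - fps_X) * Abs_fps (\<lambda>_. 1)" by (simp add: mult.assoc g)
  also have "\<dots> = - (fps_const a * Abs_fps (\<lambda>_. 1) * binom_series a)" unfolding binom_series_deriv by (simp add: mult_ac)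
  finally show ?thesis .
qed

text \<open>The absorption identity for binomials. It compares neighbouring sequences at the same n,
  and so drives both the decay estimate and the removal of factors 1/n.\<close>

lemma acoeff_Suc: "acoeff (Suc j) n * (real n - real j + 1 / 2) = - (real j - 1 / 2) * acoeff j n"
proof -
  have "(real (Suc j) - 3 / 2 - of_nat n) * ((real (Suc j) - 3 / 2) gchoose n) = (real (Suc j) - 3 / 2) * (real (Suc j) - 3 / 2 - 1 gchoose n)"
    by (rule gbinomial_absorb_comp)
  moreover have "real (Suc j) - 3 / 2 - 1 = real j - 3 / 2" "real (Suc j) - 3 / 2 = real j - 1 / 2" by simp_all
  ultimately have e: "(real j - 1 / 2 - real n) * ((real j - 1 / 2) gchoose n) = (real j - 1 / 2) * ((real j - 3 / 2) gchoose n)"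
    by (simp only:)
  have "acoeff (Suc j) n = (-1) ^ n * ((real j - 1 / 2) gchoose n)" by (simp add: acoeff_def)
  hence "acoeff (Suc j) n * (real n - real j + 1 / 2) = - ((-1) ^ n * ((real j - 1 / 2 - real n) * ((real j - 1 / 2) gchoose n)))"
    by (simp add: algebra_simps)
  thus ?thesis unfolding e by (simp add: acoeff_def algebra_simps)
qed

lemma acoeff_1_Suc: "acoeff 1 (Suc n) * (real n + 1) = (real n + 1 / 2) * acoeff 1 n"
proof -
  have "real (Suc n) * ((- 1 / 2) gchoose Suc n) = (- 1 / 2 - real n) * ((- 1 / 2 :: real) gchoose n)"
    using gbinomial_mult_1[of "- 1 / 2 :: real" n] by (simp add: algebra_simps)
  hence "(-1) ^ n * (real (Suc n) * ((- 1 / 2) gchoose Suc n)) = (-1) ^ n * ((- 1 / 2 - real n) * ((- 1 / 2 :: real) gchoose n))"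
    by (rule arg_cong)
  thus ?thesis by (simp add: acoeff_def algebra_simps)
qed

lemma acoeff_1_pos: "acoeff 1 n > 0"
proof (induction n)
  case (Suc n)
  have "0 < acoeff 1 (Suc n) * (real n + 1)" unfolding acoeff_1_Suc using Suc by simp
  thus ?case by (simp add: zero_less_mult_iff)
qed (simp add: acoeff_def)

text \<open>By \<open>acoeff_1_Suc\<close> the product of (acoeff 1 n)^2 with n + 1 decreases and
  the product with n increases, which pins the order n^(-1/2) from both sides.\<close>

lemma acoeff_1_sq: "(acoeff 1 n)\<^sup>2 * (real n + 1) \<le> 1" "n \<ge> 1 \<Longrightarrow> (acoeff 1 n)\<^sup>2 * real n \<ge> 1 / 4"
proof -
  have r: "acoeff 1 (Suc n) = (real n + 1 / 2) / (real n + 1) * acoeff 1 n" for n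
    using acoeff_1_Suc[of n] by (simp add: field_simps)
  have sq: "(acoeff 1 (Suc n))\<^sup>2 = (real n + 1 / 2)\<^sup>2 / (real n + 1)\<^sup>2 * (acoeff 1 n)\<^sup>2" for n
    unfolding r by (simp add: power_mult_distrib power_divide)
  show "(acoeff 1 n)\<^sup>2 * (real n + 1) \<le> 1"
  proof (induction n)
    case (Suc n)
    have "(real n + 1 / 2)\<^sup>2 * (real (Suc n) + 1) \<le> (real n + 1)\<^sup>2 * (real n + 1)"
      by (simp add: power2_eq_square algebra_simps)
    hence k: "(real n + 1 / 2)\<^sup>2 / (real n + 1)\<^sup>2 * (real (Suc n) + 1) \<le> real n + 1"
      by (simp add: field_simps)
    have "(acoeff 1 (Suc n))\<^sup>2 * (real (Suc n) + 1) = ((real n + 1 / 2)\<^sup>2 / (real n + 1)\<^sup>2 * (real (Suc n) + 1)) * (acoeff 1 n)\<^sup>2"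
      unfolding sq by (simp only: mult_ac)
    also have "\<dots> \<le> (real n + 1) * (acoeff 1 n)\<^sup>2" using k by (intro mult_right_mono) auto
    finally show ?case using Suc by (simp add: mult.commute)
  qed (simp add: acoeff_def)
  show "(acoeff 1 n)\<^sup>2 * real n \<ge> 1 / 4" if "n \<ge> 1"
    using that
  proof (induction n rule: dec_induct)
    case base
    have "acoeff 1 1 = 1 / 2" by (simp add: acoeff_def gbinomial_1)
    hence "(acoeff 1 1)\<^sup>2 * real 1 = 1 / 4" by (simp only:) (simp add: power2_eq_square)
    thus ?case by (simp only:)
  next
    case (step n)
    have "(real n + 1)\<^sup>2 * real n \<le> (real n + 1 / 2)\<^sup>2 * real (Suc n)"
      by (simp add: power2_eq_square algebra_simps)
    hence k: "real n \<le> (real n + 1 / 2)\<^sup>2 / (real n + 1)\<^sup>2 * real (Suc n)"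
      by (simp add: field_simps)
    have "1 / 4 \<le> (acoeff 1 n)\<^sup>2 * real n" by (rule step)
    also have "\<dots> \<le> (acoeff 1 n)\<^sup>2 * ((real n + 1 / 2)\<^sup>2 / (real n + 1)\<^sup>2 * real (Suc n))"
      using k by (intro mult_left_mono) auto
    also have "\<dots> = (acoeff 1 (Suc n))\<^sup>2 * real (Suc n)" unfolding sq by (simp only: mult_ac)
    finally show ?case .
  qed
qed

section \<open>Weighted bounds for coefficients\<close>

definition wt :: "real \<Rightarrow> nat \<Rightarrow> real" where "wt \<beta> n = (real n + 1) powr (- \<beta>)"

lemma wt_pos [simp]: "wt \<beta> n > 0" and wt_nonneg [simp]: "wt \<beta> n \<ge> 0"
  by (simp_all add: wt_def add_nonneg_pos less_imp_le)

text \<open>A bound for all n, not an asymptotic one, because infinite sums of powers have to be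
  controlled. The shift by one in \<open>wt\<close> makes it meaningful at n = 0.\<close>

definition decays :: "real \<Rightarrow> real fps \<Rightarrow> bool" where
  "decays \<beta> F \<longleftrightarrow> (\<exists>C\<ge>0. \<forall>n. \<bar>F $ n\<bar> \<le> C * wt \<beta> n)"

lemma decaysI: "(\<And>n. \<bar>F $ n\<bar> \<le> C * wt \<beta> n) \<Longrightarrow> decays \<beta> F"
proof -
  assume a: "\<And>n. \<bar>F $ n\<bar> \<le> C * wt \<beta> n"
  have "0 \<le> C * wt \<beta> 0" using a[of 0] by (meson abs_ge_zero order_trans)
  hence "C \<ge> 0" by (simp add: wt_def)
  with a show ?thesis unfolding decays_def by blast
qed

lemma acoeff_bound:
  assumes "j \<ge> 1" shows "\<exists>C\<ge>0. \<forall>n. \<bar>acoeff j n\<bar> \<le> C * wt (real j - 1 / 2) n"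
  using assms
proof (induction j rule: dec_induct)
  case base
  show ?case
  proof (intro exI[of _ 1] conjI allI)
    fix n
    have "(acoeff 1 n)\<^sup>2 \<le> 1 / (real n + 1)" using acoeff_1_sq(1)[of n] by (simp add: field_simps)
    hence "acoeff 1 n \<le> sqrt (1 / (real n + 1))" by (rule real_le_rsqrt)
    also have "\<dots> = wt (1 / 2) n"
    proof -
      have "wt (1 / 2) n = inverse (sqrt (real n + 1))"
        unfolding wt_def powr_minus by (subst powr_half_sqrt) simp_all
      thus ?thesis by (simp only: real_sqrt_divide real_sqrt_one inverse_eq_divide)
    qed
    finally show "\<bar>acoeff 1 n\<bar> \<le> 1 * wt (real 1 - 1 / 2) n" using acoeff_1_pos[of n] by simp
  qed simp
next
  case (step j)
  then obtain C where C: "C \<ge> 0" "\<And>n. \<bar>acoeff j n\<bar> \<le> C * wt (real j - 1 / 2) n" by blast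
  show ?case
  proof (intro exI[of _ "real j * (2 * real j + 2) * C"] conjI allI)
    fix n
    let ?d = "\<bar>real n - real j + 1 / 2\<bar>"
    \<comment> \<open>The number n - j + 1/2 is half an odd integer, so its modulus never drops
      below 1/2.\<close>
    have d: "?d \<ge> 1 / 2"
    proof -
      have "2 * int n - 2 * int j + 1 \<noteq> 0" by presburger
      hence "\<bar>2 * int n - 2 * int j + 1\<bar> \<ge> 1" by linarith
      hence "\<bar>real_of_int (2 * int n - 2 * int j + 1)\<bar> \<ge> 1" by linarith
      moreover have "real_of_int (2 * int n - 2 * int j + 1) = 2 * (real n - real j + 1 / 2)" by simp
      ultimately have "1 \<le> \<bar>2 * (real n - real j + 1 / 2)\<bar>" by (simp only:)
      thus ?thesis unfolding abs_mult by simp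
    qed
    have "real n + 1 \<le> ?d + (real j + 1 / 2)" by linarith
    also have "\<dots> \<le> ?d + ?d * (2 * real j + 1)" using mult_right_mono[OF d, of "2 * real j + 1"] by (simp add: algebra_simps)
    finally have n1: "real n + 1 \<le> ?d * (2 * real j + 2)" by (simp add: algebra_simps)
    have "\<bar>acoeff (Suc j) n\<bar> * ?d = \<bar>real j - 1 / 2\<bar> * \<bar>acoeff j n\<bar>"
      using arg_cong[OF acoeff_Suc[of j n], of abs] by (simp only: abs_mult abs_minus_cancel)
    also have "\<dots> \<le> real j * (C * wt (real j - 1 / 2) n)"
      using step(1) C by (intro mult_mono) auto
    finally have *: "\<bar>acoeff (Suc j) n\<bar> * ?d \<le> real j * (C * wt (real j - 1 / 2) n)" .
    have "\<bar>acoeff (Suc j) n\<bar> * (real n + 1) \<le> \<bar>acoeff (Suc j) n\<bar> * (?d * (2 * real j + 2))"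
      using n1 by (intro mult_left_mono) auto
    also have "\<dots> \<le> real j * (C * wt (real j - 1 / 2) n) * (2 * real j + 2)"
      using mult_right_mono[OF *, of "2 * real j + 2"] by (simp add: mult.assoc)
    finally have "\<bar>acoeff (Suc j) n\<bar> \<le> real j * (2 * real j + 2) * C * (wt (real j - 1 / 2) n / (real n + 1))"
      by (simp add: field_simps)
    also have "wt (real j - 1 / 2) n / (real n + 1) = wt (real (Suc j) - 1 / 2) n"
    proof -
      have "- (real (Suc j) - 1 / 2) = - (real j - 1 / 2) - 1" by simp
      thus ?thesis by (simp only: wt_def powr_diff) simp
    qed
    finally show "\<bar>acoeff (Suc j) n\<bar> \<le> real j * (2 * real j + 2) * C * wt (real (Suc j) - 1 / 2) n" .
  qed (use C in simp)
qed

lemma decays_add: assumes "decays \<beta> F" "decays \<beta> G" shows "decays \<beta> (F + G)"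
proof -
  obtain C D where "\<And>n. \<bar>F $ n\<bar> \<le> C * wt \<beta> n" "\<And>n. \<bar>G $ n\<bar> \<le> D * wt \<beta> n" using assms unfolding decays_def by blast
  hence "\<bar>(F + G) $ n\<bar> \<le> (C + D) * wt \<beta> n" for n
    using abs_triangle_ineq[of "F $ n" "G $ n"] by (simp add: distrib_right) (meson add_mono order_trans)
  thus ?thesis by (rule decaysI)
qed

lemma decays_cmult: assumes "decays \<beta> F" shows "decays \<beta> (fps_const c * F)"
proof -
  obtain C where C: "\<And>n. \<bar>F $ n\<bar> \<le> C * wt \<beta> n" using assms unfolding decays_def by blast
  have "\<bar>(fps_const c * F) $ n\<bar> \<le> (\<bar>c\<bar> * C) * wt \<beta> n" for n
    using mult_left_mono[OF C, of "\<bar>c\<bar>" n] by (simp add: abs_mult mult.assoc)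
  thus ?thesis by (rule decaysI)
qed

lemma decays_sum: "finite A \<Longrightarrow> (\<And>i. i \<in> A \<Longrightarrow> decays \<beta> (F i)) \<Longrightarrow> decays \<beta> (\<Sum>i\<in>A. F i)"
  by (induction A rule: finite_induct) (auto intro: decays_add decaysI[where C = 0])

lemma wt_summable: "\<beta> > 1 \<Longrightarrow> summable (wt \<beta>)"
proof -
  assume "\<beta> > 1"
  hence "summable (\<lambda>n. real n powr (- \<beta>))" by (simp add: summable_real_powr_iff)
  hence "summable (\<lambda>n. real (Suc n) powr (- \<beta>))" by (subst summable_Suc_iff)
  thus ?thesis by (simp add: wt_def[abs_def] add.commute)
qed

lemma wt_half:
  assumes "i \<le> j" "0 \<le> \<beta>" shows "wt \<beta> j \<le> 2 powr \<beta> * wt \<beta> (i + j)"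
proof -
  have "wt \<beta> j \<le> ((real (i + j) + 1) / 2) powr (- \<beta>)"
    unfolding wt_def using assms by (intro powr_mono2') auto
  also have "\<dots> = 2 powr \<beta> * wt \<beta> (i + j)"
  proof -
    have "((real (i + j) + 1) / 2) powr (- \<beta>) = (real (i + j) + 1) powr (- \<beta>) / 2 powr (- \<beta>)"
      by (rule powr_divide)
    moreover have "inverse (2 powr (- \<beta>)) = 2 powr \<beta>" by (simp only: powr_minus inverse_inverse_eq)
    ultimately show ?thesis by (simp only: wt_def divide_inverse mult.commute)
  qed
  finally show ?thesis .
qed

text \<open>In each product one index is at least n/2 and contributes the weight at n, while the
  other factor is summable because \<beta> > 1. Series with this decay therefore form an
  algebra.\<close>

lemma wt_convolution:
  assumes "\<beta> > 1"
  shows "\<exists>B\<ge>1. \<forall>n. (\<Sum>i=0..n. wt \<beta> i * wt \<beta> (n - i)) \<le> B * wt \<beta> n"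
proof -
  define W where "W = suminf (wt \<beta>)"
  have W: "(\<Sum>i\<in>A. wt \<beta> i) \<le> W" if "finite A" for A
    unfolding W_def using wt_summable[OF assms] that by (intro sum_le_suminf) auto
  let ?c = "2 powr \<beta>"
  have pt: "wt \<beta> i * wt \<beta> j \<le> ?c * wt \<beta> (i + j) * (wt \<beta> i + wt \<beta> j)" for i j
  proof -
    show ?thesis
    proof (cases "i \<le> j")
      case True
      have "wt \<beta> i * wt \<beta> j \<le> wt \<beta> i * (?c * wt \<beta> (i + j))" using wt_half[OF True, of \<beta>] assms by (intro mult_left_mono) auto
      also have "\<dots> \<le> (wt \<beta> i + wt \<beta> j) * (?c * wt \<beta> (i + j))" by (intro mult_right_mono) auto
      finally show ?thesis by (simp add: mult.commute)
    next
      case False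
      hence "wt \<beta> i \<le> ?c * wt \<beta> (i + j)" using wt_half[of j i \<beta>] assms by (simp add: add.commute)
      hence "wt \<beta> i * wt \<beta> j \<le> (?c * wt \<beta> (i + j)) * wt \<beta> j" by (intro mult_right_mono) auto
      also have "\<dots> \<le> (?c * wt \<beta> (i + j)) * (wt \<beta> i + wt \<beta> j)" by (intro mult_left_mono) auto
      finally show ?thesis .
    qed
  qed
  have "(\<Sum>i=0..n. wt \<beta> i * wt \<beta> (n - i)) \<le> max 1 (?c * (2 * W)) * wt \<beta> n" for n
  proof -
    have "(\<Sum>i=0..n. wt \<beta> i * wt \<beta> (n - i)) \<le> (\<Sum>i=0..n. ?c * wt \<beta> n * (wt \<beta> i + wt \<beta> (n - i)))"
    proof (rule sum_mono)
      fix i assume "i \<in> {0..n}"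
      thus "wt \<beta> i * wt \<beta> (n - i) \<le> ?c * wt \<beta> n * (wt \<beta> i + wt \<beta> (n - i))" using pt[of i "n - i"] by simp
    qed
    also have "\<dots> = ?c * wt \<beta> n * ((\<Sum>i=0..n. wt \<beta> i) + (\<Sum>i=0..n. wt \<beta> (n - i)))"
      by (simp only: sum_distrib_left[symmetric] sum.distrib)
    also have "(\<Sum>i=0..n. wt \<beta> (n - i)) = (\<Sum>i=0..n. wt \<beta> i)"
      using sum.atLeastAtMost_rev[of "wt \<beta>" 0 n] by simp
    also have "?c * wt \<beta> n * ((\<Sum>i=0..n. wt \<beta> i) + (\<Sum>i=0..n. wt \<beta> i)) \<le> ?c * wt \<beta> n * (W + W)"
      by (intro mult_left_mono add_mono W) auto
    also have "\<dots> = (?c * (2 * W)) * wt \<beta> n" by simp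
    also have "\<dots> \<le> max 1 (?c * (2 * W)) * wt \<beta> n" by (intro mult_right_mono) auto
    finally show ?thesis .
  qed
  thus ?thesis by (intro exI[of _ "max 1 (?c * (2 * W))"]) auto
qed

text \<open>The constants are explicit so that iteration gives geometric growth D^k for the k-th
  power.\<close>

lemma decays_mult_bound:
  assumes "\<And>n. \<bar>F $ n\<bar> \<le> C * wt \<beta> n" "\<And>n. \<bar>G $ n\<bar> \<le> D * wt \<beta> n" "C \<ge> 0" "D \<ge> 0"
    and B: "\<And>n. (\<Sum>i=0..n. wt \<beta> i * wt \<beta> (n - i)) \<le> B * wt \<beta> n"
  shows "\<bar>(F * G) $ n\<bar> \<le> C * D * B * wt \<beta> n"
proof -
  have "\<bar>(F * G) $ n\<bar> \<le> (\<Sum>i=0..n. \<bar>F $ i * G $ (n - i)\<bar>)" unfolding fps_mult_nth by (rule sum_abs)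
  also have "\<dots> \<le> (\<Sum>i=0..n. (C * wt \<beta> i) * (D * wt \<beta> (n - i)))"
    unfolding abs_mult using assms by (intro sum_mono mult_mono) auto
  also have "\<dots> = C * D * (\<Sum>i=0..n. wt \<beta> i * wt \<beta> (n - i))" by (simp add: sum_distrib_left mult_ac)
  also have "\<dots> \<le> C * D * (B * wt \<beta> n)" using assms by (intro mult_left_mono B) auto
  finally show ?thesis by (simp add: mult.assoc)
qed

lemma decays_mult: assumes "\<beta> > 1" "decays \<beta> F" "decays \<beta> G" shows "decays \<beta> (F * G)"
proof -
  obtain B where "\<And>n. (\<Sum>i=0..n. wt \<beta> i * wt \<beta> (n - i)) \<le> B * wt \<beta> n" using wt_convolution[OF assms(1)] by blast
  moreover obtain C D where "C \<ge> 0" "D \<ge> 0" "\<And>n. \<bar>F $ n\<bar> \<le> C * wt \<beta> n" "\<And>n. \<bar>G $ n\<bar> \<le> D * wt \<beta> n" using assms unfolding decays_def by blast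
  ultimately show ?thesis by (intro decaysI[where C = "C * D * B"] decays_mult_bound)
qed

lemma decays_const: "decays \<beta> (fps_const c)"
  by (rule decaysI[where C = "\<bar>c\<bar>"]) (simp add: fps_const_def wt_def)

lemma decays_1_minus_X: "decays \<beta> (1 - fps_X)"
proof (rule decaysI[where C = "max 1 (2 powr \<beta>)"])
  fix n :: nat
  consider "n = 0" | "n = 1" | "n > 1" by linarith
  thus "\<bar>(1 - fps_X) $ n\<bar> \<le> max 1 (2 powr \<beta>) * wt \<beta> n"
  proof cases
    case 2
    have "1 = 2 powr \<beta> * 2 powr (- \<beta>)" by (simp flip: powr_add)
    also have "\<dots> \<le> max 1 (2 powr \<beta>) * 2 powr (- \<beta>)" by (intro mult_right_mono) auto
    finally show ?thesis using 2 by (simp add: wt_def)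
  qed (auto simp: wt_def fps_X_def)
qed

lemma decays_power: "\<beta> > 1 \<Longrightarrow> decays \<beta> F \<Longrightarrow> decays \<beta> (F ^ k)"
  by (induction k) (auto intro: decays_mult decays_const[of _ 1, simplified])

text \<open>Substitution of \<open>F\<close> into an entire series, with real convergence in each
  coefficient: \<open>F\<close> may have a nonzero constant term, so formal composition does not
  apply.\<close>

definition fps_subst_series :: "(nat \<Rightarrow> real) \<Rightarrow> real fps \<Rightarrow> real fps" where
  "fps_subst_series g F = Abs_fps (\<lambda>n. \<Sum>k. g k * (F ^ k) $ n)"

lemma decays_power_bound:
  assumes "\<beta> > 1" "decays \<beta> F"
  shows "\<exists>D\<ge>0. \<forall>k n. \<bar>(F ^ k) $ n\<bar> \<le> D ^ k * wt \<beta> n"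
proof -
  obtain B where B: "B \<ge> 1" "\<And>n. (\<Sum>i=0..n. wt \<beta> i * wt \<beta> (n - i)) \<le> B * wt \<beta> n" using wt_convolution[OF assms(1)] by blast
  obtain C where C: "C \<ge> 0" "\<And>n. \<bar>F $ n\<bar> \<le> C * wt \<beta> n" using assms unfolding decays_def by blast
  have "\<bar>(F ^ k) $ n\<bar> \<le> (C * B) ^ k * wt \<beta> n" for k n
  proof (induction k arbitrary: n)
    case 0 show ?case by (cases n) (simp_all add: wt_def)
  next
    case (Suc k)
    have "\<bar>(F * F ^ k) $ n\<bar> \<le> C * (C * B) ^ k * B * wt \<beta> n"
      using C B Suc by (intro decays_mult_bound) auto
    thus ?case by (simp add: mult_ac)
  qed
  thus ?thesis using B C by (intro exI[of _ "C * B"]) auto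
qed

context
  fixes \<beta> :: real and F :: "real fps" and g :: "nat \<Rightarrow> real"
  assumes \<beta>: "\<beta> > 1" and F: "decays \<beta> F" and g: "\<And>k. \<bar>g k\<bar> \<le> 1 / fact k"
begin

lemma fps_subst_series_term_bound: "\<exists>D\<ge>0. \<forall>k n. \<bar>g k * (F ^ k) $ n\<bar> \<le> D ^ k / fact k * wt \<beta> n"
proof -
  obtain D where D: "D \<ge> 0" "\<And>k n. \<bar>(F ^ k) $ n\<bar> \<le> D ^ k * wt \<beta> n" using decays_power_bound[OF \<beta> F] by blast
  have "\<bar>g k * (F ^ k) $ n\<bar> \<le> D ^ k / fact k * wt \<beta> n" for k n
  proof -
    have "\<bar>g k\<bar> * \<bar>(F ^ k) $ n\<bar> \<le> 1 / fact k * (D ^ k * wt \<beta> n)" using g D by (intro mult_mono) auto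
    thus ?thesis by (simp add: abs_mult)
  qed
  thus ?thesis using D by blast
qed

lemma fps_subst_series_summable: "summable (\<lambda>k. g k * (F ^ k) $ n)"
proof -
  obtain D where D: "D \<ge> 0" "\<And>k n. \<bar>g k * (F ^ k) $ n\<bar> \<le> D ^ k / fact k * wt \<beta> n" using fps_subst_series_term_bound by blast
  have "summable (\<lambda>k. D ^ k / fact k * wt \<beta> n)"
    using summable_exp[of D] by (intro summable_mult2) (simp add: divide_inverse mult.commute)
  thus ?thesis by (rule summable_comparison_test') (use D in simp)
qed

lemma fps_subst_series_decays: "decays \<beta> (fps_subst_series g F)"
proof -
  obtain D where D: "D \<ge> 0" "\<And>k n. \<bar>g k * (F ^ k) $ n\<bar> \<le> D ^ k / fact k * wt \<beta> n" using fps_subst_series_term_bound by blast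
  have s: "summable (\<lambda>k. D ^ k / fact k)" using summable_exp[of D] by (simp add: divide_inverse mult.commute)
  show ?thesis
  proof (rule decaysI[where C = "\<Sum>k. D ^ k / fact k"])
    fix n
    have sa: "summable (\<lambda>k. \<bar>g k * (F ^ k) $ n\<bar>)"
      by (rule summable_comparison_test'[OF summable_mult2[OF s, of "wt \<beta> n"]]) (use D in simp)
    have "\<bar>\<Sum>k. g k * (F ^ k) $ n\<bar> \<le> (\<Sum>k. \<bar>g k * (F ^ k) $ n\<bar>)" by (rule summable_rabs[OF sa])
    also have "\<dots> \<le> (\<Sum>k. D ^ k / fact k * wt \<beta> n)" using D by (intro suminf_le sa summable_mult2 s) auto
    also have "\<dots> = (\<Sum>k. D ^ k / fact k) * wt \<beta> n" by (rule suminf_mult2[symmetric, OF s])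
    finally show "\<bar>fps_subst_series g F $ n\<bar> \<le> (\<Sum>k. D ^ k / fact k) * wt \<beta> n" by (simp add: fps_subst_series_def)
  qed
qed

text \<open>Convolution with \<open>A\<close> involves finitely many coefficients for each n, so it
  commutes with the sum over k.\<close>

lemma fps_subst_series_mult_sums: "(\<lambda>k. g k * (A * F ^ k) $ n) sums ((A * fps_subst_series g F) $ n)"
proof -
  have "(\<lambda>k. \<Sum>i=0..n. A $ i * (g k * (F ^ k) $ (n - i))) sums (\<Sum>i=0..n. A $ i * (\<Sum>k. g k * (F ^ k) $ (n - i)))"
    by (rule sums_sum) (rule sums_mult[OF summable_sums[OF fps_subst_series_summable]])
  moreover have "(\<Sum>i=0..n. A $ i * (g k * (F ^ k) $ (n - i))) = g k * (A * F ^ k) $ n" for k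
    by (simp add: fps_mult_nth sum_distrib_left mult_ac)
  ultimately show ?thesis by (simp add: fps_mult_nth fps_subst_series_def)
qed

end

definition exp_fps :: "real fps \<Rightarrow> real fps" where "exp_fps F = fps_subst_series (\<lambda>k. 1 / fact k) F"

lemma inverse_fact_abs: "\<bar>1 / fact k :: real\<bar> \<le> 1 / fact k"
proof -
  have "(0::real) \<le> 1 / fact k" by (rule divide_nonneg_nonneg) simp_all
  thus ?thesis by (simp only: abs_of_nonneg order_refl)
qed

lemma exp_fps_deriv:
  assumes "\<beta> > 1" "decays \<beta> F"
  shows "fps_deriv (exp_fps F) = fps_deriv F * exp_fps F"
proof (rule fps_ext)
  fix n
  have g: "\<bar>1 / fact k :: real\<bar> \<le> 1 / fact k" for k :: nat by (rule inverse_fact_abs)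
  have "(\<lambda>k. 1 / fact k * (1 * F ^ k) $ Suc n) sums ((1 * exp_fps F) $ Suc n)"
    unfolding exp_fps_def by (rule fps_subst_series_mult_sums[OF assms g])
  hence "(\<lambda>k. real (Suc n) * (1 / fact k * (F ^ k) $ Suc n)) sums (real (Suc n) * exp_fps F $ Suc n)"
    by (intro sums_mult) simp
  hence "(\<lambda>k. 1 / fact k * fps_deriv (F ^ k) $ n) sums (fps_deriv (exp_fps F) $ n)"
    by (simp add: mult_ac)
  from this have "(\<lambda>k. 1 / fact (Suc k) * fps_deriv (F ^ Suc k) $ n) sums (fps_deriv (exp_fps F) $ n)"
  proof -
    assume a: "(\<lambda>k. 1 / fact k * fps_deriv (F ^ k) $ n) sums (fps_deriv (exp_fps F) $ n)"
    have "1 / fact 0 * fps_deriv (F ^ 0) $ n = 0" by simp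
    with a show ?thesis
      using sums_Suc_iff[of "\<lambda>k. 1 / fact k * fps_deriv (F ^ k) $ n" "fps_deriv (exp_fps F) $ n"] by (simp only: add_0_right)
  qed
  moreover have "1 / fact (Suc k) * fps_deriv (F ^ Suc k) $ n = 1 / fact k * (fps_deriv F * F ^ k) $ n" for k
    by (simp add: fps_deriv_power mult.assoc del: power_Suc of_nat_Suc)
  ultimately have "(\<lambda>k. 1 / fact k * (fps_deriv F * F ^ k) $ n) sums (fps_deriv (exp_fps F) $ n)" by simp
  moreover have "(\<lambda>k. 1 / fact k * (fps_deriv F * F ^ k) $ n) sums ((fps_deriv F * exp_fps F) $ n)"
    unfolding exp_fps_def by (rule fps_subst_series_mult_sums[OF assms g])
  ultimately show "fps_deriv (exp_fps F) $ n = (fps_deriv F * exp_fps F) $ n" by (rule sums_unique2)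
qed

text \<open>The constant coefficient is the real exponential of \<open>F $ 0\<close>. It normalises
  the solution in \<open>fps_linear_ODE_unique\<close> and must not vanish there.\<close>

lemma exp_fps_0: "exp_fps F $ 0 > 0"
proof -
  have "exp_fps F $ 0 = (\<Sum>k. (F $ 0) ^ k /\<^sub>R fact k)"
    by (simp add: exp_fps_def fps_subst_series_def fps_power_zeroth divide_inverse mult.commute)
  also have "\<dots> = exp (F $ 0)" by (simp add: exp_def)
  finally show ?thesis by simp
qed

text \<open>Two rates enter: \<open>F\<close> itself may decay slowly while its square decays fast,
  and both partial series are power series in the square.\<close>

lemma exp_fps_even_odd:
  assumes "\<beta> > 1" "decays \<beta> F" and \<gamma>: "\<gamma> > 1" "decays \<gamma> (F\<^sup>2)"
  shows "exp_fps F = fps_subst_series (\<lambda>k. 1 / fact (2 * k)) (F\<^sup>2) + F * fps_subst_series (\<lambda>k. 1 / fact (2 * k + 1)) (F\<^sup>2)"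
proof (rule fps_ext)
  fix n
  have "(\<lambda>k. 1 / fact k * (1 * F ^ k) $ n) sums ((1 * exp_fps F) $ n)"
    unfolding exp_fps_def by (rule fps_subst_series_mult_sums[OF assms(1,2)]) simp
  hence "(\<lambda>k. \<Sum>i\<in>{k*2..<k*2+2}. 1 / fact i * (F ^ i) $ n) sums (exp_fps F $ n)"
    by (intro sums_group) simp_all
  moreover have "(\<Sum>i\<in>{k*2..<k*2+2}. 1 / fact i * (F ^ i) $ n) = 1 / fact (2 * k) * (1 * (F\<^sup>2) ^ k) $ n + 1 / fact (2 * k + 1) * (F * (F\<^sup>2) ^ k) $ n" for k
  proof -
    have "{k*2..<k*2+2} = {2 * k, 2 * k + 1}" by auto
    moreover have "F ^ (2 * k) = (F\<^sup>2) ^ k" "F ^ (2 * k + 1) = F * (F\<^sup>2) ^ k" by (simp_all add: power_mult)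
    ultimately show ?thesis by simp
  qed
  moreover have "(\<lambda>k. 1 / fact (2 * k) * (1 * (F\<^sup>2) ^ k) $ n + 1 / fact (2 * k + 1) * (F * (F\<^sup>2) ^ k) $ n) sums
      ((1 * fps_subst_series (\<lambda>k. 1 / fact (2 * k)) (F\<^sup>2)) $ n + (F * fps_subst_series (\<lambda>k. 1 / fact (2 * k + 1)) (F\<^sup>2)) $ n)"
  proof (intro sums_add fps_subst_series_mult_sums[OF \<gamma>])
    show "\<bar>1 / fact (2 * k) :: real\<bar> \<le> 1 / fact k" "\<bar>1 / fact (2 * k + 1) :: real\<bar> \<le> 1 / fact k" for k
      by (simp_all add: frac_le fact_mono del: fact_Suc)
  qed
  ultimately show "exp_fps F $ n = (fps_subst_series (\<lambda>k. 1 / fact (2 * k)) (F\<^sup>2) + F * fps_subst_series (\<lambda>k. 1 / fact (2 * k + 1)) (F\<^sup>2)) $ n"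
    by (simp add: sums_unique2)
qed

lemma fps_linear_ODE_zero:
  fixes q H :: "real fps"
  assumes "fps_deriv q = H * q" "q $ 0 = 0" shows "q = 0"
proof (rule fps_ext)
  fix n show "q $ n = 0 $ n"
  proof (induction n rule: less_induct)
    case (less n)
    show ?case
    proof (cases n)
      case (Suc m)
      have "real (Suc m) * q $ Suc m = (\<Sum>i=0..m. H $ i * q $ (m - i))"
        using arg_cong[OF assms(1), of "\<lambda>F. F $ m"] by (simp add: fps_mult_nth)
      also have "\<dots> = 0" using less Suc by (intro sum.neutral) auto
      finally show ?thesis using Suc by simp
    qed (use assms in simp)
  qed
qed

lemma fps_linear_ODE_unique:
  fixes p q H :: "real fps"
  assumes "fps_deriv p = H * p" "fps_deriv q = H * q" "q $ 0 \<noteq> 0"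
  shows "p = fps_const (p $ 0 / q $ 0) * q"
proof -
  have "p - fps_const (p $ 0 / q $ 0) * q = 0"
    by (rule fps_linear_ODE_zero[of _ H]) (use assms in \<open>simp_all add: algebra_simps\<close>)
  thus ?thesis by simp
qed

section \<open>Multiplication by an inverse square root\<close>

text \<open>Multiplication by 1 - X takes backward differences and raises the exponent of the
  binomial series by one.\<close>

lemma acoeff_diff: "acoeff (Suc j) (Suc n) = acoeff j (Suc n) - acoeff j n"
proof -
  have "real (Suc j) - 3 / 2 = (real j - 3 / 2) + 1" by simp
  hence e: "binom_series (real (Suc j) - 3 / 2) = binom_series (real j - 3 / 2) * (1 - fps_X)" by (simp only: binom_series_add binom_series_1)
  have "binom_series (real (Suc j) - 3 / 2) $ Suc n = binom_series (real j - 3 / 2) $ Suc n - binom_series (real j - 3 / 2) $ n"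
    unfolding e by (simp add: right_diff_distrib mult.commute[of _ fps_X])
  thus ?thesis by (simp only: binom_series_acoeff)
qed

lemma acoeff_backward:
  assumes "m \<le> n" shows "acoeff j (n - m) = acoeff j n - (\<Sum>i<m. acoeff (Suc j) (n - i))"
  using assms
proof (induction m)
  case (Suc m)
  have "n - m = Suc (n - Suc m)" using Suc by simp
  thus ?case using Suc acoeff_diff[of j "n - Suc m"] by simp
qed simp

lemma sum_choose_lessThan: "(\<Sum>i<m. i choose k) = m choose (Suc k)"
  by (induction m) simp_all

text \<open>Newton's backward difference expansion, the differences of \<open>acoeff j\<close> being
  \<open>acoeff (Suc j)\<close>. The induction step sums the expansion of the differences over i <
  m, using \<open>sum_choose_lessThan\<close>; the condition 2 m <= n keeps n - m comparable to
  n.\<close>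

lemma acoeff_taylor:
  assumes "j \<ge> 1"
  shows "\<exists>C\<ge>0. \<forall>n m. 2 * m \<le> n \<longrightarrow>
    \<bar>acoeff j (n - m) - (\<Sum>k<K. (-1) ^ k * real (m choose k) * acoeff (j + k) n)\<bar> \<le> C * real m ^ K * wt (real (j + K) - 1 / 2) n"
  using assms
proof (induction K arbitrary: j)
  case 0
  obtain C where C: "C \<ge> 0" "\<And>n. \<bar>acoeff j n\<bar> \<le> C * wt (real j - 1 / 2) n" using acoeff_bound[OF 0] by blast
  show ?case
  proof (intro exI[of _ "C * 2 powr (real j - 1 / 2)"] conjI allI impI)
    fix n m :: nat assume m: "2 * m \<le> n"
    have "\<bar>acoeff j (n - m)\<bar> \<le> C * wt (real j - 1 / 2) (n - m)" by (rule C)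
    also have "wt (real j - 1 / 2) (n - m) \<le> 2 powr (real j - 1 / 2) * wt (real j - 1 / 2) (m + (n - m))"
      using m 0 by (intro wt_half) auto
    also have "m + (n - m) = n" using m by simp
    finally show "\<bar>acoeff j (n - m) - (\<Sum>k<0. (-1) ^ k * real (m choose k) * acoeff (j + k) n)\<bar> \<le> C * 2 powr (real j - 1 / 2) * real m ^ 0 * wt (real (j + 0) - 1 / 2) n"
      using C(1) by (simp add: mult.assoc mult_left_mono)
  qed (use C in simp)
next
  case (Suc K)
  obtain C where C: "C \<ge> 0" "\<And>n m. 2 * m \<le> n \<Longrightarrow>
    \<bar>acoeff (Suc j) (n - m) - (\<Sum>k<K. (-1) ^ k * real (m choose k) * acoeff (Suc j + k) n)\<bar> \<le> C * real m ^ K * wt (real (Suc j + K) - 1 / 2) n"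
    using Suc.IH[of "Suc j"] by auto
  show ?case
  proof (intro exI[of _ C] conjI allI impI)
    fix n m :: nat assume m: "2 * m \<le> n"
    let ?w = "wt (real (Suc j + K) - 1 / 2) n"
    let ?T = "\<lambda>i. \<Sum>k<K. (-1) ^ k * real (i choose k) * acoeff (Suc j + k) n"
    have 1: "acoeff j (n - m) = acoeff j n - (\<Sum>i<m. acoeff (Suc j) (n - i))"
      using m by (intro acoeff_backward) simp
    have "(\<Sum>k<Suc K. (-1) ^ k * real (m choose k) * acoeff (j + k) n) = acoeff j n + (\<Sum>k<K. (-1) ^ Suc k * real (m choose Suc k) * acoeff (j + Suc k) n)"
      by (subst sum.lessThan_Suc_shift) simp
    also have "(\<Sum>k<K. (-1) ^ Suc k * real (m choose Suc k) * acoeff (j + Suc k) n) = - (\<Sum>i<m. ?T i)"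
    proof -
      have "(\<Sum>i<m. ?T i) = (\<Sum>k<K. \<Sum>i<m. (-1) ^ k * real (i choose k) * acoeff (Suc j + k) n)"
        by (rule sum.swap)
      also have "\<dots> = (\<Sum>k<K. (-1) ^ k * real (\<Sum>i<m. i choose k) * acoeff (Suc j + k) n)"
        by (simp add: sum_distrib_left sum_distrib_right)
      finally show ?thesis unfolding sum_choose_lessThan by (simp add: sum_negf)
    qed
    finally have 2: "acoeff j (n - m) - (\<Sum>k<Suc K. (-1) ^ k * real (m choose k) * acoeff (j + k) n) = - (\<Sum>i<m. acoeff (Suc j) (n - i) - ?T i)"
      unfolding 1 by (simp add: sum_subtractf)
    have "\<bar>- (\<Sum>i<m. acoeff (Suc j) (n - i) - ?T i)\<bar> \<le> (\<Sum>i<m. \<bar>acoeff (Suc j) (n - i) - ?T i\<bar>)"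
      unfolding abs_minus_cancel by (rule sum_abs)
    also have "\<dots> \<le> (\<Sum>i<m. C * real m ^ K * ?w)"
    proof (rule sum_mono)
      fix i assume i: "i \<in> {..<m}"
      have "\<bar>acoeff (Suc j) (n - i) - ?T i\<bar> \<le> C * real i ^ K * ?w" using i m by (intro C(2)) auto
      also have "\<dots> \<le> C * real m ^ K * ?w" using i C(1) by (intro mult_right_mono mult_left_mono power_mono) auto
      finally show "\<bar>acoeff (Suc j) (n - i) - ?T i\<bar> \<le> C * real m ^ K * ?w" .
    qed
    also have "\<dots> = C * real m ^ Suc K * wt (real (j + Suc K) - 1 / 2) n" by simp
    finally show "\<bar>acoeff j (n - m) - (\<Sum>k<Suc K. (-1) ^ k * real (m choose k) * acoeff (j + k) n)\<bar> \<le> C * real m ^ Suc K * wt (real (j + Suc K) - 1 / 2) n"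
      unfolding 2 .
  qed (rule C)
qed

lemma wt_add: "wt a n * wt b n = wt (a + b) n"
  by (simp add: wt_def powr_add[symmetric] add.commute)

lemma wt_mono: "a \<le> b \<Longrightarrow> wt b n \<le> wt a n"
  unfolding wt_def by (intro powr_mono) auto

lemma wt_half_eq: "wt (1 / 2) n = 1 / sqrt (real n + 1)"
proof -
  have "wt (1 / 2) n = inverse (sqrt (real n + 1))"
    unfolding wt_def powr_minus by (subst powr_half_sqrt) simp_all
  thus ?thesis by (simp only: inverse_eq_divide)
qed

lemma pow_mult_wt: "real m ^ k * wt b m \<le> wt (b - real k) m"
proof -
  have "real m ^ k \<le> (real m + 1) ^ k" by (intro power_mono) auto
  also have "\<dots> = (real m + 1) powr real k" by (simp add: powr_realpow)
  also have "\<dots> = wt (- real k) m" by (simp add: wt_def)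
  finally have "real m ^ k * wt b m \<le> wt (- real k) m * wt b m" by (intro mult_right_mono) auto
  thus ?thesis by (simp add: wt_add)
qed

section \<open>Partial sums and tails of the weights\<close>

lemma sum_wt_half: "(\<Sum>m\<le>h. wt (1 / 2) m) \<le> 2 * sqrt (real h + 1)"
proof (induction h)
  case (Suc h)
  define a b where "a = sqrt (real h + 1)" and "b = sqrt (real h + 2)"
  have ab: "a > 0" "b > 0" "a \<le> b" "b * b - a * a = 1" by (simp_all add: a_def b_def)
  have "1 = (b - a) * (b + a)" using ab by (simp add: algebra_simps)
  also have "\<dots> \<le> (b - a) * (2 * b)" using ab by (intro mult_left_mono) auto
  finally have "1 / b \<le> 2 * (b - a)" using ab by (simp add: field_simps)
  moreover have "wt (1 / 2) (Suc h) = 1 / b" unfolding wt_half_eq b_def by (simp add: add.commute)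
  moreover have "sqrt (real (Suc h) + 1) = b" by (simp add: b_def add.commute)
  ultimately show ?case using Suc by (simp add: a_def)
qed (simp add: wt_def)

lemma sum_wt_one: "(\<Sum>m\<le>h. wt 1 m) \<le> 1 + ln (real h + 1)"
proof (induction h)
  case (Suc h)
  have "ln ((real h + 1) / (real h + 2)) \<le> (real h + 1) / (real h + 2) - 1" by (rule ln_le_minus_one) simp
  hence "1 / (real h + 2) \<le> ln (real h + 2) - ln (real h + 1)"
    by (subst (asm) ln_div) (auto simp: field_simps)
  moreover have "wt 1 (Suc h) = 1 / (real h + 2)" by (simp add: wt_def powr_minus divide_inverse add.commute)
  moreover have "real (Suc h) + 1 = real h + 2" by simp
  ultimately show ?case using Suc by (simp only: sum.atMost_Suc)
qed (simp add: wt_def)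

text \<open>Each term is at most the increment of -2 / sqrt (m + p), so the tail telescopes.\<close>

lemma tail_wt_three_halves:
  assumes "p \<ge> 1" shows "summable (\<lambda>m. wt (3 / 2) (m + p))" "(\<Sum>m. wt (3 / 2) (m + p)) \<le> 2 / sqrt (real p)"
proof -
  show s: "summable (\<lambda>m. wt (3 / 2) (m + p))"
    using wt_summable[of "3 / 2"] by (subst summable_iff_shift) simp
  let ?f = "\<lambda>m. - (2 / sqrt (real (m + p)))"
  have le: "wt (3 / 2) (m + p) \<le> ?f (Suc m) - ?f m" for m
  proof -
    define a b where "a = sqrt (real (m + p))" and "b = sqrt (real (Suc m + p))"
    have ab: "a > 0" "b > 0" "a \<le> b" "b * b - a * a = 1" using assms by (simp_all add: a_def b_def)
    have w: "wt (3 / 2) (m + p) = 1 / b * (1 / b * (1 / b))"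
    proof -
      have "wt (3 / 2) (m + p) = wt (1 / 2) (m + p) * (wt (1 / 2) (m + p) * wt (1 / 2) (m + p))" by (simp add: wt_add)
      thus ?thesis unfolding wt_half_eq b_def by (simp add: add.commute)
    qed
    have "(b - a) * (b + a) = 1" using ab by (simp add: algebra_simps)
    hence "b - a = 1 / (b + a)" using ab by (simp add: field_simps)
    moreover have "1 / (b + a) \<ge> 1 / (2 * b)" using ab by (intro divide_left_mono) auto
    ultimately have "1 / (2 * b) \<le> b - a" by simp
    hence "2 * (1 / (2 * b) / (a * b)) \<le> 2 * ((b - a) / (a * b))" using ab by (intro mult_left_mono divide_right_mono) auto
    moreover have "2 * ((b - a) / (a * b)) = - (2 / b) - - (2 / a)" using ab by (simp add: field_simps)
    moreover have "1 / b * (1 / b * (1 / b)) \<le> 2 * (1 / (2 * b) / (a * b))"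
    proof -
      have "1 / b * (1 / b) * (1 / b) \<le> 1 / b * (1 / b) * (1 / a)" using ab by (intro mult_left_mono divide_left_mono) auto
      moreover have "2 * (1 / (2 * b) / (a * b)) = 1 / b * (1 / b) * (1 / a)" by simp
      ultimately show ?thesis by (simp only: mult.assoc)
    qed
    ultimately show ?thesis unfolding w a_def b_def by linarith
  qed
  have "?f \<longlonglongrightarrow> - 0"
  proof (intro tendsto_minus)
    have "filterlim (\<lambda>m. sqrt (real (m + p))) at_top sequentially"
      by (intro filterlim_compose[OF sqrt_at_top] filterlim_compose[OF filterlim_real_sequentially] filterlim_add_const_nat_at_top)
    thus "(\<lambda>m. 2 / sqrt (real (m + p))) \<longlonglongrightarrow> 0" by (intro real_tendsto_divide_at_top[OF tendsto_const])
  qed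
  from telescope_sums[OF this] have "(\<lambda>m. ?f (Suc m) - ?f m) sums (2 / sqrt (real p))" by simp
  from suminf_le[OF le s sums_summable[OF this]] show "(\<Sum>m. wt (3 / 2) (m + p)) \<le> 2 / sqrt (real p)"
    using sums_unique[OF \<open>(\<lambda>m. ?f (Suc m) - ?f m) sums (2 / sqrt (real p))\<close>] by simp
qed

text \<open>The coefficient is the sum of \<open>f $ m * acoeff 1 (n - m)\<close>, cut at m = n/2.
  For small m the second factor is expanded, for large m the decay of f is used, and the truncated
  moments of f are completed to infinite sums. The Taylor remainder needs the sum of m^(K - \<beta>)
  up to n/2, which has order sqrt n for even r and is harmonic for odd r.\<close>

theorem half_power_transfer:
  assumes f: "decays ((real r + 3) / 2) f"
  shows "\<exists>\<nu> Q. \<forall>n\<ge>2. \<bar>(binom_series (- 1 / 2) * f) $ n - (\<Sum>j=1..r div 2 + 1. \<nu> j * acoeff j n)\<bar>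
           \<le> Q * (1 + (if odd r then ln (real n + 1) else 0)) * wt ((real r + 2) / 2) n"
proof -
  define \<beta> where "\<beta> = (real r + 3) / 2"
  define e where "e = (real r + 2) / 2"
  \<comment> \<open>The number of moments of \<open>f\<close> that the decay makes convergent:
    \<beta> - k is at least 3/2 for k < K, and is 1/2 or 1 at k = K.\<close>
  define K where "K = r div 2 + 1"
  have K: "K \<ge> 1" and Kr: "2 * K = r + 2 \<or> 2 * K = r + 1" unfolding K_def by presburger+
  have Krr: "real K \<le> e" "real K \<ge> e - 1 / 2" using Kr unfolding e_def by (auto simp: field_simps)
  have \<beta>e: "\<beta> = e + 1 / 2" by (simp add: \<beta>_def e_def field_simps)
  obtain A where A: "A \<ge> 0" "\<And>n. \<bar>f $ n\<bar> \<le> A * wt \<beta> n" using f unfolding decays_def \<beta>_def by blast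
  obtain C where C: "C \<ge> 0" "\<And>n m. 2 * m \<le> n \<Longrightarrow>
    \<bar>acoeff 1 (n - m) - (\<Sum>k<K. (-1) ^ k * real (m choose k) * acoeff (1 + k) n)\<bar> \<le> C * real m ^ K * wt (real (1 + K) - 1 / 2) n"
    using acoeff_taylor[of 1 K] by auto
  have "\<forall>k. \<exists>D. D \<ge> 0 \<and> (\<forall>n. \<bar>acoeff (1 + k) n\<bar> \<le> D * wt (real (1 + k) - 1 / 2) n)"
    using acoeff_bound by (metis le_add1)
  then obtain D where D: "\<And>k. D k \<ge> 0" "\<And>k n. \<bar>acoeff (1 + k) n\<bar> \<le> D k * wt (real (1 + k) - 1 / 2) n" by metis
  have ck: "\<bar>real (m choose k) * f $ m\<bar> \<le> A * wt (\<beta> - real k) m" for m k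
  proof -
    have "m choose k \<le> m ^ k" by (cases "k \<le> m") (simp_all add: binomial_le_pow binomial_eq_0)
    hence "real (m choose k) \<le> real m ^ k" by (metis of_nat_le_iff of_nat_power)
    hence "\<bar>real (m choose k) * f $ m\<bar> \<le> real m ^ k * (A * wt \<beta> m)"
      unfolding abs_mult using A by (intro mult_mono) auto
    also have "\<dots> = A * (real m ^ k * wt \<beta> m)" by simp
    also have "\<dots> \<le> A * wt (\<beta> - real k) m" using A(1) pow_mult_wt by (intro mult_left_mono)
    finally show ?thesis .
  qed
  have k32: "\<beta> - real k \<ge> 3 / 2" if "k < K" for k
    using that Krr \<beta>e by linarith
  have summ: "summable (\<lambda>m. real (m choose k) * f $ m)" if "k < K" for k
    by (rule summable_comparison_test'[OF summable_mult[OF wt_summable[of "\<beta> - real k"], of A]]) (use k32[OF that] ck in auto)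
  \<comment> \<open>The coefficient of (1-s)^(j-1) in the Taylor expansion of f at s = 1; this power
    times (1-s)^(-1/2) generates \<open>acoeff j\<close>.\<close>
  define \<nu> where "\<nu> j = (-1) ^ (j - 1) * (\<Sum>m. real (m choose (j - 1)) * f $ m)" for j
  define Q1 where "Q1 = A * C * 2"
  define Q2 where "Q2 = A * 2 powr \<beta> * 2"
  define q3 where "q3 k = D k * (A * (2 powr (\<beta> - real k - 3 / 2) * (2 * sqrt 2)))" for k
  define Q3 where "Q3 = (\<Sum>k<K. q3 k)"
  define L where "L n = (1 + (if odd r then ln (real n + 1) else 0))" for n
  have L1: "L n \<ge> 1" for n by (simp add: L_def)
  have Q0: "Q1 \<ge> 0" "Q2 \<ge> 0" "Q3 \<ge> 0" using A C D by (auto simp: Q1_def Q2_def Q3_def q3_def intro!: sum_nonneg mult_nonneg_nonneg)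
  show ?thesis
  proof (intro exI[of _ \<nu>] exI[of _ "Q1 + Q2 + Q3"] allI impI)
    fix n :: nat assume n: "2 \<le> n"
    define h where "h = n div 2"
    have h: "2 * h \<le> n" "n \<le> 2 * h + 1" "h \<ge> 1" using n by (auto simp: h_def)
    let ?N = "real n + 1"
    define R where "R m = acoeff 1 (n - m) - (\<Sum>k<K. (-1) ^ k * real (m choose k) * acoeff (1 + k) n)" for m
    define T1 where "T1 = (\<Sum>m\<le>h. f $ m * R m)"
    define T2 where "T2 = (\<Sum>m\<in>{h<..n}. f $ m * acoeff 1 (n - m))"
    define t3 where "t3 k = (\<Sum>m. real ((m + (h + 1)) choose k) * f $ (m + (h + 1)))" for k
    define T3 where "T3 = (\<Sum>k<K. (-1) ^ k * acoeff (1 + k) n * t3 k)"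
    have bf: "(binom_series (- 1 / 2) * f) $ n = (\<Sum>m\<le>h. f $ m * acoeff 1 (n - m)) + T2"
    proof -
      have "(binom_series (- 1 / 2) * f) $ n = (f * binom_series (real 1 - 3 / 2)) $ n" by (simp add: mult.commute)
      also have "\<dots> = (\<Sum>m=0..n. f $ m * acoeff 1 (n - m))" by (simp only: fps_mult_nth binom_series_acoeff)
      also have "{0..n} = {..h} \<union> {h<..n}" using h by auto
      also have "(\<Sum>m\<in>{..h} \<union> {h<..n}. f $ m * acoeff 1 (n - m)) = (\<Sum>m\<le>h. f $ m * acoeff 1 (n - m)) + T2"
        unfolding T2_def by (rule sum.union_disjoint) auto
      finally show ?thesis .
    qed
    have head: "(\<Sum>m\<le>h. f $ m * acoeff 1 (n - m)) = T1 + (\<Sum>k<K. (-1) ^ k * acoeff (1 + k) n * (\<Sum>m\<le>h. real (m choose k) * f $ m))"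
    proof -
      have "(\<Sum>m\<le>h. f $ m * acoeff 1 (n - m)) = T1 + (\<Sum>m\<le>h. \<Sum>k<K. (-1) ^ k * acoeff (1 + k) n * (real (m choose k) * f $ m))"
        unfolding T1_def R_def sum.distrib[symmetric]
        by (intro sum.cong refl) (simp add: right_diff_distrib sum_distrib_left mult_ac)
      also have "(\<Sum>m\<le>h. \<Sum>k<K. (-1) ^ k * acoeff (1 + k) n * (real (m choose k) * f $ m)) = (\<Sum>k<K. \<Sum>m\<le>h. (-1) ^ k * acoeff (1 + k) n * (real (m choose k) * f $ m))"
        by (rule sum.swap)
      finally show ?thesis by (simp only: sum_distrib_left)
    qed
    have split: "(\<Sum>m. real (m choose k) * f $ m) = (\<Sum>m\<le>h. real (m choose k) * f $ m) + t3 k" if "k < K" for k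
      using suminf_split_initial_segment[OF summ[OF that], of "h + 1"] unfolding t3_def
      by (simp add: lessThan_Suc_atMost)
    have "(\<Sum>j=1..r div 2 + 1. \<nu> j * acoeff j n) = (\<Sum>k<K. \<nu> (1 + k) * acoeff (1 + k) n)"
      by (rule sum.reindex_bij_witness[of _ "\<lambda>k. 1 + k" "\<lambda>j. j - 1"]) (auto simp: K_def)
    also have "\<dots> = (\<Sum>k<K. (-1) ^ k * acoeff (1 + k) n * (\<Sum>m\<le>h. real (m choose k) * f $ m)) + T3"
      unfolding T3_def sum.distrib[symmetric]
    proof (rule sum.cong[OF refl])
      fix k assume "k \<in> {..<K}"
      hence "\<nu> (1 + k) = (-1) ^ k * ((\<Sum>m\<le>h. real (m choose k) * f $ m) + t3 k)"
        by (simp only: \<nu>_def add_diff_cancel_left' split lessThan_iff)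
      thus "\<nu> (1 + k) * acoeff (1 + k) n = (-1) ^ k * acoeff (1 + k) n * (\<Sum>m\<le>h. real (m choose k) * f $ m) + (-1) ^ k * acoeff (1 + k) n * t3 k"
        by (simp only: distrib_left distrib_right mult_ac)
    qed
    finally have eq: "(binom_series (- 1 / 2) * f) $ n - (\<Sum>j=1..r div 2 + 1. \<nu> j * acoeff j n) = T1 + T2 - T3"
      unfolding bf head by simp
    have b1: "\<bar>T1\<bar> \<le> Q1 * L n * wt e n"
    proof -
      have "\<bar>T1\<bar> \<le> (\<Sum>m\<le>h. \<bar>f $ m * R m\<bar>)" unfolding T1_def by (rule sum_abs)
      also have "\<dots> \<le> (\<Sum>m\<le>h. A * C * wt (real (1 + K) - 1 / 2) n * wt (\<beta> - real K) m)"
      proof (rule sum_mono)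
        fix m assume "m \<in> {..h}"
        hence "2 * m \<le> n" using h by simp
        hence "\<bar>f $ m * R m\<bar> \<le> (A * wt \<beta> m) * (C * real m ^ K * wt (real (1 + K) - 1 / 2) n)"
          unfolding abs_mult R_def using A C by (intro mult_mono) auto
        also have "\<dots> = A * C * wt (real (1 + K) - 1 / 2) n * (real m ^ K * wt \<beta> m)" by (simp add: mult_ac)
        also have "\<dots> \<le> A * C * wt (real (1 + K) - 1 / 2) n * wt (\<beta> - real K) m"
          using A C pow_mult_wt by (intro mult_left_mono) auto
        finally show "\<bar>f $ m * R m\<bar> \<le> A * C * wt (real (1 + K) - 1 / 2) n * wt (\<beta> - real K) m" .
      qed
      also have "\<dots> = A * C * wt (real (1 + K) - 1 / 2) n * (\<Sum>m\<le>h. wt (\<beta> - real K) m)"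
        by (simp only: sum_distrib_left)
      also have "\<dots> \<le> A * C * wt (real (1 + K) - 1 / 2) n * (2 * L n * wt (e - (real (1 + K) - 1 / 2)) n)"
      proof (intro mult_left_mono)
        show "(\<Sum>m\<le>h. wt (\<beta> - real K) m) \<le> 2 * L n * wt (e - (real (1 + K) - 1 / 2)) n"
        proof (cases "odd r")
          case True
          hence "2 * K = r + 1" unfolding K_def by presburger
          hence "real (2 * K) = real (r + 1)" by (simp only:)
          hence Ke: "real K = (real r + 1) / 2" by simp
          have x: "\<beta> - real K = 1" "e - (real (1 + K) - 1 / 2) = 0" unfolding \<beta>_def e_def by (simp_all add: Ke field_simps)
          have "(\<Sum>m\<le>h. wt 1 m) \<le> 1 + ln (real h + 1)" by (rule sum_wt_one)
          also have "\<dots> \<le> L n" using True h unfolding L_def by simp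
          also have "\<dots> \<le> 2 * L n" using L1[of n] by simp
          finally show ?thesis unfolding x by (simp add: wt_def)
        next
          case False
          hence "2 * K = r + 2" unfolding K_def by presburger
          hence "real (2 * K) = real (r + 2)" by (simp only:)
          hence Ke: "real K = (real r + 2) / 2" by simp
          have x: "\<beta> - real K = 1 / 2" "e - (real (1 + K) - 1 / 2) = - (1 / 2)" unfolding \<beta>_def e_def by (simp_all add: Ke field_simps)
          have "(\<Sum>m\<le>h. wt (1 / 2) m) \<le> 2 * sqrt (real h + 1)" by (rule sum_wt_half)
          also have "\<dots> \<le> 2 * sqrt ?N" using h by simp
          also have "sqrt ?N = wt (- (1 / 2)) n" by (simp add: wt_def powr_half_sqrt)
          finally show ?thesis unfolding x using False by (simp add: L_def)
        qed
      qed (use A C in auto)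
      also have "\<dots> = Q1 * L n * (wt (real (1 + K) - 1 / 2) n * wt (e - (real (1 + K) - 1 / 2)) n)"
        by (simp add: Q1_def mult_ac)
      also have "wt (real (1 + K) - 1 / 2) n * wt (e - (real (1 + K) - 1 / 2)) n = wt e n" by (simp only: wt_add) simp
      finally show ?thesis .
    qed
    \<comment> \<open>For m > n/2 the coefficients of f are O(n^(-\<beta>)), and the values of
      \<open>acoeff 1\<close> sum to O(sqrt n).\<close>
    have b2: "\<bar>T2\<bar> \<le> Q2 * wt e n"
    proof -
      have "\<bar>T2\<bar> \<le> (\<Sum>m\<in>{h<..n}. \<bar>f $ m * acoeff 1 (n - m)\<bar>)" unfolding T2_def by (rule sum_abs)
      also have "\<dots> \<le> (\<Sum>m\<in>{h<..n}. A * (2 powr \<beta> * wt \<beta> n) * wt (1 / 2) (n - m))"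
      proof (rule sum_mono)
        fix m assume m: "m \<in> {h<..n}"
        have "wt \<beta> m \<le> 2 powr \<beta> * wt \<beta> ((n - m) + m)" using m h by (intro wt_half) (auto simp: \<beta>_def)
        hence w: "\<bar>f $ m\<bar> \<le> A * (2 powr \<beta> * wt \<beta> n)" using m A(1) A(2)[of m] mult_left_mono[of "wt \<beta> m" "2 powr \<beta> * wt \<beta> n" A] by simp
        have "(acoeff 1 (n - m))\<^sup>2 \<le> 1 / (real (n - m) + 1)" using acoeff_1_sq(1)[of "n - m"] by (simp add: pos_le_divide_eq)
        hence "acoeff 1 (n - m) \<le> sqrt (1 / (real (n - m) + 1))" by (rule real_le_rsqrt)
        hence "\<bar>acoeff 1 (n - m)\<bar> \<le> wt (1 / 2) (n - m)"
          using acoeff_1_pos[of "n - m"] by (simp only: wt_half_eq real_sqrt_divide real_sqrt_one abs_of_pos)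
        thus "\<bar>f $ m * acoeff 1 (n - m)\<bar> \<le> A * (2 powr \<beta> * wt \<beta> n) * wt (1 / 2) (n - m)"
          unfolding abs_mult using w A by (intro mult_mono) auto
      qed
      also have "\<dots> = A * (2 powr \<beta> * wt \<beta> n) * (\<Sum>m\<in>{h<..n}. wt (1 / 2) (n - m))" by (simp only: sum_distrib_left)
      also have "\<dots> \<le> A * (2 powr \<beta> * wt \<beta> n) * (2 * sqrt ?N)"
      proof (intro mult_left_mono)
        have "(\<Sum>m\<in>{h<..n}. wt (1 / 2) (n - m)) \<le> (\<Sum>m\<le>n. wt (1 / 2) (n - m))"
          by (rule sum_mono2) auto
        also have "\<dots> = (\<Sum>m\<le>n. wt (1 / 2) m)" using sum.nat_diff_reindex[of "wt (1 / 2)" "Suc n"] by (simp add: lessThan_Suc_atMost)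
        also have "\<dots> \<le> 2 * sqrt ?N" by (rule sum_wt_half)
        finally show "(\<Sum>m\<in>{h<..n}. wt (1 / 2) (n - m)) \<le> 2 * sqrt ?N" .
      qed (use A in auto)
      also have "sqrt ?N = wt (- (1 / 2)) n" by (simp add: wt_def powr_half_sqrt)
      also have "A * (2 powr \<beta> * wt \<beta> n) * (2 * wt (- (1 / 2)) n) = Q2 * (wt \<beta> n * wt (- (1 / 2)) n)" by (simp add: Q2_def mult_ac)
      also have "wt \<beta> n * wt (- (1 / 2)) n = wt e n" by (simp only: wt_add \<beta>e) simp
      finally show ?thesis .
    qed
    have b3: "\<bar>T3\<bar> \<le> Q3 * wt e n"
    proof -
      have "\<bar>T3\<bar> \<le> (\<Sum>k<K. \<bar>(-1) ^ k * acoeff (1 + k) n * t3 k\<bar>)" unfolding T3_def by (rule sum_abs)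
      also have "\<dots> \<le> (\<Sum>k<K. q3 k * wt e n)"
      proof (rule sum_mono)
        fix k assume "k \<in> {..<K}"
        hence k: "k < K" by simp
        \<comment> \<open>The decay in excess of 3/2 is taken out at the index h + 1, which is
          comparable to n; the exponent 3/2 is left for \<open>tail_wt_three_halves\<close>.\<close>
        define \<epsilon> where "\<epsilon> = \<beta> - real k - 3 / 2"
        have \<epsilon>: "\<epsilon> \<ge> 0" using k32[OF k] by (simp add: \<epsilon>_def)
        have tm: "\<bar>real ((m + (h + 1)) choose k) * f $ (m + (h + 1))\<bar> \<le> A * (2 powr \<epsilon> * wt \<epsilon> n) * wt (3 / 2) (m + (h + 1))" for m
        proof -
          have "wt \<epsilon> (m + (h + 1)) \<le> wt \<epsilon> (h + 1)" unfolding wt_def using \<epsilon> by (intro powr_mono2') auto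
          also have "\<dots> \<le> 2 powr \<epsilon> * wt \<epsilon> ((n - (h + 1)) + (h + 1))" using h \<epsilon> by (intro wt_half) auto
          also have "(n - (h + 1)) + (h + 1) = n" using h n by auto
          finally have w: "wt \<epsilon> (m + (h + 1)) \<le> 2 powr \<epsilon> * wt \<epsilon> n" .
          have "\<bar>real ((m + (h + 1)) choose k) * f $ (m + (h + 1))\<bar> \<le> A * wt (\<beta> - real k) (m + (h + 1))" by (rule ck)
          also have "wt (\<beta> - real k) (m + (h + 1)) = wt \<epsilon> (m + (h + 1)) * wt (3 / 2) (m + (h + 1))" by (simp add: wt_add \<epsilon>_def)
          also have "A * (wt \<epsilon> (m + (h + 1)) * wt (3 / 2) (m + (h + 1))) \<le> A * ((2 powr \<epsilon> * wt \<epsilon> n) * wt (3 / 2) (m + (h + 1)))"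
            using w A(1) by (intro mult_left_mono mult_right_mono) auto
          finally show ?thesis by (simp only: mult.assoc)
        qed
        have s32: "summable (\<lambda>m. A * (2 powr \<epsilon> * wt \<epsilon> n) * wt (3 / 2) (m + (h + 1)))"
          by (intro summable_mult tail_wt_three_halves) simp
        have sa: "summable (\<lambda>m. \<bar>real ((m + (h + 1)) choose k) * f $ (m + (h + 1))\<bar>)"
          by (rule summable_comparison_test'[OF s32]) (use tm in simp)
        have "\<bar>t3 k\<bar> \<le> (\<Sum>m. \<bar>real ((m + (h + 1)) choose k) * f $ (m + (h + 1))\<bar>)"
          unfolding t3_def by (rule summable_rabs[OF sa])
        also have "\<dots> \<le> (\<Sum>m. A * (2 powr \<epsilon> * wt \<epsilon> n) * wt (3 / 2) (m + (h + 1)))"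
          by (rule suminf_le[OF tm sa s32])
        also have "\<dots> = A * (2 powr \<epsilon> * wt \<epsilon> n) * (\<Sum>m. wt (3 / 2) (m + (h + 1)))"
          by (rule suminf_mult) (rule tail_wt_three_halves, simp)
        also have "\<dots> \<le> A * (2 powr \<epsilon> * wt \<epsilon> n) * (2 / sqrt (real (h + 1)))"
          using A(1) by (intro mult_left_mono tail_wt_three_halves) auto
        also have "\<dots> \<le> A * (2 powr \<epsilon> * wt \<epsilon> n) * (2 * sqrt 2 * wt (1 / 2) n)"
        proof (intro mult_left_mono)
          have "sqrt (?N / 2) \<le> sqrt (real (h + 1))" using h by (intro real_sqrt_le_mono) auto
          hence "2 / sqrt (real (h + 1)) \<le> 2 / sqrt (?N / 2)" by (intro divide_left_mono) auto
          also have "\<dots> = 2 * sqrt 2 * wt (1 / 2) n" unfolding wt_half_eq by (simp add: real_sqrt_divide)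
          finally show "2 / sqrt (real (h + 1)) \<le> 2 * sqrt 2 * wt (1 / 2) n" .
        qed (use A in auto)
        finally have t3b: "\<bar>t3 k\<bar> \<le> A * (2 powr \<epsilon> * wt \<epsilon> n) * (2 * sqrt 2 * wt (1 / 2) n)" .
        have "\<bar>(-1) ^ k * acoeff (1 + k) n * t3 k\<bar> = \<bar>acoeff (1 + k) n\<bar> * \<bar>t3 k\<bar>" by (simp add: abs_mult power_abs)
        also have "\<dots> \<le> (D k * wt (real (1 + k) - 1 / 2) n) * (A * (2 powr \<epsilon> * wt \<epsilon> n) * (2 * sqrt 2 * wt (1 / 2) n))"
          using D t3b by (intro mult_mono) auto
        also have "\<dots> = q3 k * (wt (real (1 + k) - 1 / 2) n * (wt \<epsilon> n * wt (1 / 2) n))"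
          by (simp add: q3_def \<epsilon>_def mult_ac)
        also have "wt (real (1 + k) - 1 / 2) n * (wt \<epsilon> n * wt (1 / 2) n) = wt e n"
        proof -
          have "real (1 + k) - 1 / 2 + (\<epsilon> + 1 / 2) = e" by (simp add: \<epsilon>_def \<beta>e)
          thus ?thesis by (simp only: wt_add)
        qed
        finally show "\<bar>(-1) ^ k * acoeff (1 + k) n * t3 k\<bar> \<le> q3 k * wt e n" .
      qed
      finally show ?thesis unfolding Q3_def sum_distrib_right .
    qed
    have up: "Q * wt e n \<le> Q * L n * wt e n" if "Q \<ge> 0" for Q
      using mult_left_mono[OF L1[of n] that] by (intro mult_right_mono) auto
    have "\<bar>T1 + T2 - T3\<bar> \<le> Q1 * L n * wt e n + Q2 * L n * wt e n + Q3 * L n * wt e n"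
      using b1 b2 b3 up[OF Q0(2)] up[OF Q0(3)] by linarith
    also have "\<dots> = (Q1 + Q2 + Q3) * L n * wt e n" by (simp only: distrib_right)
    finally show "\<bar>(binom_series (- 1 / 2) * f) $ n - (\<Sum>j=1..r div 2 + 1. \<nu> j * acoeff j n)\<bar>
           \<le> (Q1 + Q2 + Q3) * (1 + (if odd r then ln (real n + 1) else 0)) * wt ((real r + 2) / 2) n"
      unfolding eq L_def e_def .
  qed
qed

section \<open>Change of basis and exponentiation\<close>

text \<open>Integrating the derivative of sin(t/2) cos(t/2)^(2n+1), which vanishes at both ends,
  gives the recursion of \<open>acoeff_1_Suc\<close>.\<close>

lemma wallis: "acoeff 1 n = 1 / (2 * pi) * (LINT t:{-pi..pi}|lborel. cos (t / 2) ^ (2 * n))"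
proof -
  define I where "I n = (LINT t:{-pi..pi}|lborel. cos (t / 2) ^ (2 * n))" for n
  have si: "set_integrable lborel {-pi..pi} (\<lambda>t. cos (t / 2) ^ (2 * n))" for n
    by (intro borel_integrable_atLeastAtMost' continuous_intros) auto
  have rec: "(real n + 1) * I (Suc n) = (real n + 1 / 2) * I n" for n
  proof -
    let ?f = "\<lambda>t. (real n + 1) * cos (t / 2) ^ (2 * Suc n) - (real n + 1 / 2) * cos (t / 2) ^ (2 * n)"
    have "(\<integral>t. ?f t * indicator {-pi..pi} t \<partial>lborel) = sin (pi / 2) * cos (pi / 2) ^ (2 * n + 1) - sin (-pi / 2) * cos (-pi / 2) ^ (2 * n + 1)"
    proof (rule integral_FTC_Icc_real)
      fix t :: real
      let ?c = "cos (t / 2)" and ?s = "sin (t / 2)"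
      have s2: "?s * ?s = 1 - ?c * ?c" using sin_cos_squared_add[of "t / 2"] by (simp add: power2_eq_square)
      have "((\<lambda>t. sin (t / 2)) has_real_derivative ?c / 2) (at t)" "((\<lambda>t. cos (t / 2)) has_real_derivative (- ?s / 2)) (at t)"
        by (auto intro!: derivative_eq_intros)
      from DERIV_mult[OF this(1) DERIV_power[OF this(2), of "2 * n + 1"]]
      have "((\<lambda>t. sin (t / 2) * cos (t / 2) ^ (2 * n + 1)) has_real_derivative
        (?c / 2 * ?c ^ (2 * n + 1) + real (2 * n + 1) * (- ?s / 2 * ?c ^ (2 * n + 1 - Suc 0)) * ?s)) (at t)" .
      moreover have "?c / 2 * ?c ^ (2 * n + 1) + real (2 * n + 1) * (- ?s / 2 * ?c ^ (2 * n + 1 - Suc 0)) * ?s = ?f t"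
      proof -
        have "?c / 2 * ?c ^ (2 * n + 1) + real (2 * n + 1) * (- ?s / 2 * ?c ^ (2 * n + 1 - Suc 0)) * ?s
           = ?c ^ (2 * n) * (?c * ?c / 2 - (real n + 1 / 2) * (?s * ?s))" by (simp add: algebra_simps add_divide_distrib)
        thus ?thesis unfolding s2 by (simp add: algebra_simps)
      qed
      ultimately show "((\<lambda>t. sin (t / 2) * cos (t / 2) ^ (2 * n + 1)) has_real_derivative ?f t) (at t)" by (simp only:)
    qed (auto intro!: continuous_intros)
    hence "(LINT t:{-pi..pi}|lborel. ?f t) = 0" by (simp add: set_lebesgue_integral_def mult.commute)
    moreover have "(LINT t:{-pi..pi}|lborel. ?f t) = (real n + 1) * I (Suc n) - (real n + 1 / 2) * I n"
      unfolding I_def using si[of "Suc n"] si[of n] by (subst set_integral_diff) (auto simp del: power_Suc)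
    ultimately show ?thesis by simp
  qed
  have "I n = 2 * pi * acoeff 1 n"
  proof (induction n)
    case 0 show ?case by (simp add: I_def acoeff_def set_lebesgue_integral_def)
  next
    case (Suc n)
    have "(real n + 1) * I (Suc n) = (real n + 1) * (2 * pi * acoeff 1 (Suc n))"
      using rec[of n] acoeff_1_Suc[of n] unfolding Suc by (simp add: algebra_simps)
    thus ?case by (subst (asm) mult_left_cancel) auto
  qed
  thus ?thesis by (simp add: I_def[symmetric])
qed

text \<open>cos(t/2)^2 is the characteristic function of a step that is 0 with probability 1/2 and
  +1 or -1 with probability 1/4 each, so \<open>acoeff 1 n\<close> is the probability that this lazy
  walk is at 0 after n steps.\<close>

lemma half_int_expansion_acoeff_1: "half_int_expansion r (acoeff 1)"
proof -
  define \<phi> where "\<phi> t = complex_of_real ((cos (t / 2))\<^sup>2)" for t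
  define F where "F = fps_const (1 / 2) + fps_const (1 / 4) * (fps_exp 1 + fps_exp (- 1 :: real))"
  have "imag_expansion (r + 3) (\<lambda>t. of_real (1 / 2) + of_real (1 / 4) * (iexp (1 * t) + iexp (- 1 * t))) F"
    unfolding F_def by (intro imag_expansion_add imag_expansion_const imag_expansion_cmult imag_expansion_iexp)
  moreover have "of_real (1 / 2) + of_real (1 / 4) * (iexp (1 * t) + iexp (- 1 * t)) = \<phi> t" for t
  proof -
    have "iexp (1 * t) = cis t" "iexp (- 1 * t) = cis (- t)" by (simp_all add: cis_conv_exp)
    moreover have "(cos (t / 2))\<^sup>2 = 1 / 2 + cos t / 2" using cos_double_cos[of "t / 2"] by (simp add: diff_divide_distrib)
    ultimately show ?thesis unfolding \<phi>_def by (simp add: complex_eq_iff)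
  qed
  ultimately have \<phi>: "imag_expansion (r + 3) \<phi> F" by (simp only: ext)
  have V: "imag_expansion (r + 1) (\<lambda>t. \<i> * of_real t) fps_X"
  proof (rule imag_expansion_poly[where M = 2])
    show "\<i> * complex_of_real t = (\<Sum>m<2. complex_of_real (fps_X $ m) * (\<i> * complex_of_real t) ^ m)" for t
      by (simp add: numeral_2_eq_2)
  qed (auto simp: fps_X_def)
  have \<phi>m: "\<phi> \<in> borel_measurable borel" unfolding \<phi>_def by measurable
  have Vm: "(\<lambda>t. \<i> * complex_of_real t) \<in> borel_measurable borel" by measurable
  have F012: "F $ 0 = 1" "F $ 1 = 0" "F $ 2 > 0" by (simp_all add: F_def)
  obtain \<delta> where \<delta>: "0 < \<delta>" "\<delta> \<le> 1"
    "half_int_expansion r (\<lambda>n. LINT t:{-\<delta>..\<delta>}|lborel. Re (\<phi> t ^ n * (\<i> * of_real t) / (\<i> * of_real t)))"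
    using edgeworth_integral[OF \<phi>m \<phi> F012 Vm V] by auto
  let ?g = "\<lambda>n t. cos (t / 2) ^ (2 * n)"
  have "(LINT t:{-\<delta>..\<delta>}|lborel. Re (\<phi> t ^ n * (\<i> * of_real t) / (\<i> * of_real t))) = (LINT t:{-\<delta>..\<delta>}|lborel. ?g n t)" for n
    unfolding set_lebesgue_integral_def
  proof (rule integral_cong_AE)
    have Re: "Re (\<phi> t ^ n * (\<i> * of_real t) / (\<i> * of_real t)) = ?g n t" if "t \<noteq> 0" for t
    proof -
      have "\<phi> t ^ n * (\<i> * of_real t) / (\<i> * of_real t) = complex_of_real (?g n t)"
        using that by (simp add: \<phi>_def power_mult)
      thus ?thesis by (simp only: Re_complex_of_real)
    qed
    show "AE t in lborel. indicator {-\<delta>..\<delta>} t *\<^sub>R Re (\<phi> t ^ n * (\<i> * of_real t) / (\<i> * of_real t)) = indicator {-\<delta>..\<delta>} t *\<^sub>R ?g n t"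
    proof (rule AE_mp[OF AE_lborel_singleton[of 0]], intro AE_I2 impI)
      fix t :: real assume "t \<noteq> 0"
      from Re[OF this] show "indicator {-\<delta>..\<delta>} t *\<^sub>R Re (\<phi> t ^ n * (\<i> * of_real t) / (\<i> * of_real t)) = indicator {-\<delta>..\<delta>} t *\<^sub>R ?g n t"
        by (simp only:)
    qed
  qed (use \<phi>m in measurable)
  with \<delta>(3) have h: "half_int_expansion r (\<lambda>n. LINT t:{-\<delta>..\<delta>}|lborel. ?g n t)" by (simp only:)
  define \<rho> where "\<rho> = (cos (\<delta> / 2))\<^sup>2"
  have "\<delta> / 2 < pi / 2" using \<delta> pi_gt3 by linarith
  hence c: "0 < cos (\<delta> / 2)" "cos (\<delta> / 2) < 1"
    using \<delta> cos_gt_zero[of "\<delta> / 2"] cos_monotone_0_pi[of 0 "\<delta> / 2"] by auto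
  have \<rho>: "0 \<le> \<rho>" "\<rho> < 1" using c by (auto simp: \<rho>_def power_less_one_iff abs_square_less_1)
  have "(\<lambda>n. (LINT t:{-pi..pi}|lborel. ?g n t) - (LINT t:{-\<delta>..\<delta>}|lborel. ?g n t)) \<in> O(\<lambda>n. \<rho> ^ n)"
  proof (intro bigoI[where c = "2 * pi"] always_eventually allI)
    fix n
    have "\<bar>(LINT t:{-pi..pi}|lborel. ?g n t) - (LINT t:{-\<delta>..\<delta>}|lborel. ?g n t)\<bar> \<le> 2 * pi * \<rho> ^ n"
    proof (rule central_integral_diff[OF _ \<delta>(1,2)])
      show "set_integrable lborel {-pi..pi} (?g n)"
        by (intro borel_integrable_atLeastAtMost' continuous_intros) auto
      fix t :: real assume t: "\<delta> \<le> \<bar>t\<bar>" "\<bar>t\<bar> \<le> pi"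
      have "cos (t / 2) = cos (\<bar>t\<bar> / 2)" by (cases "t \<ge> 0") auto
      moreover have "0 \<le> cos (\<bar>t\<bar> / 2)" using t by (intro cos_ge_zero) auto
      moreover have "cos (\<bar>t\<bar> / 2) \<le> cos (\<delta> / 2)" using t \<delta> by (intro cos_monotone_0_pi_le) auto
      ultimately have "(cos (t / 2))\<^sup>2 \<le> \<rho>" unfolding \<rho>_def by (simp add: power_mono)
      hence "((cos (t / 2))\<^sup>2) ^ n \<le> \<rho> ^ n" by (intro power_mono) auto
      thus "\<bar>?g n t\<bar> \<le> \<rho> ^ n" by (simp add: power_mult)
    qed (use \<rho> in simp)
    thus "norm ((LINT t:{-pi..pi}|lborel. ?g n t) - (LINT t:{-\<delta>..\<delta>}|lborel. ?g n t)) \<le> 2 * pi * norm (\<rho> ^ n)"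
      using \<rho> by simp
  qed
  moreover have "(\<lambda>n. \<rho> ^ n) \<in> O(\<lambda>n. real n powr (-((real r + 1) / 2)))" using pow_mult_power_bigo[OF \<rho>, of 0] by simp
  ultimately have "(\<lambda>n. (LINT t:{-pi..pi}|lborel. ?g n t) - (LINT t:{-\<delta>..\<delta>}|lborel. ?g n t)) \<in> O(\<lambda>n. real n powr (-((real r + 1) / 2)))"
    by (rule landau_o.big_trans)
  from half_int_expansion_cmult[OF half_int_expansion_diff_bigo[OF h this], of "1 / (2 * pi)"]
  show ?thesis unfolding wallis[symmetric] .
qed

section \<open>Trading powers of n for the sequences \<open>acoeff l\<close>\<close>

lemma acoeff_bigo: "j \<ge> 1 \<Longrightarrow> acoeff j \<in> O(\<lambda>n. real n powr (-(real j - 1 / 2)))"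
proof -
  assume "j \<ge> 1"
  then obtain C where C: "C \<ge> 0" "\<And>n. \<bar>acoeff j n\<bar> \<le> C * wt (real j - 1 / 2) n" using acoeff_bound by blast
  show ?thesis
  proof (intro bigoI[where c = C] eventually_mono[OF eventually_gt_at_top[of 0]])
    fix n :: nat assume "n > 0"
    hence "wt (real j - 1 / 2) n \<le> real n powr (-(real j - 1 / 2))" unfolding wt_def using \<open>j \<ge> 1\<close> by (intro powr_mono2') auto
    hence "C * wt (real j - 1 / 2) n \<le> C * real n powr (-(real j - 1 / 2))" using C by (intro mult_left_mono)
    thus "norm (acoeff j n) \<le> C * norm (real n powr (-(real j - 1 / 2)))" using C(2)[of n] by simp
  qed
qed

lemma bigo_div_n: "f \<in> O(\<lambda>n. real n powr a) \<Longrightarrow> (\<lambda>n. f n / real n) \<in> O(\<lambda>n. real n powr (a - 1))"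
proof -
  assume "f \<in> O(\<lambda>n. real n powr a)"
  hence "(\<lambda>n. f n * (1 / real n)) \<in> O(\<lambda>n. real n powr a * (1 / real n))" by (intro landau_o.big.mult) auto
  moreover have "(\<lambda>n. real n powr a * (1 / real n)) \<in> O(\<lambda>n. real n powr (a - 1))"
    by (intro bigoI[where c = 1] eventually_mono[OF eventually_gt_at_top[of 0]]) (simp add: powr_diff)
  ultimately show ?thesis using landau_o.big_trans by fastforce
qed

text \<open>The sum starts at l = 2 because (1-s)^(l - 3/2) is then y times a polynomial. The error
  has the order of the first omitted sequence, \<open>acoeff (L + 1)\<close>.\<close>

definition acoeff_expandable :: "nat \<Rightarrow> (nat \<Rightarrow> real) \<Rightarrow> bool" where
  "acoeff_expandable L f \<longleftrightarrow> (\<exists>d. (\<lambda>n. f n - (\<Sum>l=2..L. d l * acoeff l n)) \<in> O(\<lambda>n. real n powr (-(real L + 1 / 2))))"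

lemma acoeff_expandable_bigo: "f \<in> O(\<lambda>n. real n powr (-(real L + 1 / 2))) \<Longrightarrow> acoeff_expandable L f"
  unfolding acoeff_expandable_def by (intro exI[of _ "\<lambda>_. 0"]) simp

lemma acoeff_expandable_add: assumes "acoeff_expandable L f" "acoeff_expandable L g" shows "acoeff_expandable L (\<lambda>n. f n + g n)"
proof -
  obtain c where c: "(\<lambda>n. f n - (\<Sum>l=2..L. c l * acoeff l n)) \<in> O(\<lambda>n. real n powr (-(real L + 1 / 2)))"
    using assms(1) unfolding acoeff_expandable_def by blast
  obtain d where d: "(\<lambda>n. g n - (\<Sum>l=2..L. d l * acoeff l n)) \<in> O(\<lambda>n. real n powr (-(real L + 1 / 2)))"
    using assms(2) unfolding acoeff_expandable_def by blast
  show ?thesis unfolding acoeff_expandable_def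
    by (intro exI[of _ "\<lambda>l. c l + d l"]) (use sum_in_bigo(1)[OF c d] in \<open>simp add: algebra_simps sum.distrib\<close>)
qed

lemma acoeff_expandable_cmult: assumes "acoeff_expandable L f" shows "acoeff_expandable L (\<lambda>n. a * f n)"
proof -
  obtain c where c: "(\<lambda>n. f n - (\<Sum>l=2..L. c l * acoeff l n)) \<in> O(\<lambda>n. real n powr (-(real L + 1 / 2)))"
    using assms(1) unfolding acoeff_expandable_def by blast
  have "(\<lambda>n. a * (f n - (\<Sum>l=2..L. c l * acoeff l n))) \<in> O(\<lambda>n. real n powr (-(real L + 1 / 2)))"
    using c by (cases "a = 0") simp_all
  thus ?thesis unfolding acoeff_expandable_def by (intro exI[of _ "\<lambda>l. a * c l"]) (simp add: algebra_simps sum_distrib_left)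
qed

lemma acoeff_expandable_sum: "finite A \<Longrightarrow> (\<And>i. i \<in> A \<Longrightarrow> acoeff_expandable L (f i)) \<Longrightarrow> acoeff_expandable L (\<lambda>n. \<Sum>i\<in>A. f i n)"
  by (induction A rule: finite_induct) (auto intro: acoeff_expandable_add acoeff_expandable_bigo)

lemma acoeff_expandable_cong:
  assumes "acoeff_expandable L f" "\<And>n. n > 0 \<Longrightarrow> f n = g n" shows "acoeff_expandable L g"
proof -
  obtain c where c: "(\<lambda>n. f n - (\<Sum>l=2..L. c l * acoeff l n)) \<in> O(\<lambda>n. real n powr (-(real L + 1 / 2)))"
    using assms(1) unfolding acoeff_expandable_def by blast
  show ?thesis unfolding acoeff_expandable_def
    by (rule exI[of _ c], rule landau_o.big.in_cong[THEN iffD1, OF _ c])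
       (use assms(2) in \<open>auto intro!: eventually_mono[OF eventually_gt_at_top[of 0]]\<close>)
qed

lemma acoeff_expandable_acoeff: assumes "l \<ge> 2" shows "acoeff_expandable L (acoeff l)"
proof (cases "l \<le> L")
  case True
  have "(\<Sum>i=2..L. (if i = l then 1 else 0) * acoeff i n) = acoeff l n" for n
  proof -
    have "(\<Sum>i=2..L. (if i = l then 1 else 0) * acoeff i n) = (\<Sum>i\<in>{l}. acoeff i n)"
      using True assms by (intro sum.mono_neutral_cong_right) auto
    thus ?thesis by simp
  qed
  thus ?thesis unfolding acoeff_expandable_def by (intro exI[of _ "\<lambda>i. if i = l then 1 else 0"]) simp
next
  case False
  have "(\<lambda>n. real n powr (-(real l - 1 / 2))) \<in> O(\<lambda>n. real n powr (-(real L + 1 / 2)))"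
    using False by (intro powr_bigo_nat) auto
  with acoeff_bigo[of l] assms show ?thesis by (intro acoeff_expandable_bigo) (auto intro: landau_o.big_trans)
qed

text \<open>Dividing \<open>acoeff_Suc\<close> by n expresses acoeff i / n through acoeff (i+1) and
  acoeff (i+1) / n. Each round gains a power of n, until i reaches L and the quotient is within the
  error.\<close>

lemma acoeff_expandable_acoeff_div: "i \<ge> 1 \<Longrightarrow> acoeff_expandable L (\<lambda>n. acoeff i n / real n)"
proof (induction "L - i" arbitrary: i)
  case 0
  have "(\<lambda>n. acoeff i n / real n) \<in> O(\<lambda>n. real n powr (-(real i - 1 / 2) - 1))"
    using 0 by (intro bigo_div_n acoeff_bigo) auto
  moreover have "(\<lambda>n. real n powr (-(real i - 1 / 2) - 1)) \<in> O(\<lambda>n. real n powr (-(real L + 1 / 2)))"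
    using 0 by (intro powr_bigo_nat) auto
  ultimately show ?case by (intro acoeff_expandable_bigo) (rule landau_o.big_trans)
next
  case (Suc k)
  have IH: "acoeff_expandable L (\<lambda>n. acoeff (Suc i) n / real n)" using Suc.hyps by (intro Suc.hyps(1)) auto
  let ?c = "real i - 1 / 2"
  have c: "?c > 0" using Suc.prems by simp
  have "acoeff_expandable L (\<lambda>n. (- 1 / ?c) * acoeff (Suc i) n + acoeff (Suc i) n / real n)"
    using Suc.prems by (intro acoeff_expandable_add acoeff_expandable_cmult acoeff_expandable_acoeff IH) auto
  thus ?case
  proof (rule acoeff_expandable_cong)
    fix n :: nat assume n: "n > 0"
    have "?c * acoeff i n = - (acoeff (Suc i) n * (real n - ?c))" using acoeff_Suc[of i n] by (simp add: algebra_simps)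
    hence "acoeff i n = - (acoeff (Suc i) n * (real n - ?c)) / ?c" using c by (simp add: field_simps)
    moreover have "(- 1 / c) * a + a / N = - (a * (N - c)) / c / N" if "c > 0" "N > 0" for c a N :: real
      using that by (simp add: field_simps)
    ultimately show "(- 1 / ?c) * acoeff (Suc i) n + acoeff (Suc i) n / real n = acoeff i n / real n"
      using n c by (simp only: of_nat_0_less_iff)
  qed
qed

lemma acoeff_expandable_div: assumes "acoeff_expandable L f" shows "acoeff_expandable L (\<lambda>n. f n / real n)"
proof -
  obtain c where c: "(\<lambda>n. f n - (\<Sum>l=2..L. c l * acoeff l n)) \<in> O(\<lambda>n. real n powr (-(real L + 1 / 2)))"
    using assms(1) unfolding acoeff_expandable_def by blast
  have "(\<lambda>n. (f n - (\<Sum>l=2..L. c l * acoeff l n)) / real n) \<in> O(\<lambda>n. real n powr (-(real L + 1 / 2) - 1))"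
    by (rule bigo_div_n[OF c])
  moreover have "(\<lambda>n. real n powr (-(real L + 1 / 2) - 1)) \<in> O(\<lambda>n. real n powr (-(real L + 1 / 2)))" by (intro powr_bigo_nat) auto
  ultimately have "acoeff_expandable L (\<lambda>n. (f n - (\<Sum>l=2..L. c l * acoeff l n)) / real n)" by (intro acoeff_expandable_bigo) (rule landau_o.big_trans)
  moreover have "acoeff_expandable L (\<lambda>n. \<Sum>l=2..L. c l * (acoeff l n / real n))" by (intro acoeff_expandable_sum acoeff_expandable_cmult acoeff_expandable_acoeff_div) auto
  ultimately have "acoeff_expandable L (\<lambda>n. (f n - (\<Sum>l=2..L. c l * acoeff l n)) / real n + (\<Sum>l=2..L. c l * (acoeff l n / real n)))" by (rule acoeff_expandable_add)
  thus ?thesis by (rule acoeff_expandable_cong) (simp add: diff_divide_distrib sum_divide_distrib)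
qed

lemma acoeff_expandable_acoeff_1_power: "acoeff_expandable L (\<lambda>n. acoeff 1 n / real n ^ Suc k)"
proof (induction k)
  case 0 show ?case using acoeff_expandable_acoeff_div[of 1 L] by simp
next
  case (Suc k) show ?case using acoeff_expandable_div[OF Suc] by (rule acoeff_expandable_cong) simp
qed

text \<open>The odd exponents are written as 2 i + 1. If the leading coefficient vanished,
  \<open>acoeff 1\<close> would be O(n^(-3/2)), against the lower bound in
  \<open>acoeff_1_sq\<close>.\<close>

lemma acoeff_1_expansion:
  "\<exists>e. e 0 \<noteq> 0 \<and> (\<lambda>n. acoeff 1 n - (\<Sum>i<Suc L. e i * real n powr (-(real i + 1 / 2)))) \<in> O(\<lambda>n. real n powr (-(real (Suc L) + 1 / 2)))"
proof -
  obtain c where c: "(\<lambda>n. acoeff 1 n - (\<Sum>j | j \<le> 2 * Suc L \<and> odd j. c j * real n powr (-(real j / 2)))) \<in> O(\<lambda>n. real n powr (-((real (2 * Suc L) + 1) / 2)))"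
    using half_int_expansion_acoeff_1[of "2 * Suc L"] unfolding half_int_expansion_def by blast
  define e where "e i = c (2 * i + 1)" for i
  have "(\<Sum>j | j \<le> 2 * Suc L \<and> odd j. c j * real n powr (-(real j / 2))) = (\<Sum>i<Suc L. e i * real n powr (-(real i + 1 / 2)))" for n
  proof (rule sum.reindex_bij_witness[of _ "\<lambda>i. 2 * i + 1" "\<lambda>j. j div 2"])
    fix j assume "j \<in> {j. j \<le> 2 * Suc L \<and> odd j}"
    then obtain i where j: "j = 2 * i + 1" by (auto elim: oddE)
    have "-(real j / 2) = -(real i + 1 / 2)" by (simp add: j add_divide_distrib)
    moreover have "e (j div 2) = c j" "real (j div 2) = real i" by (simp_all add: e_def j)
    ultimately show "e (j div 2) * real n powr (-(real (j div 2) + 1 / 2)) = c j * real n powr (-(real j / 2))" by (simp only:)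
  qed (auto, presburger)
  moreover have "(real (2 * Suc L) + 1) / 2 = real (Suc L) + 1 / 2" by (simp add: field_simps)
  ultimately have E: "(\<lambda>n. acoeff 1 n - (\<Sum>i<Suc L. e i * real n powr (-(real i + 1 / 2)))) \<in> O(\<lambda>n. real n powr (-(real (Suc L) + 1 / 2)))"
    using c by (simp only:)
  have "e 0 \<noteq> 0"
  proof
    assume e0: "e 0 = 0"
    have "(\<lambda>n. \<Sum>i<Suc L. e i * real n powr (-(real i + 1 / 2))) \<in> O(\<lambda>n. real n powr (-(3 / 2)))"
    proof (rule big_sum_in_bigo)
      fix i assume "i \<in> {..<Suc L}"
      show "(\<lambda>n. e i * real n powr (-(real i + 1 / 2))) \<in> O(\<lambda>n. real n powr (-(3 / 2)))"
      proof (cases "i = 0")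
        case False
        hence "(\<lambda>n. real n powr (-(real i + 1 / 2))) \<in> O(\<lambda>n. real n powr (-(3 / 2)))" by (intro powr_bigo_nat) auto
        thus ?thesis by (cases "e i = 0") simp_all
      qed (simp add: e0)
    qed
    moreover have "(\<lambda>n. acoeff 1 n - (\<Sum>i<Suc L. e i * real n powr (-(real i + 1 / 2)))) \<in> O(\<lambda>n. real n powr (-(3 / 2)))"
      by (rule landau_o.big_trans[OF E]) (rule powr_bigo_nat, simp)
    ultimately have "acoeff 1 \<in> O(\<lambda>n. real n powr (-(3 / 2)))"
      using sum_in_bigo(1) by fastforce
    then obtain C where C: "C > 0" "eventually (\<lambda>n. norm (acoeff 1 n) \<le> C * norm (real n powr (-(3 / 2)))) sequentially"
      by (elim landau_o.bigE) auto
    have "eventually (\<lambda>n::nat. n > nat \<lceil>4 * C\<^sup>2\<rceil> \<and> n \<ge> 1) sequentially"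
      by (intro eventually_conj eventually_gt_at_top eventually_ge_at_top)
    from eventually_conj[OF C(2) this] obtain n where n: "norm (acoeff 1 n) \<le> C * norm (real n powr (-(3 / 2)))" "n > nat \<lceil>4 * C\<^sup>2\<rceil>" "n \<ge> 1"
      using eventually_happens'[OF sequentially_bot] by blast
    have n4: "real n > 4 * C\<^sup>2" using n(2) by linarith
    have "(acoeff 1 n)\<^sup>2 \<le> (C * real n powr (-(3 / 2)))\<^sup>2"
      using n(1) acoeff_1_pos[of n] by (intro power_mono) auto
    also have "\<dots> = C\<^sup>2 * (real n powr (-(3 / 2)) * real n powr (-(3 / 2)))" by (simp add: power2_eq_square mult_ac)
    also have "real n powr (-(3 / 2)) * real n powr (-(3 / 2)) = real n powr (-3)" by (simp flip: powr_add)
    also have "\<dots> = 1 / real n ^ 3" using n(3) by (simp add: powr_minus powr_numeral divide_inverse)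
    finally have "(acoeff 1 n)\<^sup>2 * real n \<le> C\<^sup>2 * (1 / real n ^ 3) * real n" by (intro mult_right_mono) auto
    also have "\<dots> = C\<^sup>2 / real n / real n" using n(3) by (simp add: power3_eq_cube)
    also have "\<dots> \<le> C\<^sup>2 / real n / 1" using n(3) C by (intro divide_left_mono) auto
    also have "\<dots> < 1 / 4" using n4 n(3) C by (simp add: field_simps)
    finally show False using acoeff_1_sq(2)[OF n(3)] by simp
  qed
  with E show ?thesis by blast
qed

lemma sum_split_0: "(\<Sum>i<Suc L. h i) = h 0 + (\<Sum>i\<in>{1..<Suc L}. h i :: real)"
proof -
  have "{..<Suc L} = insert 0 {1..<Suc L}" by auto
  thus ?thesis by (simp only:) (rule sum.insert, auto)
qed

text \<open>Triangular inversion: the expansion of \<open>acoeff 1\<close>, divided by n^(k+1),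
  starts with a nonzero multiple of n^(-(k + 3/2)). Its left side is expandable by
  \<open>acoeff_expandable_acoeff_1_power\<close>, its higher powers by induction, so one can solve
  for the first power.\<close>

lemma acoeff_expandable_powr: "acoeff_expandable L (\<lambda>n. real n powr (-(real (Suc k) + 1 / 2)))"
proof (induction "L - k" arbitrary: k rule: less_induct)
  case less
  show ?case
  proof (cases "k \<ge> L")
    case True
    thus ?thesis by (intro acoeff_expandable_bigo powr_bigo_nat) auto
  next
    case False
    obtain e where e: "e 0 \<noteq> 0" "(\<lambda>n. acoeff 1 n - (\<Sum>i<Suc L. e i * real n powr (-(real i + 1 / 2)))) \<in> O(\<lambda>n. real n powr (-(real (Suc L) + 1 / 2)))"
      using acoeff_1_expansion by blast
    let ?r = "\<lambda>n. acoeff 1 n - (\<Sum>i<Suc L. e i * real n powr (-(real i + 1 / 2)))"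
    have shift: "real n powr (-(real i + 1 / 2)) / real n ^ Suc k = real n powr (-(real (Suc (k + i)) + 1 / 2))" if "n > 0" for n i
    proof -
      have "-(real (Suc (k + i)) + 1 / 2) = -(real i + 1 / 2) - real (Suc k)" by simp
      thus ?thesis using that by (simp only: powr_diff powr_realpow of_nat_0_less_iff)
    qed
    have "(\<lambda>n. ?r n * (1 / real n ^ Suc k)) \<in> O(\<lambda>n. real n powr (-(real (Suc L) + 1 / 2)) * 1)"
      by (intro landau_o.big.mult e(2) bigoI[where c = 1] eventually_mono[OF eventually_gt_at_top[of 0]]) (auto simp: field_simps simp del: power_Suc)
    also have "(\<lambda>n. real n powr (-(real (Suc L) + 1 / 2)) * 1) \<in> O(\<lambda>n. real n powr (-(real L + 1 / 2)))"
      unfolding mult_1_right by (rule powr_bigo_nat) simp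
    finally have 1: "acoeff_expandable L (\<lambda>n. ?r n * (1 / real n ^ Suc k))" by (rule acoeff_expandable_bigo)
    have 2: "acoeff_expandable L (\<lambda>n. \<Sum>i\<in>{1..<Suc L}. e i * real n powr (-(real (Suc (k + i)) + 1 / 2)))"
      using False by (intro acoeff_expandable_sum acoeff_expandable_cmult less) auto
    have "acoeff_expandable L (\<lambda>n. (1 / e 0) * (acoeff 1 n / real n ^ Suc k + (- 1) * (?r n * (1 / real n ^ Suc k)) + (- 1) * (\<Sum>i\<in>{1..<Suc L}. e i * real n powr (-(real (Suc (k + i)) + 1 / 2)))))"
      by (intro acoeff_expandable_cmult acoeff_expandable_add acoeff_expandable_acoeff_1_power 1 2)
    thus ?thesis
    proof (rule acoeff_expandable_cong)
      fix n :: nat assume n: "n > 0"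
      have "acoeff 1 n / real n ^ Suc k + (- 1) * (?r n * (1 / real n ^ Suc k)) = (\<Sum>i<Suc L. e i * real n powr (-(real i + 1 / 2))) / real n ^ Suc k"
        by (simp add: diff_divide_distrib del: power_Suc)
      also have "\<dots> = (\<Sum>i<Suc L. e i * real n powr (-(real (Suc (k + i)) + 1 / 2)))"
        unfolding sum_divide_distrib by (intro sum.cong refl) (simp only: shift[OF n, symmetric] times_divide_eq_right)
      also have "\<dots> = e 0 * real n powr (-(real (Suc (k + 0)) + 1 / 2)) + (\<Sum>i\<in>{1..<Suc L}. e i * real n powr (-(real (Suc (k + i)) + 1 / 2)))"
        by (rule sum_split_0)
      finally have X: "acoeff 1 n / real n ^ Suc k + (- 1) * (?r n * (1 / real n ^ Suc k)) =
         e 0 * real n powr (-(real (Suc (k + 0)) + 1 / 2)) + (\<Sum>i\<in>{1..<Suc L}. e i * real n powr (-(real (Suc (k + i)) + 1 / 2)))" .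
      have "(1 / c) * (c * b + s + (- 1) * s) = b" if "c \<noteq> 0" for b c s :: real using that by simp
      from this[OF e(1)] show "(1 / e 0) * (acoeff 1 n / real n ^ Suc k + (- 1) * (?r n * (1 / real n ^ Suc k)) + (- 1) * (\<Sum>i\<in>{1..<Suc L}. e i * real n powr (-(real (Suc (k + i)) + 1 / 2)))) = real n powr (-(real (Suc k) + 1 / 2))"
        unfolding X by (simp only: add_0_right)
    qed
  qed
qed

lemma bigo_imp_decays:
  assumes "f \<in> O(\<lambda>n. real n powr (- \<beta>))" "\<beta> \<ge> 0" shows "decays \<beta> (Abs_fps f)"
proof -
  obtain c where c: "c > 0" "eventually (\<lambda>n. norm (f n) \<le> c * norm (real n powr (- \<beta>))) sequentially"
    using assms(1) by (elim landau_o.bigE) auto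
  then obtain N where N: "\<And>n. n \<ge> N \<Longrightarrow> \<bar>f n\<bar> \<le> c * real n powr (- \<beta>)" unfolding eventually_sequentially by auto
  define A where "A = (\<Sum>n\<le>N. \<bar>f n\<bar> / wt \<beta> n)"
  have A: "\<bar>f n\<bar> \<le> A * wt \<beta> n" if "n \<le> N" for n
  proof -
    have "\<bar>f n\<bar> / wt \<beta> n \<le> A" unfolding A_def using that by (intro member_le_sum) (auto intro!: divide_nonneg_nonneg)
    thus ?thesis using wt_pos[of \<beta> n] by (simp only: pos_divide_le_eq)
  qed
  have A0: "A \<ge> 0" unfolding A_def by (intro sum_nonneg divide_nonneg_nonneg) auto
  show ?thesis
  proof (rule decaysI[where C = "A + c * 2 powr \<beta>"])
    fix n
    have w: "wt \<beta> n \<ge> 0" by simp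
    show "\<bar>Abs_fps f $ n\<bar> \<le> (A + c * 2 powr \<beta>) * wt \<beta> n"
    proof (cases "n \<le> N")
      case True
      have "A * wt \<beta> n \<le> (A + c * 2 powr \<beta>) * wt \<beta> n" using c(1) by (intro mult_right_mono) auto
      from order_trans[OF A[OF True] this] show ?thesis by (simp only: fps_nth_Abs_fps)
    next
      case False
      hence n: "n \<ge> 1" by simp
      have "((real n + 1) / 2) powr (- \<beta>) \<ge> real n powr (- \<beta>)" using n assms(2) by (intro powr_mono2') auto
      moreover have "((real n + 1) / 2) powr (- \<beta>) = 2 powr \<beta> * wt \<beta> n"
      proof -
        have "((real n + 1) / 2) powr (- \<beta>) = (real n + 1) powr (- \<beta>) / 2 powr (- \<beta>)" by (rule powr_divide)
        moreover have "inverse (2 powr (- \<beta>)) = 2 powr \<beta>" by (simp only: powr_minus inverse_inverse_eq)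
        ultimately show ?thesis by (simp only: wt_def divide_inverse mult.commute)
      qed
      ultimately have "c * real n powr (- \<beta>) \<le> c * (2 powr \<beta> * wt \<beta> n)" using c(1) by (intro mult_left_mono) auto
      also have "\<dots> \<le> (A + c * 2 powr \<beta>) * wt \<beta> n" using A0 by (simp add: distrib_right)
      finally show ?thesis using N[of n] False by simp
    qed
  qed
qed

theorem coefficient_expansion:
  fixes p u :: "nat \<Rightarrow> real"
  assumes ode: "fps_deriv (Abs_fps p) = Abs_fps (\<lambda>n. u (Suc n)) * Abs_fps p"
    and u: "half_int_expansion r (\<lambda>n. u n - 1 / 2)"
  shows "\<exists>\<nu>. (\<lambda>n. p n - (\<Sum>j=1..r div 2 + 1. \<nu> j * acoeff j n))
           \<in> O(\<lambda>n. ln (real n) ^ (if odd r then 1 else 0) / real n powr (real (r + 2) / 2))"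
proof -
  define \<beta> where "\<beta> = (real r + 3) / 2"
  \<comment> \<open>Large enough that the error n^(-(L + 1/2)) of \<open>acoeff_expandable\<close>
    is within n^(-\<beta>).\<close>
  define L where "L = (r + 3) div 2"
  have \<beta>1: "\<beta> > 1" by (simp add: \<beta>_def)
  have L\<beta>: "\<beta> \<le> real L + 1 / 2"
  proof -
    have "r + 3 \<le> 2 * L + 1" unfolding L_def by presburger
    hence "real (r + 3) \<le> real (2 * L + 1)" by (simp only: of_nat_le_iff)
    thus ?thesis by (simp add: \<beta>_def)
  qed
  \<comment> \<open>At n = 0 division by zero gives 0; this fixes an additive constant in the
    exponent that \<open>c\<close> absorbs later.\<close>
  define hc where "hc n = (u n - 1 / 2) / real n" for n
  have "\<exists>d. (\<lambda>n. hc n - (\<Sum>l=2..L. d l * acoeff l n)) \<in> O(\<lambda>n. real n powr (- \<beta>))"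
  proof -
    obtain c where c: "(\<lambda>n. (u n - 1 / 2) - (\<Sum>j | j \<le> r \<and> odd j. c j * real n powr (-(real j / 2)))) \<in> O(\<lambda>n. real n powr (-((real r + 1) / 2)))"
      using u unfolding half_int_expansion_def by blast
    have "acoeff_expandable L (\<lambda>n. \<Sum>j | j \<le> r \<and> odd j. c j * (real n powr (-(real j / 2)) / real n))"
    proof (intro acoeff_expandable_sum acoeff_expandable_cmult)
      fix j assume "j \<in> {j. j \<le> r \<and> odd j}"
      then obtain k where k: "j = 2 * k + 1" by (auto elim: oddE)
      have e: "-(real j / 2) - 1 = -(real (Suc k) + 1 / 2)" by (simp add: k field_simps)
      show "acoeff_expandable L (\<lambda>n. real n powr (-(real j / 2)) / real n)"
        by (rule acoeff_expandable_cong[OF acoeff_expandable_powr[of L k]]) (simp only: e[symmetric] powr_diff powr_one of_nat_0_le_iff)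
    qed simp
    then obtain d where d: "(\<lambda>n. (\<Sum>j | j \<le> r \<and> odd j. c j * (real n powr (-(real j / 2)) / real n)) - (\<Sum>l=2..L. d l * acoeff l n)) \<in> O(\<lambda>n. real n powr (-(real L + 1 / 2)))"
      unfolding acoeff_expandable_def by blast
    have d': "(\<lambda>n. (\<Sum>j | j \<le> r \<and> odd j. c j * (real n powr (-(real j / 2)) / real n)) - (\<Sum>l=2..L. d l * acoeff l n)) \<in> O(\<lambda>n. real n powr (- \<beta>))"
      by (rule landau_o.big_trans[OF d powr_bigo_nat]) (use L\<beta> in simp)
    have "-((real r + 1) / 2) - 1 = - \<beta>" by (simp add: \<beta>_def field_simps)
    with bigo_div_n[OF c] have c': "(\<lambda>n. ((u n - 1 / 2) - (\<Sum>j | j \<le> r \<and> odd j. c j * real n powr (-(real j / 2)))) / real n) \<in> O(\<lambda>n. real n powr (- \<beta>))"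
      by (simp only:)
    have "(\<lambda>n. ((u n - 1 / 2) - (\<Sum>j | j \<le> r \<and> odd j. c j * real n powr (-(real j / 2)))) / real n +
       ((\<Sum>j | j \<le> r \<and> odd j. c j * (real n powr (-(real j / 2)) / real n)) - (\<Sum>l=2..L. d l * acoeff l n))) \<in> O(\<lambda>n. real n powr (- \<beta>))"
      using c' d' by (rule sum_in_bigo(1))
    also have "(\<lambda>n. ((u n - 1 / 2) - (\<Sum>j | j \<le> r \<and> odd j. c j * real n powr (-(real j / 2)))) / real n +
       ((\<Sum>j | j \<le> r \<and> odd j. c j * (real n powr (-(real j / 2)) / real n)) - (\<Sum>l=2..L. d l * acoeff l n))) = (\<lambda>n. hc n - (\<Sum>l=2..L. d l * acoeff l n))"
    proof (rule ext)
      fix n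
      have s: "(\<Sum>j | j \<le> r \<and> odd j. c j * (real n powr (-(real j / 2)) / real n)) = (\<Sum>j | j \<le> r \<and> odd j. c j * real n powr (-(real j / 2))) / real n"
        by (simp add: sum_divide_distrib)
      have "(a - s) / N + (s / N - q) = a / N - q" for a s N q :: real by (simp add: diff_divide_distrib)
      thus "((u n - 1 / 2) - (\<Sum>j | j \<le> r \<and> odd j. c j * real n powr (-(real j / 2)))) / real n +
       ((\<Sum>j | j \<le> r \<and> odd j. c j * (real n powr (-(real j / 2)) / real n)) - (\<Sum>l=2..L. d l * acoeff l n)) = hc n - (\<Sum>l=2..L. d l * acoeff l n)"
        unfolding s hc_def .
    qed
    finally show ?thesis by blast
  qed
  then obtain d where d: "(\<lambda>n. hc n - (\<Sum>l=2..L. d l * acoeff l n)) \<in> O(\<lambda>n. real n powr (- \<beta>))" by blast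
  define y where "y = binom_series (1 / 2)"
  define P where "P = (\<Sum>l=2..L. fps_const (d l) * (1 - fps_X) ^ (l - 2))"
  define H where "H = Abs_fps hc"
  define E where "E = H - y * P"
  \<comment> \<open>Uses (1-s)^(l - 3/2) = y (1-s)^(l - 2), valid with a natural exponent because l
    >= 2.\<close>
  have yP: "(y * P) $ n = (\<Sum>l=2..L. d l * acoeff l n)" for n
  proof -
    have "y * (fps_const (d l) * (1 - fps_X) ^ (l - 2)) = fps_const (d l) * binom_series (real l - 3 / 2)" if "l \<in> {2..L}" for l
    proof -
      have "real l - 3 / 2 = 1 / 2 + real (l - 2)" using that by (simp add: of_nat_diff)
      hence "binom_series (real l - 3 / 2) = y * (1 - fps_X) ^ (l - 2)" by (simp only: binom_series_add binom_series_nat y_def)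
      thus ?thesis by (simp only: mult_ac)
    qed
    hence "y * P = (\<Sum>l=2..L. fps_const (d l) * binom_series (real l - 3 / 2))"
      unfolding P_def sum_distrib_left by (intro sum.cong refl)
    thus ?thesis by (simp add: fps_sum_nth binom_series_acoeff)
  qed
  have E: "decays \<beta> E"
  proof -
    have "E = Abs_fps (\<lambda>n. hc n - (\<Sum>l=2..L. d l * acoeff l n))" by (rule fps_ext) (simp add: E_def H_def yP)
    thus ?thesis using bigo_imp_decays[OF d] \<beta>1 by simp
  qed
  have P: "decays b P" if "b > 1" for b
    unfolding P_def using that by (intro decays_sum decays_cmult decays_power decays_1_minus_X) auto
  have y: "decays (3 / 2) y"
  proof -
    obtain C where "\<And>n. \<bar>acoeff 2 n\<bar> \<le> C * wt (real 2 - 1 / 2) n" using acoeff_bound[of 2] by auto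
    thus ?thesis by (intro decaysI[where C = C]) (simp add: y_def binom_series_acoeff[of 2, simplified])
  qed
  \<comment> \<open>Only the rate 3/2 is available for y P; the rate \<beta> holds for its square,
    where y y = 1 - X.\<close>
  have yPd: "decays (3 / 2) (y * P)" by (intro decays_mult y P) auto
  have y2: "y * y = 1 - fps_X" by (simp add: y_def binom_series_add[symmetric] binom_series_1[symmetric])
  have yP2: "(y * P)\<^sup>2 = (1 - fps_X) * P\<^sup>2" by (simp add: power2_eq_square y2[symmetric] mult_ac)
  have X: "decays \<beta> ((y * P)\<^sup>2)" unfolding yP2 unfolding power2_eq_square
    by (intro decays_mult[OF \<beta>1] decays_1_minus_X P \<beta>1)
  define C where "C = fps_subst_series (\<lambda>k. 1 / fact (2 * k)) ((y * P)\<^sup>2)"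
  define S where "S = P * fps_subst_series (\<lambda>k. 1 / fact (2 * k + 1)) ((y * P)\<^sup>2)"
  have g: "\<bar>1 / fact (2 * k) :: real\<bar> \<le> 1 / fact k" "\<bar>1 / fact (2 * k + 1) :: real\<bar> \<le> 1 / fact k" for k
    by (simp_all add: frac_le fact_mono del: fact_Suc)
  have C: "decays \<beta> C" unfolding C_def by (rule fps_subst_series_decays[OF \<beta>1 X g(1)])
  have S: "decays \<beta> S" unfolding S_def by (intro decays_mult[OF \<beta>1] P \<beta>1 fps_subst_series_decays[OF \<beta>1 X g(2)])
  have CS: "exp_fps (y * P) = C + y * S"
    unfolding C_def S_def using exp_fps_even_odd[OF _ yPd \<beta>1 X] by (simp add: mult.assoc)
  define p' where "p' = Abs_fps p"
  have yinv: "binom_series (- 1 / 2) * y = 1" by (simp add: y_def binom_series_add[symmetric])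
  have H': "fps_deriv H = Abs_fps (\<lambda>n. u (Suc n)) - fps_const (1 / 2) * Abs_fps (\<lambda>_. 1)"
    by (rule fps_ext) (simp add: H_def hc_def del: of_nat_Suc)
  \<comment> \<open>The derivative of y contributes -1/2 times the geometric series, which removes
    the constant 1/2 from \<open>u\<close>.\<close>
  have "fps_deriv (p' * y) = fps_deriv H * (p' * y)"
    unfolding H' fps_deriv_mult y_def binom_series_half_deriv ode[folded p'_def] by (simp add: algebra_simps)
  moreover have "fps_deriv (exp_fps (y * P) * exp_fps E) = fps_deriv H * (exp_fps (y * P) * exp_fps E)"
  proof -
    have "fps_deriv H = fps_deriv (y * P) + fps_deriv E" unfolding E_def fps_deriv_sub by simp
    moreover have "fps_deriv (exp_fps (y * P)) = fps_deriv (y * P) * exp_fps (y * P)" by (rule exp_fps_deriv[OF _ yPd]) simp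
    moreover have "fps_deriv (exp_fps E) = fps_deriv E * exp_fps E" by (rule exp_fps_deriv[OF \<beta>1 E])
    ultimately show ?thesis by (simp only: fps_deriv_mult distrib_left distrib_right mult_ac)
  qed
  moreover have "(exp_fps (y * P) * exp_fps E) $ 0 \<noteq> 0" using exp_fps_0[of "y * P"] exp_fps_0[of E] by simp
  ultimately obtain c where c: "p' * y = fps_const c * (exp_fps (y * P) * exp_fps E)" using fps_linear_ODE_unique by blast
  define f where "f = fps_const c * (C * exp_fps E)"
  define g where "g = fps_const c * (S * exp_fps E)"
  have EE: "decays \<beta> (exp_fps E)" unfolding exp_fps_def by (rule fps_subst_series_decays[OF \<beta>1 E]) simp
  have f: "decays \<beta> f" unfolding f_def by (intro decays_cmult decays_mult[OF \<beta>1] C EE)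
  have g: "decays \<beta> g" unfolding g_def by (intro decays_cmult decays_mult[OF \<beta>1] S EE)
  \<comment> \<open>In the part containing y S the inverse square root cancels, so only f is left
    multiplied by it.\<close>
  have "p' = binom_series (- 1 / 2) * (p' * y)" using yinv by (metis mult.commute mult.left_commute mult.right_neutral)
  also have "\<dots> = binom_series (- 1 / 2) * f + (binom_series (- 1 / 2) * y) * g" unfolding c CS f_def g_def by (simp add: algebra_simps)
  finally have pfg: "p' = binom_series (- 1 / 2) * f + g" unfolding yinv by simp
  obtain \<nu> Q where Q: "\<And>n. n \<ge> 2 \<Longrightarrow> \<bar>(binom_series (- 1 / 2) * f) $ n - (\<Sum>j=1..r div 2 + 1. \<nu> j * acoeff j n)\<bar>
           \<le> Q * (1 + (if odd r then ln (real n + 1) else 0)) * wt ((real r + 2) / 2) n"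
    using half_power_transfer[OF f[unfolded \<beta>_def]] by blast
  obtain G where G: "G \<ge> 0" "\<And>n. \<bar>g $ n\<bar> \<le> G * wt \<beta> n" using g unfolding decays_def by blast
  show ?thesis
  proof (rule exI[of _ \<nu>], rule bigoI[where c = "(\<bar>Q\<bar> + G) * 3"], rule eventually_mono[OF eventually_ge_at_top[of 3]])
    fix n :: nat assume n: "3 \<le> n"
    define l where "l = (1 + (if odd r then ln (real n + 1) else 0))"
    have l1: "l \<ge> 1" by (simp add: l_def)
    have ln1: "ln (real n) \<ge> 1"
    proof -
      have "exp 1 \<le> real n" using exp_le n by linarith
      thus ?thesis using n by (subst ln_ge_iff) auto
    qed
    \<comment> \<open>For n >= 3 one has n + 1 <= n^2, hence ln (n + 1) <= 2 ln n, and also 1 <= ln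
      n.\<close>
    have l3: "l \<le> 3 * ln (real n) ^ (if odd r then 1 else 0)"
    proof (cases "odd r")
      case True
      have "3 * real n \<le> real n * real n" using n by (intro mult_right_mono) auto
      hence "real n + 1 \<le> real n * real n" using n by linarith
      hence "ln (real n + 1) \<le> ln (real n * real n)" using n by (subst ln_le_cancel_iff) auto
      also have "\<dots> = 2 * ln (real n)" using n by (simp add: ln_mult)
      finally show ?thesis using True ln1 by (simp add: l_def)
    qed (simp add: l_def)
    have "\<bar>p n - (\<Sum>j=1..r div 2 + 1. \<nu> j * acoeff j n)\<bar> = \<bar>((binom_series (- 1 / 2) * f) $ n - (\<Sum>j=1..r div 2 + 1. \<nu> j * acoeff j n)) + g $ n\<bar>"
    proof -
      have "p n = (binom_series (- 1 / 2) * f) $ n + g $ n" using arg_cong[OF pfg, of "\<lambda>F. F $ n"] by (simp add: p'_def)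
      moreover have "x - s = (a - s) + b" if "x = a + b" for x s a b :: real using that by simp
      ultimately show ?thesis by (intro arg_cong[where f = abs]) blast
    qed
    also have "\<dots> \<le> Q * l * wt ((real r + 2) / 2) n + G * wt \<beta> n"
      using Q[of n] G(2)[of n] n unfolding l_def by linarith
    also have "\<dots> \<le> \<bar>Q\<bar> * l * wt ((real r + 2) / 2) n + G * l * wt ((real r + 2) / 2) n"
    proof (rule add_mono)
      show "Q * l * wt ((real r + 2) / 2) n \<le> \<bar>Q\<bar> * l * wt ((real r + 2) / 2) n" using l1 by (intro mult_right_mono) auto
      have "wt \<beta> n \<le> wt ((real r + 2) / 2) n" by (rule wt_mono) (simp add: \<beta>_def)
      hence "G * wt \<beta> n \<le> (G * 1) * wt ((real r + 2) / 2) n" using G(1) by (simp add: mult_left_mono)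
      also have "\<dots> \<le> (G * l) * wt ((real r + 2) / 2) n" using G(1) l1 by (intro mult_right_mono mult_left_mono) auto
      finally show "G * wt \<beta> n \<le> G * l * wt ((real r + 2) / 2) n" .
    qed
    also have "\<dots> = (\<bar>Q\<bar> + G) * (l * wt ((real r + 2) / 2) n)" by (simp add: algebra_simps)
    also have "\<dots> \<le> (\<bar>Q\<bar> + G) * ((3 * ln (real n) ^ (if odd r then 1 else 0)) * (1 / real n powr (real (r + 2) / 2)))"
    proof (intro mult_left_mono mult_mono l3)
      have "wt ((real r + 2) / 2) n \<le> real n powr (-((real r + 2) / 2))" unfolding wt_def using n by (intro powr_mono2') auto
      also have "\<dots> = 1 / real n powr (real (r + 2) / 2)" by (simp only: powr_minus inverse_eq_divide of_nat_add of_nat_numeral)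
      finally show "wt ((real r + 2) / 2) n \<le> 1 / real n powr (real (r + 2) / 2)" .
    qed (use G ln1 in auto)
    also have "\<dots> = (\<bar>Q\<bar> + G) * 3 * norm (ln (real n) ^ (if odd r then 1 else 0) / real n powr (real (r + 2) / 2))"
      using ln1 by simp
    finally show "norm (p n - (\<Sum>j=1..r div 2 + 1. \<nu> j * acoeff j n)) \<le> (\<bar>Q\<bar> + G) * 3 * norm (ln (real n) ^ (if odd r then 1 else 0) / real n powr (real (r + 2) / 2))"
      by (simp only: real_norm_def)
  qed
qed

section \<open>The theorem\<close>

text \<open>In \<open>enat\<close>, exceeding n means being at least Suc n, a form that passes
  through the infimum, including that of the empty set.\<close>

lemma less_INF_enat: "enat n < (INF k\<in>A. enat k) \<longleftrightarrow> (\<forall>k\<in>A. n < k)"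
proof -
  have "enat n < (INF k\<in>A. enat k) \<longleftrightarrow> enat (Suc n) \<le> (INF k\<in>A. enat k)" by (simp add: Suc_ile_eq)
  also have "\<dots> \<longleftrightarrow> (\<forall>k\<in>A. n < k)" by (simp add: le_INF_iff Suc_le_eq)
  finally show ?thesis .
qed

lemma partial_sum_psum: "partial_sum X n \<omega> = psum (\<lambda>i. X (Suc i) \<omega>) n"
proof -
  have "(\<Sum>i=1..n. X i \<omega>) = (\<Sum>i<n. X (Suc i) \<omega>)"
    by (rule sum.reindex_bij_witness[of _ Suc "\<lambda>i. i - 1"]) auto
  thus ?thesis by (simp add: partial_sum_def psum_def)
qed

text \<open>\<open>tau0\<close> stops at S_k <= 0, so survival means S_k > 0;
  \<open>tau0_bar\<close> stops at S_k < 0, so survival means S_k >= 0.\<close>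

interpretation strict: half_line "\<lambda>x. 0 < x"
  by unfold_locales auto

interpretation weak: half_line "\<lambda>x. 0 \<le> x"
  by unfold_locales auto

lemma tau0_gt: "enat n < tau0 X \<omega> \<longleftrightarrow> strict.stays n (\<lambda>i. X (Suc i) \<omega>)"
  unfolding tau0_def less_INF_enat strict.stays_def partial_sum_psum[symmetric]
  by (auto simp: not_le[symmetric])

lemma tau0_bar_gt: "enat n < tau0_bar X \<omega> \<longleftrightarrow> weak.stays n (\<lambda>i. X (Suc i) \<omega>)"
  unfolding tau0_bar_def less_INF_enat weak.stays_def partial_sum_psum[symmetric]
  by (auto simp: not_le[symmetric])

lemma (in real_distribution) AE_Ints_iff: "prob \<int> = 1 \<longleftrightarrow> (AE x in M. x \<in> \<int>)"
  using prob_eq_1[of "\<int>"] by simp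

text \<open>The indicator of x > 0 is 1/2 + sgn x / 2 minus half the indicator of 0, with plus
  instead for x >= 0. So the sign expectation and the atom at 0 determine both
  probabilities.\<close>

lemma (in real_distribution) half_line_probs:
  "prob {0<..} = 1 / 2 + (1 / 2 * (LINT x|M. sgn x) + (- 1 / 2) * prob {0})"
  "prob {0..} = 1 / 2 + (1 / 2 * (LINT x|M. sgn x) + 1 / 2 * prob {0})"
proof -
  have s: "integrable M (\<lambda>x. sgn x)" by (rule integrable_const_bound[where B = 1]) (auto simp: abs_sgn_eq)
  have i: "integrable M (\<lambda>x. indicator A x :: real)" if "A \<in> sets borel" for A
    using that by (intro integrable_real_indicator) (auto simp: emeasure_eq_measure)
  have "(LINT x|M. indicator {0<..} x) = (LINT x|M. 1 / 2 + (1 / 2 * sgn x + (- 1 / 2) * indicator {0} x))"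
    by (rule Bochner_Integration.integral_cong) (auto simp: indicator_def sgn_if)
  also have "\<dots> = (LINT x|M. 1 / 2) + ((LINT x|M. 1 / 2 * sgn x) + (LINT x|M. (- 1 / 2) * indicator {0} x))"
    using s i[of "{0}"] by (subst Bochner_Integration.integral_add) auto
  finally show "prob {0<..} = 1 / 2 + (1 / 2 * (LINT x|M. sgn x) + (- 1 / 2) * prob {0})"
    using prob_space by simp
  have "(LINT x|M. indicator {0..} x) = (LINT x|M. 1 / 2 + (1 / 2 * sgn x + 1 / 2 * indicator {0} x))"
    by (rule Bochner_Integration.integral_cong) (auto simp: indicator_def sgn_if)
  also have "\<dots> = (LINT x|M. 1 / 2) + ((LINT x|M. 1 / 2 * sgn x) + (LINT x|M. 1 / 2 * indicator {0} x))"
    using s i[of "{0}"] by (subst Bochner_Integration.integral_add) auto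
  finally show "prob {0..} = 1 / 2 + (1 / 2 * (LINT x|M. sgn x) + 1 / 2 * prob {0})"
    using prob_space by simp
qed

theorem theorem1:
  fixes M :: "'a measure" and X :: "nat \<Rightarrow> 'a \<Rightarrow> real" and r :: nat
  assumes "prob_space M"
    and indep: "prob_space.indep_vars M (\<lambda>_. borel) X {1..}"
    and ident: "\<And>i. i \<ge> 1 \<Longrightarrow> distr M borel (X i) = distr M borel (X 1)"
    and mean: "integrable M (X 1)" "(LINT \<omega>|M. X 1 \<omega>) = 0"
    and second_moment: "integrable M (\<lambda>\<omega>. (X 1 \<omega>)\<^sup>2)" "(LINT \<omega>|M. (X 1 \<omega>)\<^sup>2) > 0"
    and moment: "integrable M (\<lambda>\<omega>. \<bar>X 1 \<omega>\<bar> ^ (r + 3))"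
    and "lattice_max_span_1 (distr M borel (X 1)) \<or>
         Limsup at_infinity (\<lambda>t. ereal (cmod (char (distr M borel (X 1)) t))) < 1"
  shows "(\<exists>\<nu> :: nat \<Rightarrow> real.
           (\<lambda>n. measure M {\<omega> \<in> space M. tau0 X \<omega> > enat n}
                - (\<Sum>j = 1..r div 2 + 1. \<nu> j * acoeff j n))
           \<in> O(\<lambda>n. ln (real n) ^ (if odd r then 1 else 0) / real n powr (real (r + 2) / 2))) \<and>
         (\<exists>\<nu>' :: nat \<Rightarrow> real.
           (\<lambda>n. measure M {\<omega> \<in> space M. tau0_bar X \<omega> > enat n}
                - (\<Sum>j = 1..r div 2 + 1. \<nu>' j * acoeff j n))
           \<in> O(\<lambda>n. ln (real n) ^ (if odd r then 1 else 0) / real n powr (real (r + 2) / 2)))"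
proof -
  interpret prob_space M by fact
  \<comment> \<open>The steps are renumbered from 0, as \<open>psum\<close> requires.\<close>
  define Y where "Y i = X (Suc i)" for i
  have Xm: "X i \<in> borel_measurable M" if "i \<ge> 1" for i using indep that unfolding indep_vars_def by auto
  have Ym [measurable]: "Y i \<in> borel_measurable M" for i using Xm by (simp add: Y_def)
  have Yind: "indep_vars (\<lambda>_. borel) Y UNIV"
  proof -
    have "indep_vars (\<lambda>j. PiM {Suc j} (\<lambda>_. borel)) (\<lambda>j \<omega>. restrict (\<lambda>i. X i \<omega>) {Suc j}) UNIV"
      by (intro indep_vars_restrict[OF indep]) (auto simp: disjoint_family_on_def)
    from indep_vars_compose2[OF this, of "\<lambda>j z. z (Suc j)" "\<lambda>_. borel"]
    show ?thesis by (simp add: Y_def[abs_def])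
  qed
  have Yid: "distr M borel (Y i) = distr M borel (X 1)" for i unfolding Y_def by (rule ident) simp
  let ?\<mu> = "distr M borel (X 1)"
  interpret \<mu>: real_distribution ?\<mu> using Xm by simp
  define \<nu> where "\<nu> n = distr M borel (\<lambda>\<omega>. psum (\<lambda>i. Y i \<omega>) n)" for n
  have Sm [measurable]: "(\<lambda>\<omega>. psum (\<lambda>i. Y i \<omega>) n) \<in> borel_measurable M" for n unfolding psum_def by measurable
  have \<nu>_dist: "real_distribution (\<nu> n)" for n unfolding \<nu>_def by simp
  have Yint: "integrable M (Y i)" for i
  proof -
    have "integrable ?\<mu> (\<lambda>x. x)" using mean(1) Xm[of 1] by (simp add: integrable_distr_eq)
    thus ?thesis unfolding Yid[of i, symmetric] by (simp add: integrable_distr_eq)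
  qed
  have \<nu>int: "integrable (\<nu> n) (\<lambda>x. x)" for n
    unfolding \<nu>_def using Yint by (simp add: integrable_distr_eq psum_def)
  have char_\<nu>: "char (\<nu> n) t = char ?\<mu> t ^ n" for n t
    unfolding \<nu>_def psum_def using char_distr_sum[OF indep_vars_subset[OF Yind, of "{..<n}"], of t] by (simp add: Yid)
  interpret edgeworth_setting ?\<mu> r \<nu>
  proof (intro edgeworth_setting.intro edgeworth_setting_axioms.intro)
    show "integrable ?\<mu> (\<lambda>x. \<bar>x\<bar> ^ (r + 3))" using moment Xm[of 1] by (simp add: integrable_distr_eq)
    show "(LINT x|?\<mu>. x) = 0" using mean Xm[of 1] by (simp add: integral_distr)
    show "0 < (LINT x|?\<mu>. x\<^sup>2)" using second_moment Xm[of 1] by (simp add: integral_distr)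
  qed (rule \<mu>.real_distribution_axioms \<nu>_dist \<nu>int char_\<nu>)+
  have half: "half_int_expansion r (\<lambda>n. LINT x|\<nu> n. sgn x) \<and> half_int_expansion r (\<lambda>n. measure (\<nu> n) {0})"
    using assms(9)
  proof
    assume lat: "lattice_max_span_1 ?\<mu>"
    have ae: "AE x in ?\<mu>. x \<in> \<int>"
      using lat unfolding lattice_max_span_1_def \<mu>.AE_Ints_iff by (rule conjunct1)
    have "measure (\<nu> n) \<int> = 1" for n
    proof -
      have "AE \<omega> in M. Y i \<omega> \<in> \<int>" for i
        using ae unfolding Yid[of i, symmetric] by (rule AE_distrD[OF Ym])
      hence "AE \<omega> in M. \<forall>i\<in>{..<n}. Y i \<omega> \<in> \<int>" by (intro AE_finite_allI) auto
      hence a: "AE \<omega> in M. psum (\<lambda>i. Y i \<omega>) n \<in> \<int>"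
        by (rule eventually_mono) (auto simp: psum_def)
      have z: "{x \<in> space borel. x \<in> (\<int> :: real set)} \<in> sets borel" by simp
      show ?thesis
        unfolding real_distribution.AE_Ints_iff[OF \<nu>_dist] unfolding \<nu>_def using a
        by (rule AE_distr_iff[OF Sm z, THEN iffD2])
    qed
    with expansion_lattice char_bound_lattice[OF \<mu>.real_distribution_axioms lat] show ?thesis by blast
  next
    assume lim: "Limsup at_infinity (\<lambda>t. ereal (cmod (char ?\<mu> t))) < 1"
    with expansion_smooth char_bound_limsup[OF \<mu>.real_distribution_axioms lim] show ?thesis by blast
  qed
  note probs = real_distribution.half_line_probs[OF \<nu>_dist]
  have "half_int_expansion r (\<lambda>n. 1 / 2 * (LINT x|\<nu> n. sgn x) + (- 1 / 2) * measure (\<nu> n) {0})"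
    using half by (intro half_int_expansion_add half_int_expansion_cmult) auto
  hence h1: "half_int_expansion r (\<lambda>n. measure (\<nu> n) {0<..} - 1 / 2)" unfolding probs(1) by simp
  have "half_int_expansion r (\<lambda>n. 1 / 2 * (LINT x|\<nu> n. sgn x) + 1 / 2 * measure (\<nu> n) {0})"
    using half by (intro half_int_expansion_add half_int_expansion_cmult) auto
  hence h2: "half_int_expansion r (\<lambda>n. measure (\<nu> n) {0..} - 1 / 2)" unfolding probs(2) by simp
  interpret s: iid_walk M "\<lambda>x. 0 < x" Y
    using Yind Yid by unfold_locales auto
  interpret w: iid_walk M "\<lambda>x. 0 \<le> x" Y
    using Yind Yid by unfold_locales auto
  have p1: "s.pos_prob n = measure (\<nu> n) {0<..}" for n
    unfolding s.pos_prob_def \<nu>_def by (subst measure_distr) (auto intro!: arg_cong[where f = prob])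
  have p2: "w.pos_prob n = measure (\<nu> n) {0..}" for n
    unfolding w.pos_prob_def \<nu>_def by (subst measure_distr) (auto intro!: arg_cong[where f = prob])
  have st1: "s.stay_prob n = measure M {\<omega> \<in> space M. tau0 X \<omega> > enat n}" for n
    unfolding s.stay_prob_def tau0_gt Y_def ..
  have st2: "w.stay_prob n = measure M {\<omega> \<in> space M. tau0_bar X \<omega> > enat n}" for n
    unfolding w.stay_prob_def tau0_bar_gt Y_def ..
  have "half_int_expansion r (\<lambda>n. s.pos_prob n - 1 / 2)" unfolding p1 by (rule h1)
  from coefficient_expansion[OF s.stay_prob_deriv this]
  have 1: "\<exists>\<nu>. (\<lambda>n. s.stay_prob n - (\<Sum>j=1..r div 2 + 1. \<nu> j * acoeff j n))
           \<in> O(\<lambda>n. ln (real n) ^ (if odd r then 1 else 0) / real n powr (real (r + 2) / 2))" .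
  have "half_int_expansion r (\<lambda>n. w.pos_prob n - 1 / 2)" unfolding p2 by (rule h2)
  from coefficient_expansion[OF w.stay_prob_deriv this]
  have 2: "\<exists>\<nu>. (\<lambda>n. w.stay_prob n - (\<Sum>j=1..r div 2 + 1. \<nu> j * acoeff j n))
           \<in> O(\<lambda>n. ln (real n) ^ (if odd r then 1 else 0) / real n powr (real (r + 2) / 2))" .
  show ?thesis using 1 2 unfolding st1 st2 by (rule conjI)
qed

end
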